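(* Let $1\leq p\leq\infty$, let $\Omega\subset\mathbb{R}^n$ be open, and let $A:L^p(\Omega)\to L^p(\Omega)$ be a bounded linear operator. Let $\alpha_0\in(0,1)$, let $\alpha\in L^\infty(\Omega)$ satisfy $\alpha(x)\in[\alpha_0,1]$ for almost every $x\in\Omega$, and let $u_0\in L^p(\Omega)$. Then the Cauchy problem $$cD_t^{\alpha(x)}u(t,x)=Au(t,x),\qquad u(0,x)=u_0(x)$$ has a unique solution in $[0,\infty)\times\Omega$.
   Context: For $\varphi:I\times\Omega\to\mathbb{R}$ and $\beta:\Omega\to[0,1]$, the Riemann-Liouville fractional integral of order $\beta(x)$ is $J_t^{\beta(x)}\varphi(t,x)=\frac{1}{\Gamma(\beta(x))}\int_0^t(t-s)^{\beta(x)-1}\varphi(s,x)\,ds$ if $\beta(x)\in(0,1]$, and $J_t^{\beta(x)}\varphi(t,x)=\varphi(t,x)$ if $\beta(x)=0$. The Riemann-Liouville fractional derivative of order $\alpha(x)$ is $D_t^{\alpha(x)}\varphi(t,x)=\frac{d}{dt}\big[J_t^{1-\alpha(x)}\varphi(t,x)\big]$, and the Caputo fractional derivative of order $\alpha(x)$ is $cD_t^{\alpha(x)}\varphi(t,x)=D_t^{\alpha(x)}\big[\varphi(t,x)-\varphi(0,x)\big]$, wherever the right-hand sides exist. For $I=[0,T]$ or $I=[0,\infty)$, a solution of the Cauchy problem in $I\times\Omega$ is a function $\varphi\in C(I;L^p(\Omega))$ such that (i) $cD_t^{\alpha(x)}\varphi(t,x)=A\varphi(t,x)$ for every $t\in I$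 and almost every $x\in\Omega$, and (ii) $\varphi(0,x)=u_0(x)$ for almost every $x\in\Omega$. Here a function $\varphi\in C(I;L^p(\Omega))$ is identified with $(t,x)\mapsto\varphi(t)(x)$, and $A\varphi(t,x)=(A\varphi(t,\cdot))(x)$.
   Formalization: A solution is taken jointly measurable in (t,x), and off one null set of x independent of t its Caputo derivative must exist at every t; with null sets depending on t uniqueness fails (p<∞, Ω=(0,1), α=1, A=0, u0=0, φ(t,x)=1 if x<t, else 0). *)

theory Defs
  imports "HOL-Analysis.Analysis" "HOL-Probability.Essential_Supremum"
begin

text \<open>Elements of \<open>L\<^sup>p\<close> are handled through representatives: equality in \<open>L\<^sup>p\<close> is equality
  almost everywhere, and an operator on \<open>L\<^sup>p\<close> is a map on representatives whose
  laws hold almost everywhere.\<close>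

definition Lp_space :: "'a measure \<Rightarrow> ereal \<Rightarrow> ('a \<Rightarrow> real) set" where
  "Lp_space M p = {f \<in> borel_measurable M.
     if p = \<infinity> then esssup M (\<lambda>x. ereal \<bar>f x\<bar>) < \<infinity>
     else integrable M (\<lambda>x. \<bar>f x\<bar> powr real_of_ereal p)}"

definition Lp_norm :: "'a measure \<Rightarrow> ereal \<Rightarrow> ('a \<Rightarrow> real) \<Rightarrow> real" where
  "Lp_norm M p f =
     (if p = \<infinity> then real_of_ereal (esssup M (\<lambda>x. ereal \<bar>f x\<bar>))
      else (LINT x|M. \<bar>f x\<bar> powr real_of_ereal p) powr (1 / real_of_ereal p))"

definition bounded_linear_Lp ::
  "'a measure \<Rightarrow> ereal \<Rightarrow> (('a \<Rightarrow> real) \<Rightarrow> ('a \<Rightarrow> real)) \<Rightarrow> bool" where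
  "bounded_linear_Lp M p A \<longleftrightarrow>
     (\<forall>f\<in>Lp_space M p. A f \<in> Lp_space M p) \<and>
     (\<forall>f\<in>Lp_space M p. \<forall>g\<in>Lp_space M p.
        (AE x in M. f x = g x) \<longrightarrow> (AE x in M. A f x = A g x)) \<and>
     (\<forall>f\<in>Lp_space M p. \<forall>g\<in>Lp_space M p.
        AE x in M. A (\<lambda>y. f y + g y) x = A f x + A g x) \<and>
     (\<forall>c. \<forall>f\<in>Lp_space M p. AE x in M. A (\<lambda>y. c * f y) x = c * A f x) \<and>
     (\<exists>C. \<forall>f\<in>Lp_space M p. Lp_norm M p (A f) \<le> C * Lp_norm M p f)"

definition continuous_into_Lp ::
  "real set \<Rightarrow> 'a measure \<Rightarrow> ereal \<Rightarrow> (real \<Rightarrow> 'a \<Rightarrow> real) \<Rightarrow> bool" where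
  "continuous_into_Lp I M p \<phi> \<longleftrightarrow>
     (\<forall>t\<in>I. \<phi> t \<in> Lp_space M p) \<and>
     (\<forall>t\<in>I. ((\<lambda>s. Lp_norm M p (\<lambda>x. \<phi> s x - \<phi> t x)) \<longlongrightarrow> 0) (at t within I))"

text \<open>A Lebesgue integral that diverges has the value 0 in the library, so the existence of the
  fractional integral is a separate predicate.\<close>

definition RL_integral_exists :: "real \<Rightarrow> (real \<Rightarrow> real) \<Rightarrow> real \<Rightarrow> bool" where
  "RL_integral_exists \<beta> f t \<longleftrightarrow>
     \<beta> = 0 \<or> (\<lambda>s. (t - s) powr (\<beta> - 1) * f s) absolutely_integrable_on {0..t}"

definition RL_integral :: "real \<Rightarrow> (real \<Rightarrow> real) \<Rightarrow> real \<Rightarrow> real" where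
  "RL_integral \<beta> f t =
     (if \<beta> = 0 then f t
      else 1 / Gamma \<beta> * (LINT s:{0..t}|lebesgue. (t - s) powr (\<beta> - 1) * f s))"

text \<open>The derivative is taken relative to the time interval \<open>I\<close>, hence one-sided at its
  endpoints.\<close>

definition has_RL_derivative ::
  "real set \<Rightarrow> real \<Rightarrow> (real \<Rightarrow> real) \<Rightarrow> real \<Rightarrow> real \<Rightarrow> bool" where
  "has_RL_derivative I \<alpha> f t D \<longleftrightarrow>
     (\<forall>\<^sub>F s in nhds t. s \<in> I \<longrightarrow> RL_integral_exists (1 - \<alpha>) f s) \<and>
     (RL_integral (1 - \<alpha>) f has_real_derivative D) (at t within I)"

definition has_Caputo_derivative ::
  "real set \<Rightarrow> real \<Rightarrow> (real \<Rightarrow> real) \<Rightarrow> real \<Rightarrow> real \<Rightarrow> bool" where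
  "has_Caputo_derivative I \<alpha> f t D \<longleftrightarrow> has_RL_derivative I \<alpha> (\<lambda>s. f s - f 0) t D"

text \<open>A curve in \<open>L\<^sup>p\<close> is identified with a function on \<open>I \<times> \<Omega>\<close> that is jointly Lebesgue
  measurable; such a representative always exists, and without joint measurability the integrals
  over \<open>s\<close> at fixed \<open>x\<close> would not be determined by the curve.

  The clause ``for every \<open>t\<close> and almost every \<open>x\<close>'' is read so that, off one null set of \<open>x\<close>, the
  Caputo derivative exists at every \<open>t\<close>.  Its value is compared with \<open>A (\<phi> t)\<close>, a class of functions
  modulo null sets, for each \<open>t\<close> separately.  If the null set where the derivative fails to exist
  could also depend on \<open>t\<close>, uniqueness would fail: for \<open>p < \<infinity>\<close>, \<open>\<Omega> = (0,1)\<close>, \<open>\<alpha> = 1\<close> and \<open>A = 0\<close>,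
  the indicator function of \<open>x < t\<close> would be a second solution with zero initial value.\<close>

definition solves_Cauchy_problem ::
  "real set \<Rightarrow> 'a::euclidean_space set \<Rightarrow> ereal \<Rightarrow> ('a \<Rightarrow> real) \<Rightarrow> (('a \<Rightarrow> real) \<Rightarrow> ('a \<Rightarrow> real))
     \<Rightarrow> ('a \<Rightarrow> real) \<Rightarrow> (real \<Rightarrow> 'a \<Rightarrow> real) \<Rightarrow> bool" where
  "solves_Cauchy_problem I \<Omega> p \<alpha> A u0 \<phi> \<longleftrightarrow>
     (\<lambda>(t, x). \<phi> t x) \<in> borel_measurable (lebesgue_on (I \<times> \<Omega>)) \<and>
     continuous_into_Lp I (lebesgue_on \<Omega>) p \<phi> \<and>
     (AE x in lebesgue_on \<Omega>. \<forall>t\<in>I. \<exists>D. has_Caputo_derivative I (\<alpha> x) (\<lambda>s. \<phi> s x) t D) \<and>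
     (\<forall>t\<in>I. AE x in lebesgue_on \<Omega>.
        has_Caputo_derivative I (\<alpha> x) (\<lambda>s. \<phi> s x) t (A (\<phi> t) x)) \<and>
     (AE x in lebesgue_on \<Omega>. \<phi> 0 x = u0 x)"

end

theory Submission
  imports Defs
begin

text \<open>Time is expanded in Laguerre polynomials \<open>L\<^sub>n (c t)\<close>.  The operator of fractional integration acts
  on them as a triangular Toeplitz matrix,
  \<open>J\<^sup>\<beta> L\<^sub>j = c\<^sup>-\<^sup>\<beta> (\<Sum>i. b\<^sub>i L\<^sub>i\<^sub>+\<^sub>j)\<close> with \<open>b\<^sub>i = (-1)\<^sup>i (\<beta> choose i)\<close>: formally, \<open>J = (1 - S) / c\<close> for the
  shift \<open>S\<close>.  The suprema of \<open>\<bar>b\<^sub>i\<bar>\<close> over \<open>\<beta> \<in> [\<alpha>0, 1]\<close> are summable, so for large \<open>c\<close> the integral equation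
  \<open>u = u0 + J\<^sup>\<alpha> A u\<close> becomes a contraction for the coefficients in \<open>\<ell>\<^sup>1(L\<^sup>p)\<close>.  The resulting series
  converges absolutely for almost every \<open>x\<close>, locally uniformly in time, so that off one null set the
  Caputo derivative exists at every time and can be computed termwise.

  For uniqueness, the difference \<open>w\<close> of two solutions satisfies \<open>J\<^sup>1\<^sup>-\<^sup>\<alpha> w = J A w\<close>.  Pairing with the same
  series in \<open>T - s\<close> shows that the moments \<open>\<integral> (L\<^sub>j - L\<^sub>j\<^sub>+\<^sub>1)(c (T - s)) w(s) ds\<close> over \<open>[0, T]\<close>, which are
  bounded in \<open>L\<^sup>p\<close>, satisfy the adjoint homogeneous system, again a contraction; hence they vanish.
  For \<open>j = 0\<close> this says \<open>\<integral> (T - s) w(s) ds = 0\<close> for all \<open>T\<close>, and second differences in \<open>T\<close> recover \<open>w\<close>.\<close>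

text \<open>The obstacle is that the order depends on \<open>x\<close>: \<open>A\<close> does not
  commute with multiplication by functions of \<open>x\<close>, so no fractional calculus of a
  single order applies to the curve. In Laguerre coefficients the order survives only in the bounded
  multipliers \<open>c powr (-\<alpha> x) * binc (\<alpha> x) i\<close>, and \<open>A\<close> acts
  on functions of \<open>x\<close> alone. The lower bound \<alpha>0 > 0 makes
  \<open>c powr (-\<alpha> x)\<close> uniformly small for large \<open>c\<close>, and a bound on the
  Laguerre polynomials that is uniform in the degree turns summable coefficients into locally
  uniform convergence. Uniqueness cannot expand the unknown in the same way, since an arbitrary
  solution has no growth bound on the half line that would make its coefficients summable. On a
  finite horizon bounded moments suffice. Two points then need care: \<open>A\<close> must pass
  through a time integral, and \<open>A w\<close>, known as a derivative in time but perhaps not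
  continuous at fixed \<open>x\<close>, must be integrated back. The latter works because, off one
  null set, the derivative exists at every time.\<close>

section \<open>Signed binomial coefficients\<close>

definition binc :: "real \<Rightarrow> nat \<Rightarrow> real" where
  "binc \<beta> n = (-1) ^ n * (\<beta> gchoose n)"

lemma binc_0 [simp]: "binc \<beta> 0 = 1"
  by (simp add: binc_def)

lemma binc_Suc: "real (Suc n) * binc \<beta> (Suc n) = (real n - \<beta>) * binc \<beta> n"
proof -
  have "\<beta> * (\<beta> - 1 gchoose n) = (\<beta> - real n) * (\<beta> gchoose n)"
    using gbinomial_absorb_comp[of \<beta> n] by simp
  then have *: "real (Suc n) * (\<beta> gchoose Suc n) = (\<beta> - real n) * (\<beta> gchoose n)"
    using gbinomial_absorption[of n \<beta>] by simp
  have "real (Suc n) * binc \<beta> (Suc n) = - ((-1) ^ n) * (real (Suc n) * (\<beta> gchoose Suc n))"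
    by (simp add: binc_def mult_ac)
  also have "\<dots> = (real n - \<beta>) * binc \<beta> n"
    unfolding * by (simp add: binc_def left_diff_distrib mult_ac)
  finally show ?thesis .
qed

lemma binc_Suc': "binc \<beta> (Suc n) = (real n - \<beta>) / real (Suc n) * binc \<beta> n"
  using binc_Suc[of n \<beta>] by (simp add: field_simps)

text \<open>Taking partial sums divides the generating function \<open>(1 - X)^\<beta>\<close> by
  \<open>1 - X\<close>, which lowers the exponent by one.\<close>

lemma sum_binc: "(\<Sum>k\<le>m. binc \<beta> k) = binc (\<beta> - 1) m"
  using gbinomial_sum_lower_neg[of \<beta> m] by (simp add: binc_def mult.commute)

lemma binc_nonneg: "\<beta> \<le> 0 \<Longrightarrow> 0 \<le> binc \<beta> n"
  by (induction n) (auto simp: binc_Suc')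

lemma binc_via_pred: "real (Suc n) * binc \<beta> (Suc n) = - \<beta> * binc (\<beta> - 1) n"
  using gbinomial_absorption[of n \<beta>] by (simp add: binc_def mult_ac)

lemma binc_via_pred': "binc \<beta> (Suc n) = - \<beta> * binc (\<beta> - 1) n / real (Suc n)"
  using binc_via_pred[of n \<beta>] by (simp add: field_simps)

lemma abs_binc_Suc:
  assumes "0 \<le> \<beta>" "\<beta> \<le> 1"
  shows "\<bar>binc \<beta> (Suc n)\<bar> = - binc \<beta> (Suc n)"
  using assms binc_nonneg[of "\<beta> - 1" n] by (simp add: binc_via_pred' divide_simps)

text \<open>Every coefficient after the leading 1 is nonpositive, so the absolute values add up to 1
  minus a partial sum of the signed coefficients, and that partial sum is nonnegative.\<close>

lemma sum_abs_binc_le: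
  assumes "0 \<le> \<beta>" "\<beta> \<le> 1"
  shows "(\<Sum>k<m. \<bar>binc \<beta> (Suc k)\<bar>) \<le> 1"
proof -
  have "(\<Sum>k<m. \<bar>binc \<beta> (Suc k)\<bar>) = 1 - (\<Sum>k\<le>m. binc \<beta> k)"
    using assms by (simp add: abs_binc_Suc sum.atMost_shift sum_negf)
  then show ?thesis
    using binc_nonneg[of "\<beta> - 1" m] assms by (simp add: sum_binc)
qed

lemma summable_abs_binc:
  assumes "0 \<le> \<beta>" "\<beta> \<le> 1"
  shows "summable (\<lambda>k. \<bar>binc \<beta> k\<bar>)"
proof -
  have "summable (\<lambda>k. \<bar>binc \<beta> (Suc k)\<bar>)"
    by (rule bounded_imp_summable[of _ 1])
       (use sum_abs_binc_le[OF assms] in \<open>auto simp del: sum.lessThan_Suc simp flip: lessThan_Suc_atMost\<close>)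
  then show ?thesis by (subst (asm) summable_Suc_iff)
qed

lemma decseq_binc:
  assumes "- 1 \<le> \<gamma>" "\<gamma> \<le> 0"
  shows "decseq (binc \<gamma>)"
proof (rule decseq_SucI)
  fix n
  have "(real n - \<gamma>) / real (Suc n) \<le> 1" using assms by simp
  from mult_right_mono[OF this, of "binc \<gamma> n"] show "binc \<gamma> (Suc n) \<le> binc \<gamma> n"
    using binc_nonneg[of \<gamma> n] assms by (simp add: binc_Suc')
qed

text \<open>Comparison with the harmonic series: by the absorption identity a positive limit
  \<open>s\<close> would force \<open>\<bar>binc (\<gamma> + 1) (Suc n)\<bar>\<close> to be at least
  \<open>(\<gamma> + 1) * s / Suc n\<close>, against \<open>summable_abs_binc\<close>.\<close>

lemma binc_tendsto_0:
  assumes "- 1 < \<gamma>" "\<gamma> \<le> 0"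
  shows "binc \<gamma> \<longlonglongrightarrow> 0"
proof (cases "\<gamma> = 0")
  case True
  have "binc \<gamma> (Suc n) = 0" for n
    by (induction n) (auto simp: True binc_Suc')
  then have "(\<lambda>n. binc \<gamma> (Suc n)) \<longlonglongrightarrow> 0" by simp
  then show ?thesis by (rule LIMSEQ_imp_Suc)
next
  case False
  define \<beta> where "\<beta> = \<gamma> + 1"
  have \<beta>: "0 < \<beta>" "\<beta> \<le> 1" using assms by (auto simp: \<beta>_def)
  from decseq_binc[of \<gamma>] assms obtain s where s: "binc \<gamma> \<longlonglongrightarrow> s" and le: "\<And>n. s \<le> binc \<gamma> n"
    by (metis decseq_convergent binc_nonneg less_imp_le)
  have s0: "0 \<le> s" by (rule LIMSEQ_le_const[OF s]) (use assms in \<open>auto intro: binc_nonneg\<close>)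
  have "s = 0"
  proof (rule ccontr)
    assume "s \<noteq> 0"
    with s0 have sp: "0 < s" by simp
    have *: "norm (inverse (real (Suc n))) \<le> \<bar>binc \<beta> (Suc n)\<bar> * (1 / (\<beta> * s))" for n
    proof -
      have "\<bar>binc \<beta> (Suc n)\<bar> = \<beta> * binc \<gamma> n / real (Suc n)"
        using \<beta> assms binc_nonneg[of \<gamma> n]
        by (subst abs_binc_Suc) (auto simp: binc_via_pred' \<beta>_def algebra_simps divide_simps)
      moreover have "\<beta> * s \<le> \<beta> * binc \<gamma> n" using le \<beta> by simp
      ultimately show ?thesis using \<beta> sp by (simp add: field_simps)
    qed
    have "summable (\<lambda>n. \<bar>binc \<beta> (Suc n)\<bar> * (1 / (\<beta> * s)))"
      using summable_abs_binc[of \<beta>] \<beta>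
      by (intro summable_mult2) (auto simp: summable_Suc_iff[of "\<lambda>n. \<bar>binc \<beta> n\<bar>"])
    then have "summable (\<lambda>n. inverse (real (Suc n)))"
      by (rule summable_comparison_test'[where N = 0]) (use * in auto)
    then have "summable (\<lambda>n. inverse (real n))" by (subst (asm) summable_Suc_iff)
    then show False using not_summable_harmonic[where 'a = real] by simp
  qed
  with s show ?thesis by simp
qed

text \<open>The value of \<open>(1 - X)^\<beta>\<close> at \<open>X = 1\<close>. Since every
  Laguerre polynomial equals 1 at the origin, it makes the series of a fractional integral vanish at
  time 0.\<close>

lemma binc_sums_0:
  assumes "0 < \<beta>" "\<beta> \<le> 1"
  shows "binc \<beta> sums 0"
  unfolding sums_def_le sum_binc using assms by (intro binc_tendsto_0) auto

section \<open>The power series (1 - X)^\<beta> and bounds uniform in the exponent\<close>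

definition bincF :: "real \<Rightarrow> real fps" where
  "bincF \<beta> = Abs_fps (binc \<beta>)"

lemma bincF_nth [simp]: "fps_nth (bincF \<beta>) n = binc \<beta> n"
  by (simp add: bincF_def)

text \<open>Vandermonde's convolution. On Laguerre coefficients it becomes the semigroup law of
  fractional integration.\<close>

lemma bincF_mult: "bincF \<alpha> * bincF \<beta> = bincF (\<alpha> + \<beta>)"
proof (rule fps_ext)
  fix n
  have "fps_nth (bincF \<alpha> * bincF \<beta>) n = (\<Sum>k=0..n. (-1) ^ n * ((\<alpha> gchoose k) * (\<beta> gchoose (n - k))))"
    unfolding fps_mult_nth bincF_nth binc_def
    by (intro sum.cong refl) (simp add: mult_ac flip: power_add)
  also have "\<dots> = binc (\<alpha> + \<beta>) n"
    by (simp add: binc_def gbinomial_Vandermonde flip: sum_distrib_left)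
  finally show "fps_nth (bincF \<alpha> * bincF \<beta>) n = fps_nth (bincF (\<alpha> + \<beta>)) n" by simp
qed

lemma bincF_1: "bincF 1 = 1 - fps_X"
proof (rule fps_ext)
  fix n
  have "binc 1 (Suc (Suc m)) = 0" for m
    by (induction m) (auto simp: binc_Suc')
  then show "fps_nth (bincF 1) n = fps_nth (1 - fps_X) n"
    by (cases n; cases "n - 1") (auto simp: binc_Suc')
qed

text \<open>A majorant for all exponents in \<open>[\<alpha>0, 1]\<close>. For \<open>n > 0\<close>
  the modulus of \<open>binc \<beta> n\<close> is
  \<open>\<beta> * binc (\<beta> - 1) (n - 1) / n\<close>; the second factor is largest at
  \<alpha>0, while the first is replaced by 1 instead of \<alpha>0, whence the division.\<close>

definition binc_bound :: "real \<Rightarrow> nat \<Rightarrow> real" where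
  "binc_bound \<alpha>0 n = (if n = 0 then 1 else \<bar>binc \<alpha>0 n\<bar> / \<alpha>0)"

lemma binc_bound_nonneg: "0 < \<alpha>0 \<Longrightarrow> 0 \<le> binc_bound \<alpha>0 n"
  by (simp add: binc_bound_def)

lemma binc_antimono:
  assumes "\<gamma> \<le> \<gamma>'" "\<gamma>' \<le> 0"
  shows "binc \<gamma>' n \<le> binc \<gamma> n"
proof (induction n)
  case (Suc n)
  have "(real n - \<gamma>') / real (Suc n) * binc \<gamma>' n \<le> (real n - \<gamma>) / real (Suc n) * binc \<gamma> n"
    using assms Suc binc_nonneg[of \<gamma>' n] by (intro mult_mono divide_right_mono) auto
  then show ?case by (simp only: binc_Suc')
qed simp

lemma abs_binc_le_bound:
  assumes "0 < \<alpha>0" "\<alpha>0 \<le> \<beta>" "\<beta> \<le> 1"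
  shows "\<bar>binc \<beta> n\<bar> \<le> binc_bound \<alpha>0 n"
proof (cases n)
  case (Suc m)
  have "\<beta> * binc (\<beta> - 1) m \<le> 1 * binc (\<alpha>0 - 1) m"
    using assms binc_nonneg[of "\<beta> - 1" m] by (intro mult_mono binc_antimono) auto
  then have "\<bar>binc \<beta> (Suc m)\<bar> \<le> binc (\<alpha>0 - 1) m / real (Suc m)"
    using assms by (subst abs_binc_Suc) (auto simp: binc_via_pred' divide_simps)
  also have "\<dots> = binc_bound \<alpha>0 (Suc m)"
    using assms unfolding binc_bound_def by (subst abs_binc_Suc) (auto simp: binc_via_pred')
  finally show ?thesis by (simp add: Suc)
qed (simp add: binc_bound_def)

lemma summable_binc_bound:
  assumes "0 < \<alpha>0" "\<alpha>0 \<le> 1"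
  shows "summable (binc_bound \<alpha>0)"
proof -
  have "summable (\<lambda>n. binc_bound \<alpha>0 (Suc n))"
    using summable_abs_binc[of \<alpha>0] assms
    by (auto simp: binc_bound_def summable_Suc_iff intro!: summable_divide)
       (subst summable_Suc_iff, simp)
  then show ?thesis by (subst (asm) summable_Suc_iff)
qed

section \<open>Laguerre polynomials\<close>

definition lag :: "nat \<Rightarrow> real \<Rightarrow> real" where
  "lag n t = (\<Sum>k\<le>n. real (n choose k) * (-1) ^ k * (t ^ k / fact k))"

definition dlag :: "nat \<Rightarrow> real \<Rightarrow> real" where
  "dlag n t = - (\<Sum>i<n. lag i t)"

lemma lag_0 [simp]: "lag 0 t = 1"
  by (simp add: lag_def)

lemma lag_at_0 [simp]: "lag n 0 = 1"
proof -
  have "lag n 0 = (\<Sum>k\<le>n. if k = 0 then 1 else 0)"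
    unfolding lag_def by (intro sum.cong) (auto simp: power_0_left)
  then show ?thesis by simp
qed

text \<open>With \<open>E\<close> the shift of the sequence \<open>m\<close>, the two sums are
  \<open>(1 - E)^n\<close> and \<open>(1 - E)^(n + 1)\<close> applied to \<open>m\<close> at index
  0, so their difference is \<open>E (1 - E)^n\<close>. General moments are allowed because
  fractional powers of \<open>t\<close> will take the place of
  \<open>t ^ k / fact k\<close>.\<close>

lemma alternating_binomial_diff:
  fixes m :: "nat \<Rightarrow> real"
  shows "(\<Sum>k\<le>n. real (n choose k) * (-1) ^ k * m k) - (\<Sum>k\<le>Suc n. real (Suc n choose k) * (-1) ^ k * m k)
    = (\<Sum>k\<le>n. real (n choose k) * (-1) ^ k * m (Suc k))"
proof -
  have "(\<Sum>k\<le>Suc n. real (Suc n choose k) * (-1) ^ k * m k)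
      = m 0 + (\<Sum>k\<le>n. real (Suc n choose Suc k) * (-1) ^ Suc k * m (Suc k))"
    by (subst sum.atMost_Suc_shift) simp
  also have "\<dots> = m 0 + (\<Sum>k\<le>n. real (n choose Suc k) * (-1) ^ Suc k * m (Suc k))
     - (\<Sum>k\<le>n. real (n choose k) * (-1) ^ k * m (Suc k))"
  proof -
    have "(a + b) * (-1) ^ Suc k * c = b * (-1) ^ Suc k * c - a * (-1) ^ k * c" for a b c :: real and k
      by (simp add: algebra_simps)
    then show ?thesis
      by (simp only: binomial_Suc_Suc of_nat_add sum_subtractf add_diff_eq)
  qed
  also have "m 0 + (\<Sum>k\<le>n. real (n choose Suc k) * (-1) ^ Suc k * m (Suc k))
      = (\<Sum>k\<le>Suc n. real (n choose k) * (-1) ^ k * m k)"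
    by (subst sum.atMost_Suc_shift) simp
  also have "\<dots> = (\<Sum>k\<le>n. real (n choose k) * (-1) ^ k * m k)" by simp
  finally show ?thesis by simp
qed

lemma lag_diff_Suc:
  "lag n t - lag (Suc n) t = (\<Sum>k\<le>n. real (n choose k) * (-1) ^ k * (t ^ Suc k / fact (Suc k)))"
  unfolding lag_def by (rule alternating_binomial_diff)

lemma DERIV_power_fact:
  "((\<lambda>t::real. t ^ Suc k / fact (Suc k)) has_real_derivative t ^ k / fact k) (at t)"
  using DERIV_cdivide[OF DERIV_pow[of "Suc k" t UNIV], of "fact (Suc k)"]
  by (simp add: fact_Suc del: of_nat_Suc)

text \<open>The source of the Toeplitz structure: as all Laguerre polynomials agree at 0,
  integration from 0 sends \<open>lag n\<close> to \<open>lag n - lag (Suc n)\<close>.\<close>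

lemma DERIV_lag_diff_Suc: "((\<lambda>t. lag n t - lag (Suc n) t) has_real_derivative lag n t) (at t)"
  unfolding lag_diff_Suc unfolding lag_def
  by (intro DERIV_sum DERIV_cmult DERIV_power_fact)

lemma DERIV_lag: "(lag n has_real_derivative dlag n t) (at t)"
proof (induction n)
  case 0
  show ?case by (simp add: dlag_def)
next
  case (Suc n)
  have "((\<lambda>t. lag n t - (lag n t - lag (Suc n) t)) has_real_derivative (dlag n t - lag n t)) (at t)"
    by (intro DERIV_diff Suc DERIV_lag_diff_Suc)
  then show ?case by (simp add: dlag_def)
qed

lemma continuous_on_lag [continuous_intros]:
  "continuous_on S f \<Longrightarrow> continuous_on S (\<lambda>x. lag n (f x))"
  unfolding lag_def by (intro continuous_intros) auto

lemma borel_measurable_lag [measurable]: "lag n \<in> borel_measurable borel"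
  by (intro borel_measurable_continuous_onI continuous_intros)

text \<open>Multiplying the derivative by \<open>t\<close> puts a factor \<open>k\<close> in front
  of the k-th term. Absorbing it into the binomial coefficient leaves the sum of
  \<open>lag_diff_Suc\<close>.\<close>

lemma lag_first_order: "t * dlag (Suc n) t = real (Suc n) * (lag (Suc n) t - lag n t)"
proof -
  let ?D = "\<Sum>k\<le>Suc n. real (Suc n choose k) * (-1) ^ k * (real k * t ^ (k - Suc 0) / fact k)"
  have "((\<lambda>t. lag (Suc n) t) has_real_derivative ?D) (at t)"
    unfolding lag_def by (intro DERIV_sum DERIV_cmult DERIV_cdivide DERIV_pow)
  then have D: "dlag (Suc n) t = ?D" using DERIV_lag DERIV_unique by blast
  have "t * dlag (Suc n) t = (\<Sum>k\<le>Suc n. real k * real (Suc n choose k) * (-1) ^ k * (t * t ^ (k - Suc 0) / fact k))"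
    unfolding D sum_distrib_left by (intro sum.cong refl) (simp add: mult_ac)
  also have "\<dots> = (\<Sum>k\<le>n. real (Suc k * (Suc n choose Suc k)) * (-1) ^ Suc k * (t ^ Suc k / fact (Suc k)))"
    by (subst sum.atMost_Suc_shift) (simp only: of_nat_mult of_nat_0 diff_Suc_Suc diff_zero power_Suc mult_zero_left add_0)
  also have "\<dots> = - real (Suc n) * (\<Sum>k\<le>n. real (n choose k) * (-1) ^ k * (t ^ Suc k / fact (Suc k)))"
    unfolding Suc_times_binomial sum_distrib_left
    by (intro sum.cong refl) (simp only: of_nat_mult power_Suc mult_minus1 mult_minus_left mult_minus_right mult.assoc)
  also have "\<dots> = real (Suc n) * (lag (Suc n) t - lag n t)"
    by (simp only: lag_diff_Suc[symmetric]) (simp add: algebra_simps)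
  finally show ?thesis .
qed

definition ddlag :: "nat \<Rightarrow> real \<Rightarrow> real" where
  "ddlag n t = - (\<Sum>i<n. dlag i t)"

lemma DERIV_dlag: "(dlag n has_real_derivative ddlag n t) (at t)"
proof -
  have "((\<lambda>t. - (\<Sum>i<n. lag i t)) has_real_derivative - (\<Sum>i<n. dlag i t)) (at t)"
    by (intro DERIV_minus DERIV_sum DERIV_lag)
  then show ?thesis by (simp add: dlag_def[abs_def] ddlag_def)
qed

text \<open>Differentiate the first-order relation. The difference of consecutive derivatives is a
  Laguerre polynomial, which the same relation expresses through \<open>lag n\<close> and
  \<open>dlag n\<close>.\<close>

lemma lag_ode: "t * ddlag n t = (t - 1) * dlag n t - real n * lag n t"
proof (cases n)
  case 0
  then show ?thesis by (simp add: ddlag_def dlag_def)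
next
  case (Suc m)
  have "((\<lambda>t. t * dlag n t) has_real_derivative (1 * dlag n t + ddlag n t * t)) (at t)"
    by (intro DERIV_mult DERIV_ident DERIV_dlag)
  moreover have "((\<lambda>t. real n * (lag n t - lag m t)) has_real_derivative real n * (dlag n t - dlag m t)) (at t)"
    by (intro DERIV_cmult DERIV_diff DERIV_lag)
  then have "((\<lambda>t. t * dlag n t) has_real_derivative real n * (dlag n t - dlag m t)) (at t)"
    by (simp only: Suc lag_first_order)
  ultimately have "dlag n t + t * ddlag n t = real n * (dlag n t - dlag m t)"
    using DERIV_unique by fastforce
  also have "\<dots> = - real n * lag m t" by (simp add: Suc dlag_def algebra_simps)
  also have "\<dots> = t * dlag n t - real n * lag n t"
    using lag_first_order[of t m] by (simp add: Suc algebra_simps)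
  finally show ?thesis by (simp add: algebra_simps)
qed

text \<open>By the Laguerre equation the energy \<open>v = L\<^sup>2 + t L'\<^sup>2 / n\<close> satisfies
  \<open>v' = (2 t - 1) L'\<^sup>2 / n \<le> 2 v\<close>.\<close>

lemma abs_lag_le_exp:
  assumes "0 \<le> t"
  shows "\<bar>lag n t\<bar> \<le> exp t"
proof (cases "n = 0")
  case False
  define v where "v t = (lag n t)\<^sup>2 + t * (dlag n t)\<^sup>2 / real n" for t
  define v' where "v' t = (2 * t - 1) * (dlag n t)\<^sup>2 / real n" for t
  have v: "(v has_real_derivative v' t) (at t)" for t
  proof -
    have "(v has_real_derivative
       (2 * lag n t * dlag n t + ((dlag n t)\<^sup>2 + t * (2 * dlag n t * ddlag n t)) / real n)) (at t)"
      unfolding v_def[abs_def] using False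
      by (auto intro!: derivative_eq_intros DERIV_lag DERIV_dlag simp: power2_eq_square)
    also have "t * (2 * dlag n t * ddlag n t) = 2 * dlag n t * ((t - 1) * dlag n t - real n * lag n t)"
      by (simp flip: lag_ode)
    also have "2 * lag n t * dlag n t + ((dlag n t)\<^sup>2 + 2 * dlag n t * ((t - 1) * dlag n t - real n * lag n t)) / real n = v' t"
      using False by (simp add: v'_def field_simps power2_eq_square)
    finally show ?thesis .
  qed
  have "exp (- 2 * t) * v t \<le> exp (- 2 * 0) * v 0"
  proof (rule DERIV_nonpos_imp_nonincreasing[OF assms])
    fix s :: real assume "0 \<le> s" "s \<le> t"
    have *: "((\<lambda>t. exp (- 2 * t) * v t) has_real_derivative exp (- 2 * s) * (v' s - 2 * v s)) (at s)"
      by (auto intro!: derivative_eq_intros v simp: algebra_simps)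
    have "v' s - 2 * v s = - (dlag n s)\<^sup>2 / real n - 2 * (lag n s)\<^sup>2"
      by (simp add: v_def v'_def left_diff_distrib diff_divide_distrib)
    moreover have "0 \<le> (dlag n s)\<^sup>2 / real n" by simp
    moreover have "0 \<le> (lag n s)\<^sup>2" by simp
    ultimately have "v' s - 2 * v s \<le> 0" by linarith
    then show "\<exists>y. DERIV (\<lambda>t. exp (- 2 * t) * v t) s :> y \<and> y \<le> 0"
      using * by (meson mult_nonneg_nonpos exp_ge_zero)
  qed
  \<comment> \<open>The initial energy is 1: \<open>lag n 0 = 1\<close>, and the other term carries
    the factor \<open>t\<close>.\<close>
  then have "v t \<le> exp (2 * t)" by (simp add: v_def exp_minus field_simps)
  moreover have "(lag n t)\<^sup>2 \<le> v t" using assms by (simp add: v_def)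
  ultimately have "(lag n t)\<^sup>2 \<le> (exp t)\<^sup>2"
    unfolding exp_double[symmetric] by linarith
  then show ?thesis using abs_le_square_iff[of "lag n t" "exp t"] by simp
qed (use assms in simp)

lemma abs_lag_scaled_le:
  assumes "0 \<le> c" "0 \<le> s" "s \<le> R"
  shows "\<bar>lag n (c * s)\<bar> \<le> exp (c * R)"
proof -
  have "\<bar>lag n (c * s)\<bar> \<le> exp (c * s)" "c * s \<le> c * R"
    using assms by (auto intro!: abs_lag_le_exp mult_left_mono)
  then show ?thesis by (meson exp_le_cancel_iff order_trans)
qed

section \<open>Fractional integrals of Laguerre series\<close>

text \<open>The partial sums almost solve Euler's equation \<open>t F' = \<beta> F\<close>, whose
  solutions on the positive axis are the multiples of \<open>t powr \<beta>\<close>. The defect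
  telescopes to one term, whose coefficient \<open>- \<beta> * binc (\<beta> - 1) N\<close> tends to
  0.\<close>

lemma binc_lag_partial_sum:
  "t * (\<Sum>i\<le>N. binc \<beta> i * dlag i t) - \<beta> * (\<Sum>i\<le>N. binc \<beta> i * lag i t)
     = real (Suc N) * binc \<beta> (Suc N) * lag N t"
proof (induction N)
  case 0
  show ?case by (simp add: dlag_def binc_Suc')
next
  case (Suc N)
  let ?S = "\<Sum>i\<le>N. binc \<beta> i * dlag i t" and ?L = "\<Sum>i\<le>N. binc \<beta> i * lag i t"
  have "t * (?S + binc \<beta> (Suc N) * dlag (Suc N) t) - \<beta> * (?L + binc \<beta> (Suc N) * lag (Suc N) t)
    = (t * ?S - \<beta> * ?L) + binc \<beta> (Suc N) * (t * dlag (Suc N) t - \<beta> * lag (Suc N) t)"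
    by (simp add: algebra_simps)
  also have "\<dots> = (real (Suc N) - \<beta>) * binc \<beta> (Suc N) * lag (Suc N) t"
    unfolding Suc lag_first_order by (simp add: algebra_simps)
  also have "\<dots> = real (Suc (Suc N)) * binc \<beta> (Suc (Suc N)) * lag (Suc N) t"
    by (simp only: binc_Suc)
  finally show ?case by simp
qed

lemma summable_lag_series:
  assumes "summable (\<lambda>n. \<bar>a n\<bar>)" "0 \<le> t"
  shows "summable (\<lambda>n. \<bar>a n * lag (f n) t\<bar>)"
proof (rule summable_comparison_test')
  show "summable (\<lambda>n. \<bar>a n\<bar> * exp t)" by (intro summable_mult2 assms)
  show "norm \<bar>a n * lag (f n) t\<bar> \<le> \<bar>a n\<bar> * exp t" for n
    using abs_lag_le_exp[OF assms(2), of "f n"] by (auto simp: abs_mult intro!: mult_left_mono)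
qed

lemma summable_binc_lag:
  assumes "0 \<le> \<beta>" "\<beta> \<le> 1" "0 \<le> t"
  shows "summable (\<lambda>i. binc \<beta> i * lag (f i) t)"
  by (rule summable_rabs_cancel[OF summable_lag_series[OF summable_abs_binc[OF assms(1,2)] assms(3)]])

text \<open>A Laplace transform at the point 2, obtained by scaling Euler's integral. The rate has
  to exceed 1 because \<open>lag n\<close> is only controlled by \<open>exp t\<close>.\<close>

lemma has_bochner_integral_powr_exp:
  assumes "s > (0::real)"
  shows "has_bochner_integral lborel (\<lambda>t. indicator {0..} t * t powr (s - 1) * exp (- 2 * t)) (Gamma s / 2 powr s)"
proof -
  have "has_bochner_integral lborel (\<lambda>t. indicator {0..} t * t powr (s - 1) / exp t) (Gamma s)"
    using assms by (intro has_bochner_integral_nn_integral)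
      (auto simp: Gamma_real_pos less_imp_le Gamma_conv_nn_integral_real[symmetric])
  then have "has_bochner_integral lborel
      (\<lambda>t. indicator {0..} (0 + 2 * t) * (0 + 2 * t) powr (s - 1) / exp (0 + 2 * t)) (Gamma s /\<^sub>R \<bar>2\<bar>)"
    by (subst (asm) lborel_has_bochner_integral_real_affine_iff[where c = 2 and t = 0]) simp
  from has_bochner_integral_mult_right[OF this, of "2 powr (1 - s)"]
  have "has_bochner_integral lborel (\<lambda>t. 2 powr (1 - s) * (indicator {0..} (0 + 2 * t) * (0 + 2 * t) powr (s - 1) / exp (0 + 2 * t)))
     (2 powr (1 - s) * (Gamma s /\<^sub>R \<bar>2\<bar>))" .
  also have "(\<lambda>t. 2 powr (1 - s) * (indicator {0..} (0 + 2 * t) * (0 + 2 * t) powr (s - 1) / exp (0 + 2 * t)))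
     = (\<lambda>t. indicator {0..} t * t powr (s - 1) * exp (- 2 * t))"
  proof
    fix t :: real
    have "2 powr (1 - s) * 2 powr (s - 1) = (1::real)"
      by (simp flip: powr_add)
    then show "2 powr (1 - s) * (indicator {0..} (0 + 2 * t) * (0 + 2 * t) powr (s - 1) / exp (0 + 2 * t))
       = indicator {0..} t * t powr (s - 1) * exp (- 2 * t)"
      by (auto simp: indicator_def powr_mult exp_minus field_simps)
  qed
  also have "2 powr (1 - s) * (Gamma s /\<^sub>R \<bar>2\<bar>) = Gamma s / 2 powr s"
    by (simp add: powr_diff field_simps)
  finally show ?thesis .
qed

text \<open>The Laplace transform of \<open>lag n\<close> at \<open>z\<close> is
  \<open>(1 - 1/z)^n / z\<close>, by the binomial theorem; here \<open>z = 2\<close>.\<close>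

lemma has_bochner_integral_lag_exp:
  "has_bochner_integral lborel (\<lambda>t. indicator {0..} t * exp (- 2 * t) * lag n t) ((1/2) ^ Suc n)"
proof -
  have *: "has_bochner_integral lborel (\<lambda>t::real. indicator {0..} t * exp (- 2 * t) * t ^ k) (fact k / 2 ^ Suc k)" for k
  proof -
    have "has_bochner_integral lborel (\<lambda>t. indicator {0..} t * t powr (real (Suc k) - 1) * exp (- 2 * t))
        (Gamma (real (Suc k)) / 2 powr real (Suc k))"
      by (rule has_bochner_integral_powr_exp) simp
    also have "Gamma (real (Suc k)) / 2 powr real (Suc k) = fact k / 2 ^ Suc k"
      using Gamma_fact[of k, where 'a = real] by (subst powr_realpow) (auto simp: add.commute)
    finally show ?thesis
    proof (rule has_bochner_integral_cong_AE[THEN iffD1, rotated -1])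
      \<comment> \<open>The origin is left out because \<open>0 powr 0 = 0\<close> while
        \<open>0 ^ 0 = 1\<close>.\<close>
      show "AE t in lborel. indicator {0..} t * t powr (real (Suc k) - 1) * exp (- 2 * t)
          = indicator {0..} t * exp (- 2 * t) * t ^ k"
        using AE_lborel_singleton[of 0]
        by eventually_elim (auto simp: indicator_def powr_realpow)
    qed auto
  qed
  have "has_bochner_integral lborel
      (\<lambda>t. \<Sum>k\<le>n. (real (n choose k) * (-1) ^ k / fact k) * (indicator {0..} t * exp (- 2 * t) * t ^ k))
      (\<Sum>k\<le>n. (real (n choose k) * (-1) ^ k / fact k) * (fact k / 2 ^ Suc k))"
    by (intro has_bochner_integral_sum has_bochner_integral_mult_right *)
  also have "(\<lambda>t. \<Sum>k\<le>n. (real (n choose k) * (-1) ^ k / fact k) * (indicator {0..} t * exp (- 2 * t) * t ^ k))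
     = (\<lambda>t. indicator {0..} t * exp (- 2 * t) * lag n t)"
    by (auto simp: lag_def sum_distrib_left mult_ac fun_eq_iff intro!: sum.cong)
  also have "(\<Sum>k\<le>n. (real (n choose k) * (-1) ^ k / fact k) * (fact k / 2 ^ Suc k))
    = (\<Sum>k\<le>n. real (n choose k) * (-1/2) ^ k * 1 ^ (n - k)) / 2"
    unfolding sum_divide_distrib by (intro sum.cong refl) (simp add: power_minus[of "1/2"] power_divide)
  also have "(\<Sum>k\<le>n. real (n choose k) * (-1/2) ^ k * 1 ^ (n - k)) = (-1/2 + 1) ^ n"
    by (subst binomial_ring) simp
  finally show ?thesis by simp
qed

text \<open>The infinite series is never differentiated. Instead, the derivative of
  \<open>t powr (-\<beta>)\<close> times the partial sum tends to 0 uniformly between 1 and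
  \<open>t\<close>, so in the limit this quotient has the same value at both points.\<close>

lemma binc_lag_sums_shape:
  assumes \<beta>: "0 < \<beta>" "\<beta> \<le> 1" and t: "0 < t"
  shows "(\<Sum>i. binc \<beta> i * lag i t) = (\<Sum>i. binc \<beta> i * lag i 1) * t powr \<beta>"
proof -
  define F where "F N t = (\<Sum>i\<le>N. binc \<beta> i * lag i t)" for N t
  define G where "G N t = t powr (-\<beta>) * F N t" for N t
  define a where "a = min 1 t"
  define R where "R = max 1 t"
  have a: "0 < a" using t by (simp add: a_def)
  \<comment> \<open>On \<open>[a, R]\<close> the power is largest at \<open>a\<close> and the
    Laguerre polynomial is at most \<open>exp R\<close>; the factor
    \<open>binc (\<beta> - 1) N\<close> is kept apart because it supplies the convergence.\<close>
  define K where "K = a powr (-\<beta> - 1) * \<beta> * exp R"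
  have der: "(G N has_real_derivative - \<beta> * binc (\<beta> - 1) N * lag N s * s powr (-\<beta> - 1)) (at s)" if "0 < s" for N s
  proof -
    have F: "(F N has_real_derivative (\<Sum>i\<le>N. binc \<beta> i * dlag i s)) (at s)"
      unfolding F_def[abs_def] by (intro DERIV_sum DERIV_cmult DERIV_lag)
    have "(G N has_real_derivative (s powr (-\<beta>) * (\<Sum>i\<le>N. binc \<beta> i * dlag i s)
        + (- \<beta>) * s powr (-\<beta> - 1) * F N s)) (at s)"
      unfolding G_def[abs_def] using that
      by (auto intro!: derivative_eq_intros F has_real_derivative_powr)
    also have "s powr (-\<beta>) = s powr (-\<beta> - 1) * s"
      using that by (simp add: powr_diff)
    also have "s powr (-\<beta> - 1) * s * (\<Sum>i\<le>N. binc \<beta> i * dlag i s) + (- \<beta>) * s powr (-\<beta> - 1) * F N s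
      = s powr (-\<beta> - 1) * (s * (\<Sum>i\<le>N. binc \<beta> i * dlag i s) - \<beta> * (\<Sum>i\<le>N. binc \<beta> i * lag i s))"
      by (simp add: F_def algebra_simps)
    also have "\<dots> = - \<beta> * binc (\<beta> - 1) N * lag N s * s powr (-\<beta> - 1)"
      unfolding binc_lag_partial_sum binc_via_pred by (simp add: mult_ac)
    finally show ?thesis .
  qed
  have bound: "norm (G N t - G N 1) \<le> K * binc (\<beta> - 1) N * norm (t - 1)" for N
  proof (rule field_differentiable_bound[where S = "{a..R}"])
    show "(G N has_field_derivative - \<beta> * binc (\<beta> - 1) N * lag N s * s powr (-\<beta> - 1)) (at s within {a..R})"
      if "s \<in> {a..R}" for s
      using der[of s] that a by (auto intro: has_field_derivative_at_within)
    show "norm (- \<beta> * binc (\<beta> - 1) N * lag N s * s powr (-\<beta> - 1)) \<le> K * binc (\<beta> - 1) N" if s: "s \<in> {a..R}" for s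
    proof -
      have "\<bar>lag N s\<bar> \<le> exp R" using abs_lag_le_exp[of s N] a s by (auto intro: order_trans)
      moreover have "s powr (-\<beta> - 1) \<le> a powr (-\<beta> - 1)"
        using s a \<beta> by (intro powr_mono2') auto
      ultimately have "\<beta> * binc (\<beta> - 1) N * (\<bar>lag N s\<bar> * s powr (-\<beta> - 1))
          \<le> \<beta> * binc (\<beta> - 1) N * (exp R * a powr (-\<beta> - 1))"
        using \<beta> binc_nonneg[of "\<beta> - 1" N] by (intro mult_left_mono mult_mono) auto
      then show ?thesis using \<beta> binc_nonneg[of "\<beta> - 1" N]
        by (simp add: K_def abs_mult mult_ac)
    qed
  qed (auto simp: a_def R_def)
  have "(\<lambda>N. G N t - G N 1) \<longlonglongrightarrow> 0"
  proof (rule Lim_null_comparison)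
    show "\<forall>\<^sub>F N in sequentially. norm (G N t - G N 1) \<le> K * binc (\<beta> - 1) N * norm (t - 1)"
      using bound by simp
    have "(\<lambda>N. K * binc (\<beta> - 1) N * norm (t - 1)) \<longlonglongrightarrow> K * 0 * norm (t - 1)"
      using \<beta> by (intro tendsto_intros binc_tendsto_0) auto
    then show "(\<lambda>N. K * binc (\<beta> - 1) N * norm (t - 1)) \<longlonglongrightarrow> 0" by simp
  qed
  moreover have F: "(\<lambda>N. F N s) \<longlonglongrightarrow> (\<Sum>i. binc \<beta> i * lag i s)" if "0 \<le> s" for s
    unfolding F_def by (rule summable_LIMSEQ'[OF summable_binc_lag]) (use \<beta> that in auto)
  have "(\<lambda>N. G N t - G N 1) \<longlonglongrightarrow> t powr (-\<beta>) * (\<Sum>i. binc \<beta> i * lag i t) - 1 powr (-\<beta>) * (\<Sum>i. binc \<beta> i * lag i 1)"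
    unfolding G_def using t by (intro tendsto_intros F) auto
  ultimately have "t powr (-\<beta>) * (\<Sum>i. binc \<beta> i * lag i t) - 1 powr (-\<beta>) * (\<Sum>i. binc \<beta> i * lag i 1) = 0"
    using LIMSEQ_unique by blast
  then show ?thesis using t by (simp add: powr_minus field_simps)
qed

text \<open>The constant is found by integrating both sides against \<open>exp (- 2 t)\<close>.\<close>

lemma binc_lag_at_1:
  assumes \<beta>: "0 < \<beta>" "\<beta> \<le> 1"
  shows "(\<Sum>i. binc \<beta> i * lag i 1) = 1 / Gamma (\<beta> + 1)"
proof -
  let ?w = "\<lambda>t::real. indicator {0..} t * exp (- 2 * t)"
  let ?C = "\<Sum>i. binc \<beta> i * lag i 1"
  have int: "integrable lborel (\<lambda>t. ?w t * lag i t)" for i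
    using has_bochner_integral_lag_exp by (rule integrable.intros)
  \<comment> \<open>The dominating function: \<open>exp (- 2 * t) * \<bar>lag i t\<bar>\<close> is
    at most \<open>exp (- t)\<close> for every \<open>i\<close>.\<close>
  have we: "integrable lborel (\<lambda>t::real. indicator {0..} t * exp (- t) :: real)"
  proof (rule integrable.intros)
    show "has_bochner_integral lborel (\<lambda>t::real. indicator {0..} t * exp (- t) :: real) 1"
      using has_bochner_integral_lag_exp[of 0]
      by (subst (asm) lborel_has_bochner_integral_real_affine_iff[where c = "1/2" and t = 0])
         (auto simp: indicator_def zero_le_mult_iff)
  qed
  have S1: "(\<lambda>i. \<integral>t. binc \<beta> i * (?w t * lag i t) \<partial>lborel) sums (\<integral>t. (\<Sum>i. binc \<beta> i * (?w t * lag i t)) \<partial>lborel)"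
  proof (rule sums_integral)
    show "integrable lborel (\<lambda>t. binc \<beta> i * (?w t * lag i t))" for i by (intro integrable_mult_right int)
    have "summable (\<lambda>i. norm (binc \<beta> i * (?w t * lag i t)))" for t
    proof (cases "0 \<le> t")
      case True
      from summable_mult[OF summable_lag_series[OF summable_abs_binc True, of \<beta> "\<lambda>i. i"], of "?w t"] \<beta>
      show ?thesis by (simp add: abs_mult mult_ac)
    qed simp
    then show "AE t in lborel. summable (\<lambda>i. norm (binc \<beta> i * (?w t * lag i t)))" by simp
    show "summable (\<lambda>i. \<integral>t. norm (binc \<beta> i * (?w t * lag i t)) \<partial>lborel)"
    proof (rule summable_comparison_test')
      show "summable (\<lambda>i. \<bar>binc \<beta> i\<bar> * (\<integral>t. indicator {0..} t * exp (- t) \<partial>lborel))"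
        using \<beta> by (intro summable_mult2 summable_abs_binc) auto
      fix i
      have "(\<integral>t. norm (binc \<beta> i * (?w t * lag i t)) \<partial>lborel) \<le> (\<integral>t. \<bar>binc \<beta> i\<bar> * (indicator {0..} t * exp (- t)) \<partial>lborel)"
      proof (intro integral_mono integrable_norm integrable_mult_right int we)
        fix t :: real
        have "exp (- 2 * t) * \<bar>lag i t\<bar> \<le> exp (- t)" if "0 \<le> t"
        proof -
          have "exp (- 2 * t) * \<bar>lag i t\<bar> \<le> exp (- 2 * t) * exp t"
            using abs_lag_le_exp[OF that] by (intro mult_left_mono) auto
          also have "\<dots> = exp (- t)" by (simp flip: exp_add)
          finally show ?thesis .
        qed
        then show "norm (binc \<beta> i * (?w t * lag i t)) \<le> \<bar>binc \<beta> i\<bar> * (indicator {0..} t * exp (- t))"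
          by (auto simp: indicator_def abs_mult intro!: mult_left_mono)
      qed
      then show "norm (\<integral>t. norm (binc \<beta> i * (?w t * lag i t)) \<partial>lborel) \<le> \<bar>binc \<beta> i\<bar> * (\<integral>t. indicator {0..} t * exp (- t) \<partial>lborel)"
        by simp
    qed
  qed
  have S2: "(\<integral>t. binc \<beta> i * (?w t * lag i t) \<partial>lborel) = (\<beta> gchoose i) * (-1/2) ^ i * (1/2)" for i
    unfolding integral_mult_right_zero has_bochner_integral_integral_eq[OF has_bochner_integral_lag_exp[of i]]
    by (simp add: binc_def power_divide power_minus[of "1/2"] mult_ac)
  \<comment> \<open>Newton's binomial series at \<open>-1/2\<close>, which the Laplace transforms at
    2 have produced.\<close>
  have S3: "(\<lambda>i. (\<beta> gchoose i) * (-1/2) ^ i * (1/2)) sums ((1 + (-1/2)) powr \<beta> * (1/2))"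
    by (intro sums_mult2 gen_binomial_real) simp
  have 1: "(\<integral>t. (\<Sum>i. binc \<beta> i * (?w t * lag i t)) \<partial>lborel) = (1/2) powr \<beta> * (1/2)"
    by (rule trans[OF sums_unique2[OF S1[unfolded S2] S3]]) simp
  have "(\<integral>t. (\<Sum>i. binc \<beta> i * (?w t * lag i t)) \<partial>lborel) = (\<integral>t. ?C * (indicator {0..} t * t powr ((\<beta> + 1) - 1) * exp (- 2 * t)) \<partial>lborel)"
  proof (rule integral_cong_AE)
    show "AE t in lborel. (\<Sum>i. binc \<beta> i * (?w t * lag i t)) = ?C * (indicator {0..} t * t powr ((\<beta> + 1) - 1) * exp (- 2 * t))"
      using AE_lborel_singleton[of 0]
    proof eventually_elim
      case (elim t)
      show ?case
      proof (cases "0 < t")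
        case True
        have "(\<Sum>i. binc \<beta> i * (?w t * lag i t)) = (\<Sum>i. ?w t * (binc \<beta> i * lag i t))"
          by (simp add: mult_ac)
        also have "\<dots> = ?w t * (\<Sum>i. binc \<beta> i * lag i t)"
          by (rule suminf_mult[OF summable_binc_lag]) (use \<beta> True in auto)
        finally show ?thesis using binc_lag_sums_shape[OF \<beta> True] by simp
      qed (use elim in auto)
    qed
  qed auto
  also have "\<dots> = ?C * (Gamma (\<beta> + 1) / 2 powr (\<beta> + 1))"
    using has_bochner_integral_powr_exp[of "\<beta> + 1"] \<beta>
    by (subst integral_mult_right_zero) (auto simp: has_bochner_integral_iff)
  finally have "?C * (Gamma (\<beta> + 1) / 2 powr (\<beta> + 1)) = (1/2) powr \<beta> * (1/2)" using 1 by simp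
  moreover have "0 < Gamma (\<beta> + 1)" using \<beta> by (intro Gamma_real_pos) auto
  ultimately show ?thesis by (simp add: powr_divide powr_add field_simps)
qed

text \<open>The sum is the fractional integral of the constant 1, so this is the case
  \<open>j = 0\<close> of the Toeplitz identity. The origin, outside the reach of the quotient
  argument, is \<open>binc_sums_0\<close>.\<close>

lemma binc_lag_sums:
  assumes \<beta>: "0 < \<beta>" "\<beta> \<le> 1" and t: "0 \<le> t"
  shows "(\<lambda>i. binc \<beta> i * lag i t) sums (t powr \<beta> / Gamma (\<beta> + 1))"
proof (cases "t = 0")
  case True
  then show ?thesis using binc_sums_0[OF \<beta>] by simp
next
  case False
  have "summable (\<lambda>i. binc \<beta> i * lag i t)"
    by (rule summable_binc_lag) (use \<beta> t in auto)
  then show ?thesis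
    using binc_lag_sums_shape[OF \<beta>, of t] binc_lag_at_1[OF \<beta>] False t by (simp add: sums_iff)
qed

text \<open>Termwise integration with the majorants
  \<open>\<bar>a n\<bar> * exp (c * t) * \<bar>\<phi> s\<bar>\<close>. The factor \<phi> is merely
  integrable, since it will be the singular kernel of a fractional integral and later the time
  reflection of an unknown function; \<open>f\<close> admits shifted indices.\<close>

lemma lag_series_integral:
  fixes \<phi> a :: "_ \<Rightarrow> real" and f :: "nat \<Rightarrow> nat"
  assumes \<phi>: "\<phi> absolutely_integrable_on {0..t}" and a: "summable (\<lambda>n. \<bar>a n\<bar>)" and c: "0 \<le> c"
  shows "(\<lambda>s. \<phi> s * (\<Sum>n. a n * lag (f n) (c * s))) absolutely_integrable_on {0..t}" (is ?int)
    and "(\<lambda>n. a n * integral {0..t} (\<lambda>s. \<phi> s * lag (f n) (c * s))) sums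
           integral {0..t} (\<lambda>s. \<phi> s * (\<Sum>n. a n * lag (f n) (c * s)))" (is ?sums)
    and "\<And>n. (\<lambda>s. \<phi> s * lag (f n) (c * s)) absolutely_integrable_on {0..t}"
proof -
  define h where "h n s = indicator {0..t} s *\<^sub>R (\<phi> s * (a n * lag (f n) (c * s)))" for n s
  define p where "p s = indicator {0..t} s *\<^sub>R \<phi> s" for s
  have p: "integrable lebesgue p" using \<phi> by (simp add: p_def[abs_def] set_integrable_def)
  have m: "(\<lambda>s. lag k (c * s)) \<in> borel_measurable lebesgue" for k
    by (intro measurable_completion) simp
  have bnd: "norm (p s * lag k (c * s)) \<le> norm (exp (c * t) * p s)" for k s
  proof (cases "s \<in> {0..t}")
    case True
    then have "\<bar>lag k (c * s)\<bar> \<le> exp (c * t)" using c by (intro abs_lag_scaled_le) auto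
    then show ?thesis by (simp add: abs_mult mult.commute mult_left_mono)
  qed (simp add: p_def)
  have int_p: "integrable lebesgue (\<lambda>s. p s * lag k (c * s))" for k
    by (rule Bochner_Integration.integrable_bound[OF integrable_mult_right[OF p, of "exp (c * t)"]])
       (use bnd p m in \<open>auto intro!: borel_measurable_times\<close>)
  show "(\<lambda>s. \<phi> s * lag (f n) (c * s)) absolutely_integrable_on {0..t}" for n
    using int_p[of "f n"] by (simp add: set_integrable_def p_def mult.assoc)
  have h_eq: "h n s = a n * (p s * lag (f n) (c * s))" for n s
    by (simp add: h_def p_def mult_ac)
  have norm_h: "norm (h n s) \<le> \<bar>a n\<bar> * norm (exp (c * t) * p s)" for n s
    unfolding h_eq norm_mult[of "a n"] real_norm_def[of "a n"] by (intro mult_left_mono bnd) simp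
  have int_h: "integrable lebesgue (h n)" for n
    unfolding h_eq by (intro integrable_mult_right int_p)
  have sum_h: "AE s in lebesgue. summable (\<lambda>n. norm (h n s))"
  proof (rule AE_I2)
    fix s
    show "summable (\<lambda>n. norm (h n s))"
    proof (rule summable_comparison_test')
      show "summable (\<lambda>n. \<bar>a n\<bar> * norm (exp (c * t) * p s))" by (intro summable_mult2 a)
      show "norm (norm (h n s)) \<le> \<bar>a n\<bar> * norm (exp (c * t) * p s)" for n
        using norm_h[of n s] by simp
    qed
  qed
  have sum_int: "summable (\<lambda>n. \<integral>s. norm (h n s) \<partial>lebesgue)"
  proof (rule summable_comparison_test')
    show "summable (\<lambda>n. \<bar>a n\<bar> * (\<integral>s. norm (exp (c * t) * p s) \<partial>lebesgue))" by (intro summable_mult2 a)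
    fix n
    have "(\<integral>s. norm (h n s) \<partial>lebesgue) \<le> (\<integral>s. \<bar>a n\<bar> * norm (exp (c * t) * p s) \<partial>lebesgue)"
      by (intro integral_mono norm_h integrable_norm int_h integrable_mult_right p)
    then show "norm (\<integral>s. norm (h n s) \<partial>lebesgue) \<le> \<bar>a n\<bar> * (\<integral>s. norm (exp (c * t) * p s) \<partial>lebesgue)"
      by simp
  qed
  have sum_ha: "(\<Sum>n. h n s) = indicator {0..t} s *\<^sub>R (\<phi> s * (\<Sum>n. a n * lag (f n) (c * s)))" for s
  proof (cases "s \<in> {0..t}")
    case True
    have "summable (\<lambda>n. a n * lag (f n) (c * s))"
      by (rule summable_rabs_cancel[OF summable_lag_series[OF a]]) (use True c in auto)
    from suminf_mult[OF this, of "\<phi> s"] show ?thesis using True by (simp add: h_def)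
  qed (simp add: h_def)
  have "integrable lebesgue (\<lambda>s. \<Sum>n. h n s)"
    by (rule integrable_suminf[OF int_h sum_h sum_int])
  then show I: ?int by (simp add: set_integrable_def sum_ha)
  have "(\<lambda>n. \<integral>s. h n s \<partial>lebesgue) sums (\<integral>s. (\<Sum>n. h n s) \<partial>lebesgue)"
    by (rule sums_integral[OF int_h sum_h sum_int])
  moreover have "(\<integral>s. (\<Sum>n. h n s) \<partial>lebesgue) = integral {0..t} (\<lambda>s. \<phi> s * (\<Sum>n. a n * lag (f n) (c * s)))"
    using set_lebesgue_integral_eq_integral(2)[OF I] by (simp add: sum_ha set_lebesgue_integral_def)
  moreover have "(\<integral>s. h n s \<partial>lebesgue) = a n * integral {0..t} (\<lambda>s. \<phi> s * lag (f n) (c * s))" for n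
  proof -
    have "(\<lambda>s. \<phi> s * lag (f n) (c * s)) absolutely_integrable_on {0..t}"
      using int_p[of "f n"] by (simp add: set_integrable_def p_def mult.assoc)
    from set_lebesgue_integral_eq_integral(2)[OF this]
    show ?thesis unfolding h_eq by (simp add: set_lebesgue_integral_def p_def mult.assoc)
  qed
  ultimately show ?sums by simp
qed

lemma has_integral_lag:
  assumes "0 \<le> t"
  shows "(lag n has_integral (lag n t - lag (Suc n) t)) {0..t}"
  using fundamental_theorem_of_calculus[OF assms, of "\<lambda>t. lag n t - lag (Suc n) t" "lag n"]
    DERIV_lag_diff_Suc[of n]
  by (auto simp: has_real_derivative_iff_has_vector_derivative[symmetric]
      intro: has_field_derivative_at_within)

text \<open>The right side is the fractional integral of \<open>lag j\<close>, monomial by monomial.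
  Integrating the identity for \<open>j\<close> over \<open>[0, t]\<close> turns
  \<open>lag (n + j)\<close> into a difference on the left and raises every moment on the right;
  subtracting the result from the identity for \<open>j\<close> gives the one for
  \<open>Suc j\<close>.\<close>

lemma binc_lag_shift_sums:
  assumes \<beta>: "0 < \<beta>" "\<beta> \<le> 1" and t: "0 \<le> t"
  shows "(\<lambda>i. binc \<beta> i * lag (i + j) t) sums
    (\<Sum>k\<le>j. real (j choose k) * (-1) ^ k * (t powr (real k + \<beta>) / Gamma (real k + \<beta> + 1)))"
  using t
proof (induction j arbitrary: t)
  case 0
  then show ?case using binc_lag_sums[OF \<beta>, of t] by simp
next
  case (Suc j)
  let ?m = "\<lambda>k s. s powr (real k + \<beta>) / Gamma (real k + \<beta> + 1)"
  let ?R = "\<lambda>s. \<Sum>k\<le>j. real (j choose k) * (-1) ^ k * ?m k s"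
  have m: "((\<lambda>s. ?m k s) has_integral ?m (Suc k) t) {0..t}" for k
  proof -
    have "((\<lambda>s. s powr (real k + \<beta>)) has_integral (t powr (real k + \<beta> + 1) / (real k + \<beta> + 1))) {0..t}"
      using \<beta> Suc.prems by (intro has_integral_powr_from_0) auto
    from has_integral_divide[OF this, of "Gamma (real k + \<beta> + 1)"]
    show ?thesis using Gamma_plus1[of "real k + \<beta> + 1"] \<beta>
      by (simp add: algebra_simps nonpos_Ints_def)
  qed
  have "(\<lambda>n. binc \<beta> n * integral {0..t} (\<lambda>s. 1 * lag (n + j) (1 * s))) sums
           integral {0..t} (\<lambda>s. 1 * (\<Sum>n. binc \<beta> n * lag (n + j) (1 * s)))"
    using \<beta> by (intro lag_series_integral(2) summable_abs_binc) auto
  moreover have "integral {0..t} (\<lambda>s. 1 * (\<Sum>n. binc \<beta> n * lag (n + j) (1 * s))) = integral {0..t} ?R"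
    using Suc.IH by (intro integral_cong) (auto simp: sums_iff)
  moreover have "integral {0..t} ?R = (\<Sum>k\<le>j. real (j choose k) * (-1) ^ k * ?m (Suc k) t)"
    by (intro integral_unique has_integral_sum has_integral_mult_right m) auto
  moreover have "integral {0..t} (\<lambda>s. 1 * lag (n + j) (1 * s)) = lag (n + j) t - lag (n + Suc j) t" for n
    using integral_unique[OF has_integral_lag[OF Suc.prems, of "n + j"]] by simp
  ultimately have "(\<lambda>n. binc \<beta> n * (lag (n + j) t - lag (n + Suc j) t)) sums
      (\<Sum>k\<le>j. real (j choose k) * (-1) ^ k * ?m (Suc k) t)"
    by simp
  from sums_diff[OF Suc.IH[OF Suc.prems] this]
  show ?case
    unfolding alternating_binomial_diff[of j "\<lambda>k. ?m k t", symmetric]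
    by (simp add: algebra_simps del: sum.atMost_Suc)
qed

text \<open>The substitution \<open>s = t * x\<close> reduces it to a Beta integral.\<close>

lemma has_integral_RL_monomial:
  assumes \<gamma>: "0 < \<gamma>" and t: "0 \<le> t"
  shows "((\<lambda>s. (t - s) powr (\<gamma> - 1) * s ^ k) has_integral
     (Gamma \<gamma> * fact k * t powr (real k + \<gamma>) / Gamma (real k + \<gamma> + 1))) {0..t}"
proof (cases "t = 0")
  case True
  then show ?thesis using \<gamma> by (simp add: has_integral_refl)
next
  case False
  with t have t: "0 < t" by simp
  have "((\<lambda>x. x powr (real k + 1 - 1) * (1 - x) powr (\<gamma> - 1)) has_integral Beta (real k + 1) \<gamma>) (cbox 0 1)"
    using has_integral_Beta_real[of "real k + 1" \<gamma>] \<gamma> by simp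
  from has_integral_affinity[OF this, of "1 / t" 0] t
  have "((\<lambda>x. (x / t) powr real k * (1 - x / t) powr (\<gamma> - 1)) has_integral t * Beta (real k + 1) \<gamma>) ((\<lambda>x. t * x) ` {0..1})"
    by simp
  also have "(\<lambda>x. t * x) ` {0..1} = {0..t}"
    using t image_mult_atLeastAtMost[of t 0 1] by simp
  finally have "((\<lambda>x. t powr (real k + \<gamma> - 1) * ((x / t) powr real k * (1 - x / t) powr (\<gamma> - 1)))
     has_integral t powr (real k + \<gamma> - 1) * (t * Beta (real k + 1) \<gamma>)) {0..t}"
    by (rule has_integral_mult_right)
  then have "((\<lambda>s. (t - s) powr (\<gamma> - 1) * s ^ k) has_integral t powr (real k + \<gamma> - 1) * (t * Beta (real k + 1) \<gamma>)) {0..t}"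
  \<comment> \<open>At \<open>s = 0\<close> and \<open>k = 0\<close> the library values
    \<open>0 ^ 0 = 1\<close> and \<open>0 powr 0 = 0\<close> disagree.\<close>
  proof (rule has_integral_spike[where S = "{0}", rotated 2])
    fix s assume s: "s \<in> {0..t} - {0}"
    have "(x / t) powr real k * (1 - x / t) powr (\<gamma> - 1) = (x powr real k / t powr real k) * ((t - x) powr (\<gamma> - 1) / t powr (\<gamma> - 1))"
      if "0 < x" "x \<le> t" for x
    proof -
      have "1 - x / t = (t - x) / t" using t by (simp add: field_simps)
      then show ?thesis using that t by (simp add: powr_divide)
    qed
    moreover have "t powr (real k + \<gamma> - 1) = t powr real k * t powr (\<gamma> - 1)"
      by (simp add: add_diff_eq flip: powr_add)
    ultimately show "(t - s) powr (\<gamma> - 1) * s ^ k = t powr (real k + \<gamma> - 1) * ((s / t) powr real k * (1 - s / t) powr (\<gamma> - 1))"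
      using s t by (simp add: powr_realpow)
  qed auto
  also have "t powr (real k + \<gamma> - 1) * (t * Beta (real k + 1) \<gamma>) = t powr (real k + \<gamma>) * Beta (real k + 1) \<gamma>"
    using t by (simp add: powr_diff)
  also have "Beta (real k + 1) \<gamma> = fact k * Gamma \<gamma> / Gamma (real k + \<gamma> + 1)"
    using Gamma_fact[of k, where 'a = real] by (simp add: Beta_def add_ac)
  finally show ?thesis by (simp add: mult_ac)
qed

lemma absolutely_integrable_RL_kernel:
  fixes \<gamma> t :: real
  assumes "0 < \<gamma>" "0 \<le> t"
  shows "(\<lambda>s. (t - s) powr (\<gamma> - 1)) absolutely_integrable_on {0..t}"
proof -
  have "(\<lambda>s. (t - s) powr (\<gamma> - 1)) integrable_on {0..t}"
    using has_integral_RL_monomial[OF assms, of 0] by (auto simp: has_integral_integrable)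
  then show ?thesis by (subst absolutely_integrable_on_iff_nonneg) auto
qed

lemma integral_RL_lag:
  assumes \<gamma>: "0 < \<gamma>" "\<gamma> \<le> 1" and t: "0 \<le> t" and c: "0 < c"
  shows "integral {0..t} (\<lambda>s. (t - s) powr (\<gamma> - 1) * lag m (c * s))
    = Gamma \<gamma> * c powr (-\<gamma>) * (\<Sum>i. binc \<gamma> i * lag (i + m) (c * t))"
proof -
  have "(\<lambda>s. (t - s) powr (\<gamma> - 1) * lag m (c * s))
     = (\<lambda>s. \<Sum>k\<le>m. (real (m choose k) * (-1) ^ k * c ^ k / fact k) * ((t - s) powr (\<gamma> - 1) * s ^ k))"
    by (auto simp: lag_def sum_distrib_left power_mult_distrib mult_ac fun_eq_iff intro!: sum.cong)
  then have "integral {0..t} (\<lambda>s. (t - s) powr (\<gamma> - 1) * lag m (c * s))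
     = (\<Sum>k\<le>m. (real (m choose k) * (-1) ^ k * c ^ k / fact k) * (Gamma \<gamma> * fact k * t powr (real k + \<gamma>) / Gamma (real k + \<gamma> + 1)))"
    using \<gamma> t by (simp only:) (intro integral_unique has_integral_sum has_integral_mult_right has_integral_RL_monomial, auto)
  also have "\<dots> = (\<Sum>k\<le>m. Gamma \<gamma> * c powr (-\<gamma>) * (real (m choose k) * (-1) ^ k * ((c * t) powr (real k + \<gamma>) / Gamma (real k + \<gamma> + 1))))"
  proof (intro sum.cong refl)
    fix k
    have "(c * t) powr (real k + \<gamma>) = c ^ k * c powr \<gamma> * t powr (real k + \<gamma>)"
      using c t by (simp add: powr_mult powr_add powr_realpow)
    moreover have "c powr (-\<gamma>) * c powr \<gamma> = 1" using c by (simp flip: powr_add)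
    ultimately have C: "c ^ k * t powr (real k + \<gamma>) = c powr (-\<gamma>) * (c * t) powr (real k + \<gamma>)"
      by simp
    have "(real (m choose k) * (-1) ^ k * c ^ k / fact k) * (Gamma \<gamma> * fact k * t powr (real k + \<gamma>) / Gamma (real k + \<gamma> + 1))
      = Gamma \<gamma> * (real (m choose k) * (-1) ^ k) * (c ^ k * t powr (real k + \<gamma>)) / Gamma (real k + \<gamma> + 1)"
      by simp
    also have "\<dots> = Gamma \<gamma> * c powr (-\<gamma>) * (real (m choose k) * (-1) ^ k * ((c * t) powr (real k + \<gamma>) / Gamma (real k + \<gamma> + 1)))"
      unfolding C by simp
    finally show "(real (m choose k) * (-1) ^ k * c ^ k / fact k) * (Gamma \<gamma> * fact k * t powr (real k + \<gamma>) / Gamma (real k + \<gamma> + 1))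
      = Gamma \<gamma> * c powr (-\<gamma>) * (real (m choose k) * (-1) ^ k * ((c * t) powr (real k + \<gamma>) / Gamma (real k + \<gamma> + 1)))" .
  qed
  also have "\<dots> = Gamma \<gamma> * c powr (-\<gamma>) * (\<Sum>i. binc \<gamma> i * lag (i + m) (c * t))"
    unfolding sum_distrib_left[symmetric] using binc_lag_shift_sums[OF \<gamma>, of "c * t" m] c t
    by (simp add: sums_iff)
  finally show ?thesis .
qed

text \<open>A Cauchy product tested against a bounded weight on the output index. The double series,
  with entry 0 whenever the output index is below the input index, is rearranged by exchanging the
  sum with an integral over counting measure.\<close>

lemma Cauchy_product_weighted:
  fixes a b g :: "nat \<Rightarrow> real"
  assumes a: "summable (\<lambda>n. \<bar>a n\<bar>)" and b: "summable (\<lambda>n. \<bar>b n\<bar>)" and g: "\<And>n. \<bar>g n\<bar> \<le> K"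
  shows "(\<lambda>m. a m * (\<Sum>i. b i * g (i + m))) sums (\<Sum>n. fps_nth (Abs_fps b * Abs_fps a) n * g n)"
proof -
  define f where "f m n = (if m \<le> n then a m * b (n - m) * g n else 0)" for m n
  have K: "0 \<le> K" using g[of 0] by simp
  have nf: "norm (f m (i + m)) \<le> \<bar>a m\<bar> * K * \<bar>b i\<bar>" for m i
    using mult_left_mono[OF g[of "i + m"], of "\<bar>a m\<bar> * \<bar>b i\<bar>"] by (simp add: f_def abs_mult mult_ac)
  have sb: "summable (\<lambda>i. norm (f m (i + m)))" for m
    by (rule summable_comparison_test'[OF summable_mult[OF b, of "\<bar>a m\<bar> * K"]]) (use nf in auto)
  then have s: "summable (\<lambda>n. norm (f m n))" for m by (subst (asm) summable_iff_shift)
  have sf: "(\<Sum>n. h (f m n)) = (\<Sum>i. h (f m (i + m)))" if "summable (\<lambda>n. h (f m n))" "h 0 = 0" for m and h :: "real \<Rightarrow> real"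
    using suminf_split_initial_segment[OF that(1), of m] that(2) by (simp add: f_def)
  have "(\<lambda>m. integral\<^sup>L (count_space UNIV) (f m)) sums (\<integral>n. (\<Sum>m. f m n) \<partial>count_space UNIV)"
  proof (rule sums_integral)
    show "integrable (count_space UNIV) (f m)" for m using s by (simp add: integrable_count_space_nat_iff)
    have "summable (\<lambda>m. norm (f m n))" for n
      by (rule summable_finite[of "{..n}"]) (auto simp: f_def)
    then show "AE n in count_space UNIV. summable (\<lambda>m. norm (f m n))" by simp
    show "summable (\<lambda>m. \<integral>n. norm (f m n) \<partial>count_space UNIV)"
    proof (rule summable_comparison_test')
      show "summable (\<lambda>m. \<bar>a m\<bar> * (K * (\<Sum>i. \<bar>b i\<bar>)))" by (intro summable_mult2 a)
      fix m
      have "(\<integral>n. norm (f m n) \<partial>count_space UNIV) = (\<Sum>i. norm (f m (i + m)))"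
        using s[of m] sf[of norm m] by (subst integral_count_space_nat) (auto simp: integrable_count_space_nat_iff)
      also have "\<dots> \<le> (\<Sum>i. \<bar>a m\<bar> * K * \<bar>b i\<bar>)"
        by (intro suminf_le nf sb summable_mult b)
      also have "\<dots> = \<bar>a m\<bar> * (K * (\<Sum>i. \<bar>b i\<bar>))" using b by (simp add: suminf_mult)
      finally show "norm (\<integral>n. norm (f m n) \<partial>count_space UNIV) \<le> \<bar>a m\<bar> * (K * (\<Sum>i. \<bar>b i\<bar>))"
        by simp
    qed
  qed
  moreover have "integral\<^sup>L (count_space UNIV) (f m) = a m * (\<Sum>i. b i * g (i + m))" for m
  proof -
    have "summable (\<lambda>i. b i * g (i + m))"
      by (rule summable_comparison_test'[OF summable_mult[OF b, of K]])
         (use g in \<open>simp add: abs_mult mult.commute[of K] mult_left_mono\<close>)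
    moreover have "integral\<^sup>L (count_space UNIV) (f m) = (\<Sum>n. f m n)"
      using s[of m] by (intro integral_count_space_nat) (auto simp: integrable_count_space_nat_iff)
    moreover have "(\<Sum>n. f m n) = (\<Sum>i. f m (i + m))"
      using sf[of "\<lambda>x. x" m] summable_norm_cancel[OF s[of m]] by simp
    ultimately show ?thesis by (simp add: f_def mult.assoc suminf_mult)
  qed
  moreover have F: "(\<Sum>m. f m n) = fps_nth (Abs_fps b * Abs_fps a) n * g n" for n
  proof -
    have "(\<Sum>m. f m n) = (\<Sum>m\<le>n. f m n)" by (rule suminf_finite) (auto simp: f_def)
    also have "\<dots> = (\<Sum>m=0..n. a m * b (n - m)) * g n"
      by (simp add: f_def sum_distrib_right atLeast0AtMost)
    also have "(\<Sum>m=0..n. a m * b (n - m)) = fps_nth (Abs_fps a * Abs_fps b) n"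
      by (simp add: fps_mult_nth)
    finally show ?thesis by (simp add: mult.commute)
  qed
  moreover have "(\<integral>n. (\<Sum>m. f m n) \<partial>count_space UNIV) = (\<Sum>n. fps_nth (Abs_fps b * Abs_fps a) n * g n)"
  proof -
    have "summable (\<lambda>n. \<bar>fps_nth (Abs_fps b * Abs_fps a) n * g n\<bar>)"
    proof (rule summable_comparison_test')
      show "summable (\<lambda>n. (\<Sum>i\<le>n. \<bar>b i\<bar> * \<bar>a (n - i)\<bar>) * K)"
        using a b by (intro summable_mult2 summable_Cauchy_product) auto
      show "norm \<bar>fps_nth (Abs_fps b * Abs_fps a) n * g n\<bar> \<le> (\<Sum>i\<le>n. \<bar>b i\<bar> * \<bar>a (n - i)\<bar>) * K" for n
        using g[of n] sum_abs[of "\<lambda>i. b i * a (n - i)" "{..n}"]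
        by (auto simp: fps_mult_nth abs_mult atLeast0AtMost intro!: mult_mono sum_nonneg)
    qed
    then show ?thesis unfolding F
      by (intro integral_count_space_nat) (auto simp: integrable_count_space_nat_iff)
  qed
  ultimately show ?thesis by simp
qed

lemma summable_abs_fps_mult:
  assumes "summable (\<lambda>n. \<bar>fps_nth f n\<bar>)" "summable (\<lambda>n. \<bar>fps_nth g n\<bar>)"
  shows "summable (\<lambda>n. \<bar>fps_nth (f * g) n :: real\<bar>)"
proof (rule summable_comparison_test')
  show "summable (\<lambda>n. \<Sum>i\<le>n. \<bar>fps_nth f i\<bar> * \<bar>fps_nth g (n - i)\<bar>)"
    using assms by (intro summable_Cauchy_product) auto
  show "norm \<bar>fps_nth (f * g) n\<bar> \<le> (\<Sum>i\<le>n. \<bar>fps_nth f i\<bar> * \<bar>fps_nth g (n - i)\<bar>)" for n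
    using sum_abs[of "\<lambda>i. fps_nth f i * fps_nth g (n - i)" "{..n}"]
    by (auto simp: fps_mult_nth abs_mult atLeast0AtMost)
qed

text \<open>The coefficients form a formal power series so that shifting the Laguerre index is
  multiplication by \<open>fps_X\<close> and fractional integration is multiplication by
  \<open>bincF\<close>.\<close>

definition lagser :: "real \<Rightarrow> real fps \<Rightarrow> real \<Rightarrow> real" where
  "lagser c a t = (\<Sum>n. fps_nth a n * lag n (c * t))"

text \<open>Each Laguerre polynomial is integrated by \<open>integral_RL_lag\<close>. Summing over
  the input index is then a Cauchy product with the weights \<open>lag n (c * t)\<close>, all
  bounded by \<open>exp (c * t)\<close>.\<close>

lemma RL_integral_lagser:
  assumes \<gamma>: "0 \<le> \<gamma>" "\<gamma> \<le> 1" and t: "0 \<le> t" and c: "0 < c"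
    and a: "summable (\<lambda>n. \<bar>fps_nth a n\<bar>)"
  shows "RL_integral_exists \<gamma> (lagser c a) t"
    and "RL_integral \<gamma> (lagser c a) t = c powr (-\<gamma>) * lagser c (bincF \<gamma> * a) t"
proof -
  have int: "(\<lambda>s. (t - s) powr (\<gamma> - 1) * lagser c a s) absolutely_integrable_on {0..t}" if "\<gamma> \<noteq> 0"
    unfolding lagser_def using \<gamma> that c t a
    by (intro lag_series_integral(1) absolutely_integrable_RL_kernel) auto
  then show "RL_integral_exists \<gamma> (lagser c a) t" by (auto simp: RL_integral_exists_def)
  show "RL_integral \<gamma> (lagser c a) t = c powr (-\<gamma>) * lagser c (bincF \<gamma> * a) t"
  proof (cases "\<gamma> = 0")
    case True
    have "bincF 0 = 1"
      by (intro fps_ext) (simp add: binc_def gbinomial_0_left)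
    then show ?thesis using True c by (simp add: RL_integral_def)
  next
    case False
    then have \<gamma>': "0 < \<gamma>" using \<gamma> by simp
    have "(\<lambda>n. fps_nth a n * integral {0..t} (\<lambda>s. (t - s) powr (\<gamma> - 1) * lag n (c * s))) sums
       integral {0..t} (\<lambda>s. (t - s) powr (\<gamma> - 1) * lagser c a s)"
      unfolding lagser_def using \<gamma>' c t a
      by (intro lag_series_integral(2) absolutely_integrable_RL_kernel) auto
    then have "(\<lambda>n. fps_nth a n * (Gamma \<gamma> * c powr (-\<gamma>) * (\<Sum>i. binc \<gamma> i * lag (i + n) (c * t)))) sums
       integral {0..t} (\<lambda>s. (t - s) powr (\<gamma> - 1) * lagser c a s)"
      using \<gamma> \<gamma>' c t by (simp add: integral_RL_lag)
    moreover have "(\<lambda>n. Gamma \<gamma> * c powr (-\<gamma>) * (fps_nth a n * (\<Sum>i. binc \<gamma> i * lag (i + n) (c * t)))) sums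
       (Gamma \<gamma> * c powr (-\<gamma>) * (\<Sum>n. fps_nth (Abs_fps (binc \<gamma>) * Abs_fps (fps_nth a)) n * lag n (c * t)))"
      using \<gamma> c t a by (intro sums_mult Cauchy_product_weighted[where K = "exp (c * t)"] summable_abs_binc abs_lag_le_exp) auto
    ultimately have "integral {0..t} (\<lambda>s. (t - s) powr (\<gamma> - 1) * lagser c a s)
      = Gamma \<gamma> * c powr (-\<gamma>) * lagser c (bincF \<gamma> * a) t"
      by (simp add: sums_iff mult_ac lagser_def bincF_def fps_nth_inverse)
    moreover have "Gamma \<gamma> > 0" using \<gamma>' by (rule Gamma_real_pos)
    ultimately show ?thesis
      using set_lebesgue_integral_eq_integral(2)[OF int[OF False]] False
      by (simp add: RL_integral_def)
  qed
qed

section \<open>Caputo derivatives of Laguerre series\<close>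

lemma RL_integral_cong:
  assumes "0 \<le> t" "\<And>s. s \<in> {0..t} \<Longrightarrow> f s = g s"
  shows "RL_integral \<gamma> f t = RL_integral \<gamma> g t"
    and "RL_integral_exists \<gamma> f t = RL_integral_exists \<gamma> g t"
proof -
  have eq: "(\<lambda>s. indicator {0..t} s *\<^sub>R ((t - s) powr (\<gamma> - 1) * f s))
      = (\<lambda>s. indicator {0..t} s *\<^sub>R ((t - s) powr (\<gamma> - 1) * g s))"
    using assms(2) by (auto simp: fun_eq_iff indicator_def)
  show "RL_integral \<gamma> f t = RL_integral \<gamma> g t"
    using assms eq by (simp add: RL_integral_def set_lebesgue_integral_def)
  show "RL_integral_exists \<gamma> f t = RL_integral_exists \<gamma> g t"
    using eq by (simp add: RL_integral_exists_def set_integrable_def)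
qed

lemma RL_integral_1:
  assumes "RL_integral_exists 1 f t"
  shows "RL_integral 1 f t = integral {0..t} f"
proof -
  have "RL_integral 1 f t = integral {0..t} (\<lambda>s. (t - s) powr (1 - 1) * f s)"
    using assms set_lebesgue_integral_eq_integral(2)[of "{0..t}" "\<lambda>s. (t - s) powr (1 - 1) * f s"]
    by (simp add: RL_integral_def RL_integral_exists_def)
  \<comment> \<open>The kernel \<open>(t - s) powr 0\<close> is 1 except at \<open>s = t\<close>,
    where it is 0.\<close>
  also have "\<dots> = integral {0..t} f"
    by (rule integral_spike[of "{t}"]) auto
  finally show ?thesis .
qed

lemma summable_lagser:
  assumes "summable (\<lambda>n. \<bar>fps_nth a n\<bar>)" "0 \<le> c" "0 \<le> t"
  shows "summable (\<lambda>n. fps_nth a n * lag n (c * t))"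
  by (rule summable_rabs_cancel[OF summable_lag_series[OF assms(1)]]) (use assms in auto)

lemma lagser_fps_const_mult:
  assumes "summable (\<lambda>n. \<bar>fps_nth a n\<bar>)" "0 \<le> c" "0 \<le> t"
  shows "lagser c (fps_const k * a) t = k * lagser c a t"
  using suminf_mult[OF summable_lagser[OF assms], of k] by (simp add: lagser_def mult.assoc)

lemma summable_abs_fps_const: "summable (\<lambda>n. \<bar>fps_nth (fps_const k) n :: real\<bar>)"
  by (rule summable_finite[of "{0}"]) auto

lemma lagser_add:
  assumes "summable (\<lambda>n. \<bar>fps_nth a n\<bar>)" "summable (\<lambda>n. \<bar>fps_nth b n\<bar>)" "0 \<le> c" "0 \<le> t"
  shows "lagser c (a + b) t = lagser c a t + lagser c b t"
  using suminf_add[OF summable_lagser[OF assms(1,3,4)] summable_lagser[OF assms(2,3,4)]]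
  by (simp add: lagser_def distrib_right)

lemma lagser_fps_const: "lagser c (fps_const k) t = k"
proof -
  have "(\<Sum>n. fps_nth (fps_const k) n * lag n (c * t)) = (\<Sum>n\<in>{0}. fps_nth (fps_const k) n * lag n (c * t))"
    by (rule suminf_finite) auto
  then show ?thesis by (simp add: lagser_def)
qed

lemma lagser_0: "lagser c a 0 = (\<Sum>n. fps_nth a n)"
  by (simp add: lagser_def)

lemma continuous_on_lagser:
  assumes "summable (\<lambda>n. \<bar>fps_nth a n\<bar>)" "0 \<le> c"
  shows "continuous_on {0..R} (lagser c a)"
proof -
  have "uniform_limit {0..R} (\<lambda>n t. \<Sum>i<n. fps_nth a i * lag i (c * t)) (lagser c a) sequentially"
    unfolding lagser_def[abs_def]
  proof (rule Weierstrass_m_test)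
    show "summable (\<lambda>n. \<bar>fps_nth a n\<bar> * exp (c * R))" by (intro summable_mult2 assms)
    fix n t assume t: "t \<in> {0..R}"
    then have "\<bar>lag n (c * t)\<bar> \<le> exp (c * R)" using assms by (intro abs_lag_scaled_le) auto
    then show "norm (fps_nth a n * lag n (c * t)) \<le> \<bar>fps_nth a n\<bar> * exp (c * R)"
      by (simp add: abs_mult mult_left_mono)
  qed
  then show ?thesis
    by (rule uniform_limit_theorem[rotated]) (auto intro!: always_eventually continuous_intros)
qed

text \<open>In coefficients, the hypothesis on \<open>a\<close> is the integral equation
  \<open>u = u0 + J^\<beta> d\<close>. Applying the integral of order \<open>1 - \<beta>\<close>
  makes the exponents add up to 1, so what gets differentiated is the ordinary integral of a
  continuous function. The initial value is right because \<open>(1 - X)^\<beta>\<close> vanishes at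
  \<open>X = 1\<close>.\<close>

lemma has_Caputo_derivative_lagser:
  assumes \<beta>: "0 < \<beta>" "\<beta> \<le> 1" and c: "0 < c" and t: "0 \<le> t"
    and d: "summable (\<lambda>n. \<bar>fps_nth d n\<bar>)"
    and a: "a = fps_const u0 + fps_const (c powr (-\<beta>)) * (bincF \<beta> * d)"
  shows "lagser c a 0 = u0"
    and "has_Caputo_derivative {0..} \<beta> (lagser c a) t (lagser c d t)"
proof -
  have bd: "summable (\<lambda>n. \<bar>fps_nth (bincF \<beta> * d) n\<bar>)"
    using \<beta> d by (intro summable_abs_fps_mult) (auto intro: summable_abs_binc)
  define a' where "a' = fps_const (c powr (-\<beta>)) * (bincF \<beta> * d)"
  have a': "summable (\<lambda>n. \<bar>fps_nth a' n\<bar>)"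
    unfolding a'_def by (intro summable_abs_fps_mult bd summable_abs_fps_const)
  have eq: "lagser c a s = u0 + lagser c a' s" if "0 \<le> s" for s
    using lagser_add[OF summable_abs_fps_const a', of c s u0] c that
    by (simp add: a a'_def lagser_fps_const)
  have "(\<Sum>n. fps_nth (bincF \<beta> * d) n) = (\<Sum>k. binc \<beta> k) * (\<Sum>k. fps_nth d k)"
    using Cauchy_product[of "binc \<beta>" "fps_nth d"] summable_abs_binc[of \<beta>] \<beta> d
    by (simp add: fps_mult_nth atLeast0AtMost)
  also have "(\<Sum>k. binc \<beta> k) = 0" using binc_sums_0[OF \<beta>] by (simp add: sums_iff)
  finally have "lagser c (bincF \<beta> * d) 0 = 0" by (simp add: lagser_0)
  then have "lagser c a' 0 = 0" unfolding a'_def using c bd by (subst lagser_fps_const_mult) auto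
  then show a0: "lagser c a 0 = u0" using eq[of 0] by simp
  define h where "h s = lagser c a s - lagser c a 0" for s
  have h: "h s = lagser c a' s" if "0 \<le> s" for s
    using eq[OF that] a0 by (simp add: h_def)
  have ex1: "RL_integral_exists 1 (lagser c d) s" if "0 \<le> s" for s
    using RL_integral_lagser(1)[of 1 s c d] that c d by simp
  have RL: "RL_integral_exists (1 - \<beta>) h s" "RL_integral (1 - \<beta>) h s = integral {0..s} (lagser c d)"
    if s: "0 \<le> s" for s
  proof -
    have "RL_integral_exists (1 - \<beta>) (lagser c a') s"
      using \<beta> c s a' by (intro RL_integral_lagser(1)) auto
    also have "RL_integral_exists (1 - \<beta>) (lagser c a') s \<longleftrightarrow> RL_integral_exists (1 - \<beta>) h s"
      using s h by (intro RL_integral_cong) auto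
    finally show "RL_integral_exists (1 - \<beta>) h s" .
    have bbd: "summable (\<lambda>n. \<bar>fps_nth (bincF (1 - \<beta>) * (bincF \<beta> * d)) n\<bar>)"
      by (rule summable_abs_fps_mult[OF _ bd]) (use \<beta> in \<open>auto intro: summable_abs_binc\<close>)
    have "RL_integral (1 - \<beta>) h s = RL_integral (1 - \<beta>) (lagser c a') s"
      using s h by (intro RL_integral_cong) auto
    also have "\<dots> = c powr (-(1 - \<beta>)) * lagser c (bincF (1 - \<beta>) * a') s"
      using \<beta> c s a' by (intro RL_integral_lagser(2)) auto
    also have "bincF (1 - \<beta>) * a' = fps_const (c powr (-\<beta>)) * (bincF (1 - \<beta>) * (bincF \<beta> * d))"
      by (simp add: a'_def mult_ac)
    also have "lagser c \<dots> s = c powr (-\<beta>) * lagser c (bincF (1 - \<beta>) * (bincF \<beta> * d)) s"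
      using c s bbd by (intro lagser_fps_const_mult) auto
    also have "bincF (1 - \<beta>) * (bincF \<beta> * d) = bincF 1 * d"
      by (simp add: bincF_mult flip: mult.assoc)
    also have "c powr (-(1 - \<beta>)) * (c powr (-\<beta>) * lagser c (bincF 1 * d) s) = c powr (-1) * lagser c (bincF 1 * d) s"
      by (simp flip: mult.assoc powr_add)
    also have "\<dots> = RL_integral 1 (lagser c d) s"
      using c s d by (intro RL_integral_lagser(2)[symmetric]) auto
    also have "\<dots> = integral {0..s} (lagser c d)"
      by (rule RL_integral_1[OF ex1[OF s]])
    finally show "RL_integral (1 - \<beta>) h s = integral {0..s} (lagser c d)" .
  qed
  have "((\<lambda>s. integral {0..s} (lagser c d)) has_real_derivative lagser c d t) (at t within {0..t + 1})"
    \<comment> \<open>The horizon \<open>t + 1\<close> keeps \<open>t\<close> away from the right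
      end, so that only the left end 0 can make the derivative one-sided.\<close>
    using c d t by (intro integral_has_real_derivative continuous_on_lagser) auto
  also have "at t within {0..t + 1} = at t within {0..}"
    by (rule at_within_nhd[of t "{..<t + 1}"]) auto
  finally have "(RL_integral (1 - \<beta>) h has_real_derivative lagser c d t) (at t within {0..})"
    by (rule has_field_derivative_transform_within[where d = 1]) (use t RL in auto)
  then show "has_Caputo_derivative {0..} \<beta> (lagser c a) t (lagser c d t)"
    unfolding has_Caputo_derivative_def has_RL_derivative_def h_def[symmetric, abs_def]
    using RL(1) by auto
qed

section \<open>Lebesgue spaces\<close>

text \<open>Young's inequality for \<open>y\<close> and \<open>m powr (r - 1)\<close>. This
  supporting line is the common root of the Minkowski and Jensen inequalities below.\<close>

lemma powr_tangent_le:
  fixes y m r :: real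
  assumes "1 \<le> r" "0 \<le> y" "0 \<le> m"
  shows "m powr r + r * m powr (r - 1) * (y - m) \<le> y powr r"
proof (cases "m = 0 \<or> r = 1")
  case False
  with assms have m: "0 < m" and r: "1 < r" by auto
  have "y * m powr (r - 1) \<le> y powr r / r + (m powr (r - 1)) powr (r / (r - 1)) / (r / (r - 1))"
    using assms r by (intro Youngs_inequality) (auto simp: field_simps)
  also have "(m powr (r - 1)) powr (r / (r - 1)) = m powr r"
    using r by (simp add: powr_powr)
  finally have "r * (y * m powr (r - 1)) \<le> r * (y powr r / r + m powr r / (r / (r - 1)))"
    using r by (intro mult_left_mono) auto
  also have "\<dots> = y powr r + (r - 1) * m powr r" using r by (simp add: field_simps)
  finally have "r * (y * m powr (r - 1)) \<le> y powr r + (r - 1) * m powr r" .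
  moreover have "m powr r = m powr (r - 1) * m" using m by (simp add: powr_diff)
  ultimately show ?thesis by (simp add: algebra_simps)
qed (use assms in auto)

text \<open>Average the two supporting-line inequalities at the combination \<open>m\<close>; the
  linear terms cancel.\<close>

lemma powr_convex_combination:
  fixes u v r \<theta> :: real
  assumes "1 \<le> r" "0 \<le> u" "0 \<le> v" "0 \<le> \<theta>" "\<theta> \<le> 1"
  shows "(\<theta> * u + (1 - \<theta>) * v) powr r \<le> \<theta> * u powr r + (1 - \<theta>) * v powr r"
proof -
  define m where "m = \<theta> * u + (1 - \<theta>) * v"
  have m: "0 \<le> m" using assms by (simp add: m_def)
  have "\<theta> * (m powr r + r * m powr (r - 1) * (u - m)) + (1 - \<theta>) * (m powr r + r * m powr (r - 1) * (v - m))
      \<le> \<theta> * u powr r + (1 - \<theta>) * v powr r"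
    using assms m by (intro add_mono mult_left_mono powr_tangent_le) auto
  moreover have "\<theta> * (m powr r + r * m powr (r - 1) * (u - m)) + (1 - \<theta>) * (m powr r + r * m powr (r - 1) * (v - m))
      = m powr r + r * m powr (r - 1) * (m - m)"
    by (simp add: m_def algebra_simps)
  ultimately show ?thesis by (simp add: m_def)
qed

text \<open>Membership together with an explicit norm bound. Such bounds pass through sums, limits
  and integrals without side conditions of integrability, because for finite exponents the integral
  is the extended nonnegative one.\<close>

definition Lp_ball :: "'a measure \<Rightarrow> ereal \<Rightarrow> real \<Rightarrow> ('a \<Rightarrow> real) \<Rightarrow> bool" where
  "Lp_ball M p C f \<longleftrightarrow> f \<in> borel_measurable M \<and> 0 \<le> C \<and>
     (if p = \<infinity> then AE x in M. \<bar>f x\<bar> \<le> C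
      else (\<integral>\<^sup>+x. ennreal (\<bar>f x\<bar> powr real_of_ereal p) \<partial>M) \<le> ennreal (C powr real_of_ereal p))"

lemma exponent_cases:
  assumes "1 \<le> (p :: ereal)"
  obtains "p = \<infinity>" | r where "p = ereal r" "1 \<le> r"
  using assms by (cases p) (auto simp: one_ereal_def)

lemma Lp_ballD:
  assumes "Lp_ball M p C f"
  shows "f \<in> borel_measurable M" "0 \<le> C"
  using assms by (auto simp: Lp_ball_def)

text \<open>Only \<open>p = \<infinity>\<close> needs an argument: the essential supremum of a
  nonnegative function can be negative only over a null space, where it is
  \<open>-\<infinity>\<close> and \<open>real_of_ereal\<close> sends it to 0.\<close>

lemma Lp_norm_nonneg:
  assumes "f \<in> Lp_space M p"
  shows "0 \<le> Lp_norm M p f"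
proof (cases "p = \<infinity>")
  case True
  have f: "f \<in> borel_measurable M" using assms by (simp add: Lp_space_def)
  let ?e = "esssup M (\<lambda>x. ereal \<bar>f x\<bar>)"
  have "0 \<le> real_of_ereal ?e"
  proof (rule ccontr)
    assume *: "\<not> 0 \<le> real_of_ereal ?e"
    then have neg: "?e < 0" by (cases ?e) (auto simp: zero_ereal_def)
    have "AE x in M. ereal \<bar>f x\<bar> \<le> ?e" by (rule esssup_AE)
    then have "AE x in M. False"
    proof eventually_elim
      case (elim x)
      have "0 \<le> ereal \<bar>f x\<bar>" by simp
      with elim neg show ?case by (meson leD order_trans)
    qed
    then have "emeasure M (space M) = 0"
      using ae_filter_eq_bot_iff[of M] by (simp add: trivial_limit_def[symmetric] eventually_False)
    then have "?e = - \<infinity>" using f by (intro esssup_zero_space) auto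
    with * show False by simp
  qed
  then show ?thesis using True by (simp add: Lp_norm_def)
qed (simp add: Lp_norm_def)

lemma Lp_ball_iff:
  assumes p: "1 \<le> p"
  shows "Lp_ball M p C f \<longleftrightarrow> f \<in> Lp_space M p \<and> Lp_norm M p f \<le> C"
proof (cases "f \<in> borel_measurable M")
  case f [measurable]: True
  show ?thesis using p
  proof (cases rule: exponent_cases)
    case 1
    let ?e = "esssup M (\<lambda>x. ereal \<bar>f x\<bar>)"
    show ?thesis
    proof
      assume "Lp_ball M p C f"
      then have C: "0 \<le> C" and "AE x in M. ereal \<bar>f x\<bar> \<le> ereal C" by (auto simp: Lp_ball_def 1)
      then have "?e \<le> ereal C" by (intro esssup_I) auto
      then show "f \<in> Lp_space M p \<and> Lp_norm M p f \<le> C"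
        using C by (cases ?e) (auto simp: Lp_space_def Lp_norm_def 1)
    next
      assume *: "f \<in> Lp_space M p \<and> Lp_norm M p f \<le> C"
      then have e: "?e < \<infinity>" "real_of_ereal ?e \<le> C" "0 \<le> C"
        using Lp_norm_nonneg[of f M p] by (auto simp: Lp_space_def Lp_norm_def 1)
      then have "?e \<le> ereal C" by (cases ?e) auto
      then have "AE x in M. \<bar>f x\<bar> \<le> C"
        using esssup_AE[of "\<lambda>x. ereal \<bar>f x\<bar>" M] by (elim eventually_mono) (drule (1) order_trans, simp)
      then show "Lp_ball M p C f" using e by (simp add: Lp_ball_def 1)
    qed
  next
    case (2 r)
    let ?g = "\<lambda>x. \<bar>f x\<bar> powr r"
    show ?thesis
    proof
      assume *: "Lp_ball M p C f"
      then have C: "0 \<le> C" and n: "(\<integral>\<^sup>+x. ennreal (?g x) \<partial>M) \<le> ennreal (C powr r)" by (auto simp: Lp_ball_def 2)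
      have i: "integrable M ?g"
        using n by (intro integrableI_bounded) (auto simp: le_less_trans)
      have "(\<integral>x. ?g x \<partial>M) \<le> C powr r"
        using n i by (subst (asm) nn_integral_eq_integral) auto
      then have "(\<integral>x. ?g x \<partial>M) powr (1 / r) \<le> (C powr r) powr (1 / r)"
        using 2 by (intro powr_mono2) auto
      also have "\<dots> = C" using C 2 by (simp add: powr_powr)
      finally show "f \<in> Lp_space M p \<and> Lp_norm M p f \<le> C"
        using i by (simp add: Lp_space_def Lp_norm_def 2)
    next
      assume *: "f \<in> Lp_space M p \<and> Lp_norm M p f \<le> C"
      then have C: "0 \<le> C" using Lp_norm_nonneg[of f M p] by linarith
      have i: "integrable M ?g" and le: "(\<integral>x. ?g x \<partial>M) powr (1 / r) \<le> C"
        using * by (auto simp: Lp_space_def Lp_norm_def 2)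
      have "(\<integral>x. ?g x \<partial>M) = ((\<integral>x. ?g x \<partial>M) powr (1 / r)) powr r"
        using 2 by (simp add: powr_powr)
      also have "\<dots> \<le> C powr r" using le 2 by (intro powr_mono2) auto
      finally have "(\<integral>\<^sup>+x. ennreal (?g x) \<partial>M) \<le> ennreal (C powr r)"
        using i by (subst nn_integral_eq_integral) (auto intro: ennreal_leI)
      then show "Lp_ball M p C f" using C by (simp add: Lp_ball_def 2)
    qed
  qed
qed (auto simp: Lp_ball_def Lp_space_def)

lemma Lp_ball_norm: "1 \<le> p \<Longrightarrow> f \<in> Lp_space M p \<Longrightarrow> Lp_ball M p (Lp_norm M p f) f"
  by (simp add: Lp_ball_iff)

lemma Lp_ball_mono:
  assumes p: "1 \<le> p" and f: "Lp_ball M p C f" and g [measurable]: "g \<in> borel_measurable M"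
    and le: "AE x in M. \<bar>g x\<bar> \<le> \<bar>f x\<bar>" and D: "C \<le> D"
  shows "Lp_ball M p D g"
  using p
proof (cases rule: exponent_cases)
  case 1
  have "AE x in M. \<bar>f x\<bar> \<le> C" using f by (simp add: Lp_ball_def 1)
  with le have "AE x in M. \<bar>g x\<bar> \<le> D" by eventually_elim (use D in auto)
  then show ?thesis using f D by (simp add: Lp_ball_def 1)
next
  case (2 r)
  have C: "0 \<le> C" using f by (simp add: Lp_ball_def)
  have "(\<integral>\<^sup>+x. ennreal (\<bar>g x\<bar> powr r) \<partial>M) \<le> (\<integral>\<^sup>+x. ennreal (\<bar>f x\<bar> powr r) \<partial>M)"
    using le by (intro nn_integral_mono_AE) (auto elim!: eventually_mono intro!: ennreal_leI powr_mono2 simp: 2 order_trans[OF _ 2(2)])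
  also have "\<dots> \<le> ennreal (C powr r)" using f by (simp add: Lp_ball_def 2)
  also have "\<dots> \<le> ennreal (D powr r)" using C D 2 by (intro ennreal_leI powr_mono2) auto
  finally show ?thesis using C D by (simp add: Lp_ball_def 2)
qed

lemma Lp_ball_weaken: "1 \<le> p \<Longrightarrow> Lp_ball M p C f \<Longrightarrow> C \<le> D \<Longrightarrow> Lp_ball M p D f"
  using Lp_ball_iff order_trans by metis

lemma Lp_ball_cong_AE:
  assumes "1 \<le> p" "Lp_ball M p C f" "g \<in> borel_measurable M" "AE x in M. g x = f x"
  shows "Lp_ball M p C g"
  using assms by (intro Lp_ball_mono[of p M C f g C]) auto

lemma Lp_ball_0: "0 \<le> C \<Longrightarrow> Lp_ball M p C (\<lambda>x. 0)"
  by (simp add: Lp_ball_def)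

lemma Lp_ball_0_AE:
  assumes p: "1 \<le> p" and f: "Lp_ball M p 0 f"
  shows "AE x in M. f x = 0"
  using p
proof (cases rule: exponent_cases)
  case (2 r)
  have [measurable]: "f \<in> borel_measurable M" using f by (simp add: Lp_ball_def)
  have "(\<integral>\<^sup>+x. ennreal (\<bar>f x\<bar> powr r) \<partial>M) = 0" using f 2 by (simp add: Lp_ball_def)
  then have "AE x in M. ennreal (\<bar>f x\<bar> powr r) = 0" by (subst (asm) nn_integral_0_iff_AE) auto
  then show ?thesis by (auto elim!: eventually_mono)
qed (use f in \<open>auto simp: Lp_ball_def\<close>)

lemma Lp_ball_arbitrarily_small:
  assumes p: "1 \<le> p" and f: "\<And>e. 0 < e \<Longrightarrow> \<exists>C\<le>e. Lp_ball M p C f"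
  shows "AE x in M. f x = 0"
proof (rule Lp_ball_0_AE[OF p])
  have "f \<in> Lp_space M p" using f[of 1] by (auto simp: Lp_ball_iff[OF p])
  moreover have "Lp_norm M p f \<le> 0"
    by (rule field_le_epsilon) (use f in \<open>auto simp: Lp_ball_iff[OF p] intro: order_trans\<close>)
  ultimately show "Lp_ball M p 0 f" by (simp add: Lp_ball_iff[OF p])
qed

lemma Lp_ball_cmult:
  assumes p: "1 \<le> p" and f: "Lp_ball M p C f"
  shows "Lp_ball M p (\<bar>k\<bar> * C) (\<lambda>x. k * f x)"
  using p
proof (cases rule: exponent_cases)
  case 1
  then show ?thesis using f by (auto simp: Lp_ball_def abs_mult elim!: eventually_mono intro: mult_left_mono)
next
  case (2 r)
  have [measurable]: "f \<in> borel_measurable M" and C: "0 \<le> C" using f by (simp_all add: Lp_ball_def)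
  have "(\<integral>\<^sup>+x. ennreal (\<bar>k * f x\<bar> powr r) \<partial>M) = (\<integral>\<^sup>+x. ennreal (\<bar>k\<bar> powr r) * ennreal (\<bar>f x\<bar> powr r) \<partial>M)"
    by (simp add: abs_mult powr_mult ennreal_mult)
  also have "\<dots> = ennreal (\<bar>k\<bar> powr r) * (\<integral>\<^sup>+x. ennreal (\<bar>f x\<bar> powr r) \<partial>M)"
    by (rule nn_integral_cmult) simp
  also have "\<dots> \<le> ennreal (\<bar>k\<bar> powr r) * ennreal (C powr r)"
    using f by (intro mult_left_mono) (auto simp: Lp_ball_def 2)
  also have "\<dots> = ennreal ((\<bar>k\<bar> * C) powr r)" using C by (simp add: powr_mult ennreal_mult)
  finally show ?thesis using C by (simp add: Lp_ball_def 2)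
qed

text \<open>Minkowski's inequality by convexity: \<open>\<bar>f + g\<bar> / (C + D)\<close> is at
  most the combination of \<open>\<bar>f\<bar> / C\<close> and \<open>\<bar>g\<bar> / D\<close> with
  weights \<open>C / (C + D)\<close> and \<open>D / (C + D)\<close>. Radius 0 comes first, to allow
  the divisions.\<close>

lemma Lp_ball_add:
  assumes p: "1 \<le> p" and f: "Lp_ball M p C f" and g: "Lp_ball M p D g"
  shows "Lp_ball M p (C + D) (\<lambda>x. f x + g x)"
proof -
  have [measurable]: "f \<in> borel_measurable M" "g \<in> borel_measurable M" and C: "0 \<le> C" and D: "0 \<le> D"
    using f g by (simp_all add: Lp_ball_def)
  show ?thesis
  proof (cases "C = 0 \<or> D = 0")
    case True
    then show ?thesis
    proof
      assume "C = 0"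
      with f have "Lp_ball M p 0 f" by simp
      from Lp_ball_0_AE[OF p this] have "AE x in M. f x + g x = g x" by eventually_elim simp
      with g \<open>C = 0\<close> show ?thesis using Lp_ball_cong_AE[OF p, of M "C + D" g "\<lambda>x. f x + g x"] by simp
    next
      assume "D = 0"
      with g have "Lp_ball M p 0 g" by simp
      from Lp_ball_0_AE[OF p this] have "AE x in M. f x + g x = f x" by eventually_elim simp
      with f \<open>D = 0\<close> show ?thesis using Lp_ball_cong_AE[OF p, of M "C + D" f "\<lambda>x. f x + g x"] by simp
    qed
  next
    case False
    with C D have C: "0 < C" and D: "0 < D" by auto
    show ?thesis using p
    proof (cases rule: exponent_cases)
      case 1
      have "AE x in M. \<bar>f x\<bar> \<le> C" "AE x in M. \<bar>g x\<bar> \<le> D" using f g by (auto simp: Lp_ball_def 1)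
      then have "AE x in M. \<bar>f x + g x\<bar> \<le> C + D" by eventually_elim auto
      then show ?thesis using C D by (simp add: Lp_ball_def 1)
    next
      case (2 r)
      \<comment> \<open>These are the factors that convexity leaves in front of the two powers;
        \<open>c * C powr r + d * D powr r\<close> is exactly \<open>(C + D) powr r\<close>.\<close>
      define c where "c = (C + D) powr r * (C / (C + D)) / C powr r"
      define d where "d = (C + D) powr r * (D / (C + D)) / D powr r"
      have pt: "\<bar>f x + g x\<bar> powr r \<le> c * \<bar>f x\<bar> powr r + d * \<bar>g x\<bar> powr r" for x
      proof -
        define \<theta> where "\<theta> = C / (C + D)"
        have th: "0 \<le> \<theta>" "\<theta> \<le> 1" "1 - \<theta> = D / (C + D)" using C D by (auto simp: \<theta>_def field_simps)
        have eqs: "\<theta> * (\<bar>f x\<bar> / C) = \<bar>f x\<bar> / (C + D)" "(1 - \<theta>) * (\<bar>g x\<bar> / D) = \<bar>g x\<bar> / (C + D)"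
          using C D by (simp_all only: th(3)) (simp_all add: \<theta>_def)
        have "\<bar>f x + g x\<bar> \<le> (C + D) * (\<theta> * (\<bar>f x\<bar> / C) + (1 - \<theta>) * (\<bar>g x\<bar> / D))"
          unfolding eqs using C D by (simp add: distrib_left)
        then have "\<bar>f x + g x\<bar> powr r \<le> ((C + D) * (\<theta> * (\<bar>f x\<bar> / C) + (1 - \<theta>) * (\<bar>g x\<bar> / D))) powr r"
          using 2 by (intro powr_mono2) auto
        also have "\<dots> = (C + D) powr r * (\<theta> * (\<bar>f x\<bar> / C) + (1 - \<theta>) * (\<bar>g x\<bar> / D)) powr r"
          using C D th by (intro powr_mult)
        also have "\<dots> \<le> (C + D) powr r * (\<theta> * (\<bar>f x\<bar> / C) powr r + (1 - \<theta>) * (\<bar>g x\<bar> / D) powr r)"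
          using C D th 2 by (intro mult_left_mono powr_convex_combination) auto
        also have "\<dots> = c * \<bar>f x\<bar> powr r + d * \<bar>g x\<bar> powr r"
          unfolding th(3) using C D by (simp add: powr_divide \<theta>_def c_def d_def distrib_left)
        finally show ?thesis .
      qed
      have cd: "0 \<le> c" "0 \<le> d" using C D by (auto simp: c_def d_def)
      have "(\<integral>\<^sup>+x. ennreal (\<bar>f x + g x\<bar> powr r) \<partial>M)
          \<le> (\<integral>\<^sup>+x. ennreal c * ennreal (\<bar>f x\<bar> powr r) + ennreal d * ennreal (\<bar>g x\<bar> powr r) \<partial>M)"
      proof (rule nn_integral_mono)
        fix x
        have "ennreal (\<bar>f x + g x\<bar> powr r) \<le> ennreal (c * \<bar>f x\<bar> powr r + d * \<bar>g x\<bar> powr r)"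
          by (rule ennreal_leI[OF pt])
        also have "\<dots> = ennreal c * ennreal (\<bar>f x\<bar> powr r) + ennreal d * ennreal (\<bar>g x\<bar> powr r)"
          using cd by (simp add: ennreal_mult)
        finally show "ennreal (\<bar>f x + g x\<bar> powr r) \<le> ennreal c * ennreal (\<bar>f x\<bar> powr r) + ennreal d * ennreal (\<bar>g x\<bar> powr r)" .
      qed
      also have "\<dots> = ennreal c * (\<integral>\<^sup>+x. ennreal (\<bar>f x\<bar> powr r) \<partial>M) + ennreal d * (\<integral>\<^sup>+x. ennreal (\<bar>g x\<bar> powr r) \<partial>M)"
        by (subst nn_integral_add) (auto simp: nn_integral_cmult)
      also have "\<dots> \<le> ennreal c * ennreal (C powr r) + ennreal d * ennreal (D powr r)"
        using f g by (intro add_mono mult_left_mono) (auto simp: Lp_ball_def 2)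
      also have "\<dots> = ennreal (c * C powr r + d * D powr r)"
        using cd by (subst ennreal_plus) (auto simp: ennreal_mult)
      also have "c * C powr r + d * D powr r = (C + D) powr r * (C / (C + D) + D / (C + D))"
        using C D by (simp add: c_def d_def distrib_left)
      also have "C / (C + D) + D / (C + D) = 1" using C D by (simp flip: add_divide_distrib)
      finally show ?thesis using C D by (simp add: Lp_ball_def 2)
    qed
  qed
qed

lemma Lp_ball_diff:
  assumes p: "1 \<le> p" and f: "Lp_ball M p C f" and g: "Lp_ball M p D g"
  shows "Lp_ball M p (C + D) (\<lambda>x. f x - g x)"
  using Lp_ball_add[OF p f Lp_ball_cmult[OF p g, of "-1"]] by simp

lemma Lp_ball_sum:
  assumes p: "1 \<le> p" and f: "\<And>i. i \<in> I \<Longrightarrow> Lp_ball M p (C i) (f i)"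
  shows "Lp_ball M p (\<Sum>i\<in>I. C i) (\<lambda>x. \<Sum>i\<in>I. f i x)"
proof (cases "finite I")
  case True
  then show ?thesis using f
    by (induction I) (auto intro!: Lp_ball_0 Lp_ball_add[OF p])
qed (auto intro: Lp_ball_0)

text \<open>For finite exponents this is Fatou's lemma.\<close>

lemma Lp_ball_limit:
  assumes p: "1 \<le> p" and f: "\<And>n. Lp_ball M p C (f n)" and g: "g \<in> borel_measurable M"
    and lim: "AE x in M. (\<lambda>n. f n x) \<longlonglongrightarrow> g x"
  shows "Lp_ball M p C g"
  using p
proof (cases rule: exponent_cases)
  case 1
  have "AE x in M. \<forall>n. \<bar>f n x\<bar> \<le> C" unfolding AE_all_countable using f by (auto simp: Lp_ball_def 1)
  with lim have "AE x in M. \<bar>g x\<bar> \<le> C"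
    by eventually_elim (auto intro!: LIMSEQ_le_const2[OF tendsto_rabs])
  then show ?thesis using g f by (auto simp: Lp_ball_def 1)
next
  case (2 r)
  have [measurable]: "f n \<in> borel_measurable M" for n using f by (simp add: Lp_ball_def)
  have "(\<integral>\<^sup>+x. ennreal (\<bar>g x\<bar> powr r) \<partial>M) \<le> (\<integral>\<^sup>+x. liminf (\<lambda>n. ennreal (\<bar>f n x\<bar> powr r)) \<partial>M)"
  proof (rule nn_integral_mono_AE)
    show "AE x in M. ennreal (\<bar>g x\<bar> powr r) \<le> liminf (\<lambda>n. ennreal (\<bar>f n x\<bar> powr r))"
      using lim
    proof eventually_elim
      case (elim x)
      have "(\<lambda>n. ennreal (\<bar>f n x\<bar> powr r)) \<longlonglongrightarrow> ennreal (\<bar>g x\<bar> powr r)"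
        using 2 by (intro tendsto_ennrealI tendsto_powr' tendsto_rabs elim tendsto_const) auto
      then show ?case by (metis lim_imp_Liminf order_refl sequentially_bot)
    qed
  qed
  also have "\<dots> \<le> liminf (\<lambda>n. \<integral>\<^sup>+x. ennreal (\<bar>f n x\<bar> powr r) \<partial>M)" by (rule nn_integral_liminf) simp
  also have "\<dots> \<le> liminf (\<lambda>n. ennreal (C powr r))"
    using f by (intro Liminf_mono always_eventually) (auto simp: Lp_ball_def 2)
  also have "\<dots> = ennreal (C powr r)" by (simp add: Liminf_const)
  finally show ?thesis using g f[of 0] by (simp add: Lp_ball_def 2)
qed

text \<open>For finite exponents, monotone convergence bounds the integral of the supremum of the
  powers, which is therefore finite almost everywhere.\<close>

lemma Lp_ball_incseq_bounded:
  fixes F :: "nat \<Rightarrow> 'a \<Rightarrow> real"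
  assumes p: "1 \<le> p" and F: "\<And>n. Lp_ball M p C (F n)" and nonneg: "\<And>n x. 0 \<le> F n x"
    and mono: "\<And>x. incseq (\<lambda>n. F n x)"
  shows "AE x in M. \<exists>K. \<forall>n. F n x \<le> K"
  using p
proof (cases rule: exponent_cases)
  case 1
  have "AE x in M. \<forall>n. F n x \<le> C" unfolding AE_all_countable
    using F nonneg by (auto simp: Lp_ball_def 1 elim!: eventually_mono)
  then show ?thesis by eventually_elim auto
next
  case (2 r)
  have [measurable]: "F n \<in> borel_measurable M" for n using F by (simp add: Lp_ball_def)
  let ?G = "\<lambda>n x. ennreal (F n x powr r)"
  have "incseq ?G"
    using mono nonneg 2 by (auto simp: incseq_def le_fun_def intro!: ennreal_leI powr_mono2)
  then have "(\<integral>\<^sup>+x. (SUP n. ?G n x) \<partial>M) = (SUP n. (\<integral>\<^sup>+x. ?G n x \<partial>M))"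
    by (intro nn_integral_monotone_convergence_SUP) auto
  also have "\<dots> \<le> ennreal (C powr r)"
    using F nonneg by (intro SUP_least) (auto simp: Lp_ball_def 2)
  finally have "(\<integral>\<^sup>+x. (SUP n. ?G n x) \<partial>M) \<noteq> \<infinity>" by (auto simp: top_unique)
  then have "AE x in M. (SUP n. ?G n x) \<noteq> \<infinity>" by (intro nn_integral_PInf_AE) auto
  then show ?thesis
  proof eventually_elim
    case (elim x)
    then obtain K where K: "(SUP n. ?G n x) = ennreal K" "0 \<le> K"
      by (cases "SUP n. ?G n x") auto
    have "F n x \<le> K powr (1 / r)" for n
    proof -
      have "?G n x \<le> ennreal K" unfolding K(1)[symmetric] by (rule SUP_upper) simp
      then have "(F n x powr r) powr (1 / r) \<le> K powr (1 / r)"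
        using K 2 by (intro powr_mono2) auto
      then show ?thesis using 2 nonneg by (simp add: powr_powr)
    qed
    then show ?case by blast
  qed
qed

text \<open>The Riesz-Fischer argument. It takes the place of completeness and yields more: the sum
  converges absolutely at every point off a null set.\<close>

lemma Lp_ball_suminf:
  fixes f :: "nat \<Rightarrow> 'a \<Rightarrow> real"
  assumes p: "1 \<le> p" and f: "\<And>k. Lp_ball M p (C k) (f k)" and C: "summable C"
  shows "AE x in M. summable (\<lambda>k. \<bar>f k x\<bar>)" (is ?s)
    and "Lp_ball M p (\<Sum>k. C k) (\<lambda>x. \<Sum>k. f k x)"
proof -
  have [measurable]: "f n \<in> borel_measurable M" and C0: "0 \<le> C n" for n using f by (auto simp: Lp_ball_def)
  have part: "sum C {..<n} \<le> (\<Sum>k. C k)" for n using C C0 by (intro sum_le_suminf) auto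
  have "AE x in M. \<exists>K. \<forall>n. (\<Sum>k<n. \<bar>f k x\<bar>) \<le> K"
  proof (rule Lp_ball_incseq_bounded[OF p])
    show "Lp_ball M p (\<Sum>k. C k) (\<lambda>x. \<Sum>k<n. \<bar>f k x\<bar>)" for n
      by (rule Lp_ball_mono[OF p Lp_ball_sum[OF p, of "{..<n}" M C "\<lambda>k x. \<bar>f k x\<bar>"]])
         (use part in \<open>auto intro!: Lp_ball_mono[OF p f]\<close>)
  qed (auto simp: incseq_def intro!: sum_nonneg sum_mono2)
  then show s: ?s
  proof eventually_elim
    case (elim x)
    then obtain K where K: "\<And>n. (\<Sum>k<n. \<bar>f k x\<bar>) \<le> K" by blast
    show ?case by (rule bounded_imp_summable[of _ K])
      (use K in \<open>auto simp del: sum.lessThan_Suc simp flip: lessThan_Suc_atMost\<close>)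
  qed
  show "Lp_ball M p (\<Sum>k. C k) (\<lambda>x. \<Sum>k. f k x)"
  proof (rule Lp_ball_limit[OF p])
    show "Lp_ball M p (\<Sum>k. C k) (\<lambda>x. \<Sum>k<n. f k x)" for n
      by (rule Lp_ball_mono[OF p Lp_ball_sum[OF p, of "{..<n}" M C f]]) (use part f in auto)
    show "AE x in M. (\<lambda>n. \<Sum>k<n. f k x) \<longlonglongrightarrow> (\<Sum>k. f k x)"
      using s by eventually_elim (auto intro: summable_LIMSEQ summable_rabs_cancel)
  qed simp
qed

section \<open>Minkowski's inequality for integrals over time\<close>

lemma set_integrable_const_Icc: "set_integrable lborel {a..b::real} (\<lambda>s. k::real)"
  by (simp add: set_integrable_def integrable_real_indicator emeasure_lborel_Icc_eq)

text \<open>Integrate the supporting-line inequality at the mean value; the linear term integrates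
  to 0.\<close>

lemma powr_Jensen:
  fixes g :: "real \<Rightarrow> real"
  assumes r: "1 \<le> r" and ab: "a < b" and g: "set_integrable lborel {a..b} g"
    and gr: "set_integrable lborel {a..b} (\<lambda>s. g s powr r)" and nonneg: "\<And>s. 0 \<le> g s"
  shows "(LINT s:{a..b}|lborel. g s) powr r \<le> (b - a) powr (r - 1) * (LINT s:{a..b}|lborel. g s powr r)"
proof -
  define I where "I = (LINT s:{a..b}|lborel. g s)"
  define m where "m = I / (b - a)"
  have I: "0 \<le> I" unfolding I_def set_lebesgue_integral_def using nonneg by (intro integral_nonneg_AE) auto
  then have m: "0 \<le> m" using ab by (simp add: m_def)
  note c = set_integrable_const_Icc[of a b]
  have "(LINT s:{a..b}|lborel. m powr r + r * m powr (r - 1) * (g s - m)) \<le> (LINT s:{a..b}|lborel. g s powr r)"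
    using r m nonneg g gr c by (intro set_integral_mono powr_tangent_le set_integral_add set_integrable_mult_right set_integral_diff) auto
  also have "(LINT s:{a..b}|lborel. m powr r + r * m powr (r - 1) * (g s - m))
      = (LINT s:{a..b}|lborel. m powr r) + r * m powr (r - 1) * (I - (LINT s:{a..b}|lborel. m))"
    using g c by (simp add: set_integral_add set_integral_diff set_integrable_mult_right I_def)
  also have "(LINT s:{a..b}|lborel. m) = I"
    using ab by (simp add: set_lebesgue_integral_def m_def)
  also have "(LINT s:{a..b}|lborel. m powr r) = (b - a) * m powr r"
    using ab by (simp add: set_lebesgue_integral_def)
  finally have *: "(b - a) * m powr r \<le> (LINT s:{a..b}|lborel. g s powr r)" by simp
  have "I powr r = ((b - a) * m) powr r" using ab by (simp add: m_def)
  also have "\<dots> = (b - a) powr r * m powr r" using ab m by (simp add: powr_mult)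
  also have "(b - a) powr r = (b - a) powr (r - 1) * (b - a)" using ab by (simp add: powr_diff)
  finally have "I powr r = (b - a) powr (r - 1) * ((b - a) * m powr r)" by simp
  also have "\<dots> \<le> (b - a) powr (r - 1) * (LINT s:{a..b}|lborel. g s powr r)"
    using * by (intro mult_left_mono) auto
  finally show ?thesis by (simp add: I_def)
qed

lemma set_integrable_of_powr:
  fixes g :: "real \<Rightarrow> real"
  assumes r: "1 \<le> r" and g: "g \<in> borel_measurable borel"
    and gr: "set_integrable lborel {a..b} (\<lambda>s. \<bar>g s\<bar> powr r)"
  shows "set_integrable lborel {a..b} g"
proof (rule set_integrable_bound)
  show "set_integrable lborel {a..b} (\<lambda>s. 1 + \<bar>g s\<bar> powr r)"
    using gr by (intro set_integral_add set_integrable_const_Icc)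
  have "\<bar>y\<bar> \<le> 1 + \<bar>y\<bar> powr r" for y :: real
  proof (cases "\<bar>y\<bar> \<le> 1")
    case False
    then have "\<bar>y\<bar> powr 1 \<le> \<bar>y\<bar> powr r" using r by (intro powr_mono) auto
    then show ?thesis by simp
  qed (simp add: add_increasing2)
  then show "AE s in lborel. s \<in> {a..b} \<longrightarrow> norm (g s) \<le> norm (1 + \<bar>g s\<bar> powr r)"
    by (auto intro!: AE_I2 intro: order_trans[OF _ abs_ge_self])
qed (use g in \<open>simp add: set_borel_measurable_def\<close>)

text \<open>At fixed \<open>x\<close>, Jensen's inequality moves the power under the time integral
  at the cost of \<open>(b - a) powr (r - 1)\<close>; Tonelli's theorem then contributes
  \<open>(b - a) * C powr r\<close>. The bound is assumed for almost every time only, since a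
  jointly measurable representative matches the curve only there.\<close>

lemma Lp_ball_integral:
  fixes F :: "real \<Rightarrow> 'a \<Rightarrow> real"
  assumes p: "1 \<le> p" and M: "sigma_finite_measure M" and ab: "a \<le> b" and C: "0 \<le> C"
    and F [measurable]: "(\<lambda>(s, x). F s x) \<in> borel_measurable (lborel \<Otimes>\<^sub>M M)"
    and bound: "AE s in lborel. s \<in> {a..b} \<longrightarrow> Lp_ball M p C (F s)"
  shows "AE x in M. set_integrable lborel {a..b} (\<lambda>s. F s x)"
    and "Lp_ball M p ((b - a) * C) (\<lambda>x. LINT s:{a..b}|lborel. F s x)"
proof -
  interpret M: sigma_finite_measure M by fact
  interpret P: pair_sigma_finite lborel M ..
  have meas: "(\<lambda>x. LINT s:{a..b}|lborel. F s x) \<in> borel_measurable M"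
    unfolding set_lebesgue_integral_def by measurable
  have mF: "(\<lambda>s. F s x) \<in> borel_measurable borel" if "x \<in> space M" for x
    using measurable_Pair1[OF F, of x] that measurable_compose[of "\<lambda>s. (s, x)" lborel, OF _ F] by simp
  have "(AE x in M. set_integrable lborel {a..b} (\<lambda>s. F s x)) \<and>
     Lp_ball M p ((b - a) * C) (\<lambda>x. LINT s:{a..b}|lborel. F s x)"
  proof (cases "a = b")
    case True
    have n: "emeasure lborel {b..b} = 0" by simp
    have z: "AE s in lborel. indicator {b..b} s *\<^sub>R F s x = 0" for x
      using AE_lborel_singleton[of b] by eventually_elim auto
    have "(LINT s:{b..b}|lborel. F s x) = 0" for x
      unfolding set_lebesgue_integral_def by (rule integral_eq_zero_AE[OF z])
    moreover have "AE x in M. set_integrable lborel {b..b} (\<lambda>s. F s x)"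
    proof (rule AE_I2)
      fix x assume "x \<in> space M"
      note [measurable] = mF[OF this]
      show "set_integrable lborel {b..b} (\<lambda>s. F s x)"
        unfolding set_integrable_def
        by (rule integrable_cong_AE_imp[of _ "\<lambda>s. 0"]) (use z[of x] in \<open>auto elim: eventually_mono\<close>)
    qed
    ultimately show ?thesis using True by (auto intro: Lp_ball_0)
  next
    case False
    with ab have ab: "a < b" by simp
    show ?thesis using p
    proof (cases rule: exponent_cases)
      case 1
      have "AE s in lborel. AE x in M. s \<in> {a..b} \<longrightarrow> \<bar>F s x\<bar> \<le> C"
        using bound by eventually_elim (auto simp: Lp_ball_def 1)
      then have *: "AE x in M. AE s in lborel. s \<in> {a..b} \<longrightarrow> \<bar>F s x\<bar> \<le> C"
        by (subst (asm) P.AE_commute) measurable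
      have "AE x in M. set_integrable lborel {a..b} (\<lambda>s. F s x) \<and> \<bar>LINT s:{a..b}|lborel. F s x\<bar> \<le> (b - a) * C"
        using * AE_space
      proof eventually_elim
        case (elim x)
        note [measurable] = mF[OF elim(2)]
        have i: "set_integrable lborel {a..b} (\<lambda>s. F s x)"
        proof (rule set_integrable_bound)
          show "set_integrable lborel {a..b} (\<lambda>s. C)" by (rule set_integrable_const_Icc)
        qed (use elim(1) in \<open>auto simp: set_borel_measurable_def elim!: eventually_mono\<close>)
        have "\<bar>LINT s:{a..b}|lborel. F s x\<bar> \<le> (LINT s:{a..b}|lborel. \<bar>F s x\<bar>)"
          using set_integral_norm_bound[OF i] by simp
        also have "\<dots> \<le> (LINT s:{a..b}|lborel. C)"
          using elim(1) i by (intro set_integral_mono_AE set_integrable_abs set_integrable_const_Icc) auto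
        also have "\<dots> = (b - a) * C" using ab by (simp add: set_lebesgue_integral_def)
        finally show ?case using i by simp
      qed
      then show ?thesis using meas ab C by (auto simp: Lp_ball_def 1 elim!: eventually_mono)
    next
      case (2 r)
      let ?J = "\<lambda>x. \<integral>\<^sup>+s. indicator {a..b} s * ennreal (\<bar>F s x\<bar> powr r) \<partial>lborel"
      have Jm: "?J \<in> borel_measurable M" by measurable
      have "(\<integral>\<^sup>+x. ?J x \<partial>M) = (\<integral>\<^sup>+s. \<integral>\<^sup>+x. indicator {a..b} s * ennreal (\<bar>F s x\<bar> powr r) \<partial>M \<partial>lborel)"
        by (rule P.Fubini') measurable
      also have "\<dots> \<le> (\<integral>\<^sup>+s. indicator {a..b} s * ennreal (C powr r) \<partial>lborel)"
      proof (rule nn_integral_mono_AE)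
        show "AE s in lborel. (\<integral>\<^sup>+x. indicator {a..b} s * ennreal (\<bar>F s x\<bar> powr r) \<partial>M) \<le> indicator {a..b} s * ennreal (C powr r)"
          using bound by eventually_elim (auto simp: Lp_ball_def 2 indicator_def)
      qed
      also have "\<dots> = ennreal ((b - a) * C powr r)"
        using ab by (subst nn_integral_multc) (auto simp: ennreal_mult)
      finally have J: "(\<integral>\<^sup>+x. ?J x \<partial>M) \<le> ennreal ((b - a) * C powr r)" .
      then have "(\<integral>\<^sup>+x. ?J x \<partial>M) \<noteq> \<infinity>" by (auto simp: top_unique)
      then have "AE x in M. ?J x \<noteq> \<infinity>" using Jm by (intro nn_integral_PInf_AE) auto
      then have main: "AE x in M. set_integrable lborel {a..b} (\<lambda>s. F s x) \<and>
          ennreal (\<bar>LINT s:{a..b}|lborel. F s x\<bar> powr r) \<le> ennreal ((b - a) powr (r - 1)) * ?J x"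
        using AE_space
      proof eventually_elim
        case (elim x)
        note [measurable] = mF[OF elim(2)]
        have Jeq: "?J x = (\<integral>\<^sup>+s. ennreal (indicator {a..b} s *\<^sub>R (\<bar>F s x\<bar> powr r)) \<partial>lborel)"
          by (intro nn_integral_cong) (auto simp: indicator_def)
        have ir: "set_integrable lborel {a..b} (\<lambda>s. \<bar>F s x\<bar> powr r)"
          unfolding set_integrable_def
        proof (rule integrableI_bounded)
          show "(\<integral>\<^sup>+s. ennreal (norm (indicator {a..b} s *\<^sub>R (\<bar>F s x\<bar> powr r))) \<partial>lborel) < \<infinity>"
            using elim(1) Jeq by (simp add: top.not_eq_extremum)
        qed simp
        have i: "set_integrable lborel {a..b} (\<lambda>s. F s x)"
          by (rule set_integrable_of_powr[OF _ _ ir]) (use 2 in auto)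
        have "\<bar>LINT s:{a..b}|lborel. F s x\<bar> \<le> (LINT s:{a..b}|lborel. \<bar>F s x\<bar>)"
          using set_integral_norm_bound[OF i] by simp
        then have "\<bar>LINT s:{a..b}|lborel. F s x\<bar> powr r \<le> (LINT s:{a..b}|lborel. \<bar>F s x\<bar>) powr r"
          using 2 by (intro powr_mono2) auto
        also have "\<dots> \<le> (b - a) powr (r - 1) * (LINT s:{a..b}|lborel. \<bar>F s x\<bar> powr r)"
          using 2 ab ir i by (intro powr_Jensen set_integrable_abs) auto
        finally have le: "\<bar>LINT s:{a..b}|lborel. F s x\<bar> powr r \<le> (b - a) powr (r - 1) * (LINT s:{a..b}|lborel. \<bar>F s x\<bar> powr r)" .
        have "?J x = ennreal (LINT s:{a..b}|lborel. \<bar>F s x\<bar> powr r)"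
          unfolding Jeq set_lebesgue_integral_def using ir
          by (intro nn_integral_eq_integral) (auto simp: set_integrable_def)
        with le i show ?case by (simp add: ennreal_mult' [symmetric] ennreal_leI)
      qed
      have "(\<integral>\<^sup>+x. ennreal (\<bar>LINT s:{a..b}|lborel. F s x\<bar> powr r) \<partial>M) \<le> (\<integral>\<^sup>+x. ennreal ((b - a) powr (r - 1)) * ?J x \<partial>M)"
        using main by (intro nn_integral_mono_AE) (auto elim: eventually_mono)
      also have "\<dots> = ennreal ((b - a) powr (r - 1)) * (\<integral>\<^sup>+x. ?J x \<partial>M)"
        using Jm by (rule nn_integral_cmult)
      also have "\<dots> \<le> ennreal ((b - a) powr (r - 1)) * ennreal ((b - a) * C powr r)"
        using J by (intro mult_left_mono) auto
      also have "\<dots> = ennreal (((b - a) * C) powr r)"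
        using ab C by (simp add: powr_mult powr_diff flip: ennreal_mult)
      finally show ?thesis using main meas ab C by (auto simp: Lp_ball_def 2 elim!: eventually_mono)
    qed
  qed
  then show "AE x in M. set_integrable lborel {a..b} (\<lambda>s. F s x)"
    "Lp_ball M p ((b - a) * C) (\<lambda>x. LINT s:{a..b}|lborel. F s x)" by auto
qed

section \<open>Bounded operators on Lebesgue spaces\<close>

text \<open>The operator acts on representatives, so every law drawn from these assumptions holds
  almost everywhere only. Taking \<open>K\<close> nonnegative makes multiplication by it
  monotone.\<close>

locale Lp_operator =
  fixes M :: "'a measure" and p :: ereal and A :: "('a \<Rightarrow> real) \<Rightarrow> ('a \<Rightarrow> real)" and K :: real
  assumes p: "1 \<le> p" and A: "bounded_linear_Lp M p A"
    and K: "0 \<le> K" "\<And>f. f \<in> Lp_space M p \<Longrightarrow> Lp_norm M p (A f) \<le> K * Lp_norm M p f"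

lemma Lp_operatorI:
  assumes p: "1 \<le> p" and A: "bounded_linear_Lp M p A"
  obtains K where "Lp_operator M p A K"
proof -
  obtain C where C: "\<And>f. f \<in> Lp_space M p \<Longrightarrow> Lp_norm M p (A f) \<le> C * Lp_norm M p f"
    using A unfolding bounded_linear_Lp_def by blast
  have "Lp_operator M p A (max 0 C)"
  proof
    fix f assume f: "f \<in> Lp_space M p"
    show "Lp_norm M p (A f) \<le> max 0 C * Lp_norm M p f"
      using C[OF f] mult_right_mono[of C "max 0 C" "Lp_norm M p f"] Lp_norm_nonneg[OF f] by simp
  qed (use p A in auto)
  then show ?thesis by (rule that)
qed

context Lp_operator
begin

abbreviation ball :: "real \<Rightarrow> ('a \<Rightarrow> real) \<Rightarrow> bool" where
  "ball \<equiv> Lp_ball M p"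

lemma A_ball:
  assumes f: "ball C f"
  shows "ball (K * C) (A f)"
proof -
  have *: "f \<in> Lp_space M p" "Lp_norm M p f \<le> C" using f by (auto simp: Lp_ball_iff[OF p])
  have "Lp_norm M p (A f) \<le> K * Lp_norm M p f" by (rule K) fact
  also have "\<dots> \<le> K * C" using * K by (intro mult_left_mono)
  finally show ?thesis using A * by (auto simp: Lp_ball_iff[OF p] bounded_linear_Lp_def)
qed

lemma A_measurable: "ball C f \<Longrightarrow> A f \<in> borel_measurable M"
  using A_ball Lp_ballD by blast

lemma A_cong: "ball C f \<Longrightarrow> ball D g \<Longrightarrow> AE x in M. f x = g x \<Longrightarrow> AE x in M. A f x = A g x"
  using A by (auto simp: Lp_ball_iff[OF p] bounded_linear_Lp_def)

lemma A_add: "ball C f \<Longrightarrow> ball D g \<Longrightarrow> AE x in M. A (\<lambda>x. f x + g x) x = A f x + A g x"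
  using A by (auto simp: Lp_ball_iff[OF p] bounded_linear_Lp_def)

lemma A_cmult: "ball C f \<Longrightarrow> AE x in M. A (\<lambda>x. c * f x) x = c * A f x"
  using A by (auto simp: Lp_ball_iff[OF p] bounded_linear_Lp_def)

lemma A_0: "AE x in M. A (\<lambda>x. 0) x = 0"
  using A_cmult[OF Lp_ball_0[of 0], of 0] by simp

lemma A_diff:
  assumes f: "ball C f" and g: "ball D g"
  shows "AE x in M. A (\<lambda>x. f x - g x) x = A f x - A g x"
  using A_add[OF f Lp_ball_cmult[OF p g, of "-1"]] A_cmult[OF g, of "-1"]
  by eventually_elim simp

lemma A_sum:
  fixes f :: "nat \<Rightarrow> 'a \<Rightarrow> real"
  assumes f: "\<And>k. ball (C k) (f k)"
  shows "AE x in M. A (\<lambda>x. \<Sum>k<n. f k x) x = (\<Sum>k<n. A (f k) x)"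
proof (induction n)
  case 0
  show ?case using A_0 by simp
next
  case (Suc n)
  have S: "ball (\<Sum>k<n. C k) (\<lambda>x. \<Sum>k<n. f k x)" by (intro Lp_ball_sum[OF p] f)
  from A_add[OF S f[of n]] Suc
  show ?case by eventually_elim simp
qed

text \<open>Split off the first \<open>n\<close> terms, where linearity suffices. The defect
  \<open>R\<close> then lies in a ball of radius \<open>2 * K\<close> times the tail of
  \<open>C\<close>, for every \<open>n\<close>, and so vanishes.\<close>

lemma A_suminf:
  fixes f :: "nat \<Rightarrow> 'a \<Rightarrow> real"
  assumes f: "\<And>k. ball (C k) (f k)" and C: "summable C"
  shows "AE x in M. A (\<lambda>x. \<Sum>k. f k x) x = (\<Sum>k. A (f k) x)"
proof -
  have C0: "0 \<le> C n" for n using f by (auto simp: Lp_ball_def)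
  have KC: "summable (\<lambda>k. K * C k)" by (intro summable_mult C)
  have Cn: "summable (\<lambda>k. C (k + n))" for n using C by simp
  define R where "R x = A (\<lambda>x. \<Sum>k. f k x) x - (\<Sum>k. A (f k) x)" for x
  have R: "ball ((\<Sum>k. C (k + n)) * (2 * K)) R" for n
  proof -
    let ?t = "\<lambda>x. \<Sum>k. f (k + n) x"
    have S: "ball (\<Sum>k<n. C k) (\<lambda>x. \<Sum>k<n. f k x)" by (intro Lp_ball_sum[OF p] f)
    have t: "ball (\<Sum>k. C (k + n)) ?t" by (rule Lp_ball_suminf[OF p f Cn])
    have "AE x in M. (\<Sum>k. f k x) = (\<Sum>k<n. f k x) + ?t x"
      using Lp_ball_suminf(1)[OF p f C]
      by eventually_elim (subst suminf_split_initial_segment[where k = n], auto intro: summable_rabs_cancel)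
    from A_cong[OF Lp_ball_suminf(2)[OF p f C] Lp_ball_add[OF p S t] this]
    have 1: "AE x in M. A (\<lambda>x. \<Sum>k. f k x) x = A (\<lambda>x. (\<Sum>k<n. f k x) + ?t x) x" .
    have 2: "AE x in M. A (\<lambda>x. (\<Sum>k<n. f k x) + ?t x) x = A (\<lambda>x. \<Sum>k<n. f k x) x + A ?t x"
      by (rule A_add[OF S t])
    have 3: "AE x in M. A (\<lambda>x. \<Sum>k<n. f k x) x = (\<Sum>k<n. A (f k) x)"
      by (rule A_sum[where C = C]) (rule f)
    have 4: "AE x in M. summable (\<lambda>k. \<bar>A (f k) x\<bar>)"
      by (rule Lp_ball_suminf(1)[OF p _ KC]) (intro A_ball f)
    from 1 2 3 4 have eq: "AE x in M. R x = A ?t x - (\<Sum>k. A (f (k + n)) x)"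
    proof eventually_elim
      case (elim x)
      have "(\<Sum>k. A (f k) x) = (\<Sum>k. A (f (k + n)) x) + (\<Sum>k<n. A (f k) x)"
        by (rule suminf_split_initial_segment[OF summable_rabs_cancel[OF elim(4)]])
      with elim(1-3) show ?case by (simp add: R_def)
    qed
    have "ball (K * (\<Sum>k. C (k + n)) + (\<Sum>k. K * C (k + n))) (\<lambda>x. A ?t x - (\<Sum>k. A (f (k + n)) x))"
      by (intro Lp_ball_diff[OF p] A_ball t Lp_ball_suminf(2)[OF p] f summable_mult Cn)
    moreover have "K * (\<Sum>k. C (k + n)) + (\<Sum>k. K * C (k + n)) = (\<Sum>k. C (k + n)) * (2 * K)"
      using Cn by (simp add: suminf_mult)
    moreover have "R \<in> borel_measurable M"
      unfolding R_def[abs_def] using A_measurable[OF Lp_ball_suminf(2)[OF p f C]] A_measurable[OF f]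
      by (intro borel_measurable_diff borel_measurable_suminf) auto
    ultimately show ?thesis using Lp_ball_cong_AE[OF p _ _ eq] by simp
  qed
  have lim: "(\<lambda>n. (\<Sum>k. C (k + n)) * (2 * K)) \<longlonglongrightarrow> 0 * (2 * K)"
    using C by (intro tendsto_mult tendsto_const suminf_exist_split2)
  have "AE x in M. R x = 0"
  proof (rule Lp_ball_arbitrarily_small[OF p])
    fix e :: real assume "0 < e"
    then have "eventually (\<lambda>n. (\<Sum>k. C (k + n)) * (2 * K) < e) sequentially"
      using lim by (intro order_tendstoD(2)[of _ 0]) auto
    then obtain n where "(\<Sum>k. C (k + n)) * (2 * K) < e" by (meson eventually_at_top_linorder order_refl)
    then show "\<exists>C\<le>e. ball C R" using R[of n] by (intro exI[of _ "(\<Sum>k. C (k + n)) * (2 * K)"]) auto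
  qed
  then show ?thesis by eventually_elim (simp add: R_def)
qed

end

section \<open>Existence\<close>

lemma exists_scale:
  assumes "0 < \<alpha>0" "0 \<le> (B :: real)"
  obtains c where "1 \<le> c" "c powr (-\<alpha>0) * B \<le> 1/2"
proof
  \<comment> \<open>Chosen so that \<open>c powr \<alpha>0 = 2 * B + 1\<close>: the product becomes
    \<open>B / (2 * B + 1)\<close>, and the summand 1 ensures \<open>1 \<le> c\<close>.\<close>
  define c where "c = (2 * B + 1) powr (1 / \<alpha>0)"
  show "1 \<le> c" unfolding c_def using assms by (intro ge_one_powr_ge_zero) auto
  have "c powr \<alpha>0 = 2 * B + 1" using assms by (simp add: c_def powr_powr)
  then have "c powr (-\<alpha>0) * B = B / (2 * B + 1)" by (simp add: powr_minus field_simps)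
  also have "\<dots> \<le> 1/2" using assms by (simp add: field_simps)
  finally show "c powr (-\<alpha>0) * B \<le> 1/2" .
qed

lemma borel_measurable_binc [measurable]: "(\<lambda>\<beta>. binc \<beta> n) \<in> borel_measurable borel"
  by (induction n) (auto simp: binc_Suc')

context Lp_operator
begin

lemma ball_mult_bounded:
  assumes f: "ball C f" and g: "g \<in> borel_measurable M" and le: "AE x in M. \<bar>g x\<bar> \<le> k" and k: "0 \<le> k"
  shows "ball (k * C) (\<lambda>x. g x * f x)"
proof (rule Lp_ball_mono[OF p])
  show "ball (k * C) (\<lambda>x. k * f x)" using Lp_ball_cmult[OF p f, of k] k by simp
  show "AE x in M. \<bar>g x * f x\<bar> \<le> \<bar>k * f x\<bar>"
    using le by eventually_elim (use k in \<open>auto simp: abs_mult intro: mult_right_mono\<close>)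
qed (use f g in \<open>auto dest: Lp_ballD\<close>)

text \<open>Here the bounds on the order enter the norm estimates. As \<open>1 \<le> c\<close>, the
  power of \<open>c\<close> is largest at \<alpha>0, so the multiplier has a bound free of
  \<open>x\<close>. Both contractions, for existence and for uniqueness, rest on it.\<close>

lemma ball_weight:
  assumes \<alpha> [measurable]: "\<alpha> \<in> borel_measurable M" and \<alpha>0: "0 < \<alpha>0"
    and \<alpha>_bounds: "AE x in M. \<alpha>0 \<le> \<alpha> x \<and> \<alpha> x \<le> 1" and c: "1 \<le> c" and f: "ball C f"
  shows "ball ((c powr (-\<alpha>0) * binc_bound \<alpha>0 i) * C) (\<lambda>x. (c powr (-\<alpha> x) * binc (\<alpha> x) i) * f x)"
proof (rule ball_mult_bounded[OF f])
  show "AE x in M. \<bar>c powr (-\<alpha> x) * binc (\<alpha> x) i\<bar> \<le> c powr (-\<alpha>0) * binc_bound \<alpha>0 i"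
    using \<alpha>_bounds
  proof eventually_elim
    case (elim x)
    have "c powr (-\<alpha> x) \<le> c powr (-\<alpha>0)" using elim c by (intro powr_mono) auto
    moreover have "\<bar>binc (\<alpha> x) i\<bar> \<le> binc_bound \<alpha>0 i" using elim \<alpha>0 by (intro abs_binc_le_bound) auto
    ultimately show ?case unfolding abs_mult by (intro mult_mono) auto
  qed
qed (use \<alpha>0 binc_bound_nonneg in auto)

text \<open>The term \<open>i = 0\<close> contains \<open>A (a m)\<close> itself, so the system is
  not an explicit recursion; it is solved by a Neumann series. The iterates \<open>it k\<close> are
  dominated by numbers \<open>e k\<close> obeying the same recursion with absolute values, a
  convolution, so the choice of \<open>c\<close> halves the total mass of \<open>e k\<close> at each
  step.\<close>

lemma coefficients_exist:
  assumes \<alpha>: "\<alpha> \<in> borel_measurable M" and \<alpha>0: "0 < \<alpha>0" "\<alpha>0 \<le> 1"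
    and \<alpha>_bounds: "AE x in M. \<alpha>0 \<le> \<alpha> x \<and> \<alpha> x \<le> 1" and u0: "ball U u0"
  obtains c :: real and a :: "nat \<Rightarrow> 'a \<Rightarrow> real" and e :: "nat \<Rightarrow> real"
    where "1 \<le> c" "\<And>m. ball (e m) (a m)" "summable e"
      "\<And>m. AE x in M. a m x = (if m = 0 then u0 x else 0)
          + c powr (-\<alpha> x) * (\<Sum>i\<le>m. binc (\<alpha> x) i * A (a (m - i)) x)"
proof -
  define B where "B = (\<Sum>i. binc_bound \<alpha>0 i)"
  have bb: "summable (binc_bound \<alpha>0)" and bb0: "0 \<le> binc_bound \<alpha>0 i" for i
    using \<alpha>0 by (auto intro: summable_binc_bound binc_bound_nonneg)
  have B: "0 \<le> B" unfolding B_def using bb bb0 by (intro suminf_nonneg)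
  obtain c where c: "1 \<le> c" and small: "c powr (-\<alpha>0) * (B * K) \<le> 1/2"
    using exists_scale[of \<alpha>0 "B * K"] \<alpha>0 B K by auto
  define step where "step a m x = c powr (-\<alpha> x) * (\<Sum>i\<le>m. binc (\<alpha> x) i * A (a (m - i)) x)"
    for a :: "nat \<Rightarrow> 'a \<Rightarrow> real" and m x
  define a0 where "a0 m x = (if m = 0 then u0 x else 0)" for m :: nat and x
  define it where "it k = (step ^^ k) a0" for k
  define estep where "estep e m = c powr (-\<alpha>0) * (\<Sum>i\<le>m. binc_bound \<alpha>0 i * (K * e (m - i)))"
    for e :: "nat \<Rightarrow> real" and m
  define e0 where "e0 m = (if m = 0 then U else 0)" for m :: nat
  define e where "e k = (estep ^^ k) e0" for k
  have U: "0 \<le> U" using u0 by (rule Lp_ballD)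
  have it_Suc: "it (Suc k) m x = c powr (-\<alpha> x) * (\<Sum>i\<le>m. binc (\<alpha> x) i * A (it k (m - i)) x)" for k m x
    by (simp add: it_def step_def)
  have e_Suc: "e (Suc k) m = c powr (-\<alpha>0) * (\<Sum>i\<le>m. binc_bound \<alpha>0 i * (K * e k (m - i)))" for k m
    by (simp add: e_def estep_def)
  have ball_it: "ball (e k m) (it k m)" for k m
  proof (induction k arbitrary: m)
    case 0
    show ?case using u0 by (cases m) (simp_all add: it_def a0_def[abs_def] e_def e0_def Lp_ball_0)
  next
    case (Suc k)
    have "ball (\<Sum>i\<le>m. (c powr (-\<alpha>0) * binc_bound \<alpha>0 i) * (K * e k (m - i)))
       (\<lambda>x. \<Sum>i\<le>m. (c powr (-\<alpha> x) * binc (\<alpha> x) i) * A (it k (m - i)) x)"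
      by (intro Lp_ball_sum[OF p] ball_weight \<alpha> \<alpha>0(1) \<alpha>_bounds c A_ball Suc)
    then show ?case by (simp add: it_Suc[abs_def] e_Suc sum_distrib_left mult.assoc)
  qed
  have e0le: "0 \<le> e k m" for k m using ball_it by (rule Lp_ballD)
  have sum_e: "summable (e k) \<and> (\<Sum>m. e k m) \<le> U * (1/2) ^ k" for k
  proof (induction k)
    case 0
    have "e 0 sums U"
      using sums_single[of 0 "\<lambda>_. U"] by (simp add: e_def e0_def[abs_def])
    then show ?case by (simp add: sums_iff)
  next
    case (Suc k)
    then have ek: "summable (\<lambda>m. K * e k m)" by (intro summable_mult) auto
    have "(\<lambda>m. \<Sum>i\<le>m. binc_bound \<alpha>0 i * (K * e k (m - i))) sums (B * (\<Sum>m. K * e k m))"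
      unfolding B_def using ek bb bb0 e0le K by (intro Cauchy_product_sums) auto
    then have "e (Suc k) sums (c powr (-\<alpha>0) * (B * (\<Sum>m. K * e k m)))"
      unfolding e_Suc[abs_def] by (rule sums_mult)
    moreover have "c powr (-\<alpha>0) * (B * (\<Sum>m. K * e k m)) = (c powr (-\<alpha>0) * (B * K)) * (\<Sum>m. e k m)"
      using Suc by (simp add: suminf_mult)
    moreover have "\<dots> \<le> 1/2 * (U * (1/2) ^ k)"
      using Suc small e0le by (intro mult_mono) (auto intro: suminf_nonneg)
    ultimately show ?case by (auto simp: sums_iff)
  qed
  have e_le: "e k m \<le> U * (1/2) ^ k" for k m
  proof -
    have "e k m \<le> (\<Sum>m. e k m)" using sum_le_suminf[of "e k" "{m}"] sum_e[of k] e0le by simp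
    then show ?thesis using sum_e[of k] by linarith
  qed
  have geo: "summable (\<lambda>k. U * (1/2) ^ k)" by (intro summable_mult summable_geometric) simp
  have ek: "summable (\<lambda>k. e k m)" for m
    by (rule summable_comparison_test'[OF geo, of 0]) (use e_le e0le in auto)
  define a where "a m x = (\<Sum>k. it k m x)" for m x
  define e' where "e' m = (\<Sum>k. e k m)" for m
  show ?thesis
  proof
    show "1 \<le> c" by fact
    show "ball (e' m) (a m)" for m
      unfolding a_def[abs_def] e'_def by (rule Lp_ball_suminf[OF p ball_it ek])
    show "summable e'"
    proof (rule bounded_imp_summable)
      show "0 \<le> e' m" for m unfolding e'_def using ek e0le by (rule suminf_nonneg)
      fix n
      \<comment> \<open>Summing over the coefficients before summing over the iterates gives a
        geometric bound independent of \<open>n\<close>.\<close>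
      have "(\<Sum>m\<le>n. e' m) = (\<Sum>k. \<Sum>m\<le>n. e k m)"
        unfolding e'_def using ek by (rule suminf_sum[symmetric])
      also have "\<dots> \<le> (\<Sum>k. U * (1/2) ^ k)"
      proof (rule suminf_le)
        show "(\<Sum>m\<le>n. e k m) \<le> U * (1/2) ^ k" for k
          using sum_le_suminf[of "e k" "{..n}"] sum_e[of k] e0le by auto
      qed (use ek geo in \<open>auto intro: summable_sum\<close>)
      finally show "(\<Sum>m\<le>n. e' m) \<le> (\<Sum>k. U * (1/2) ^ k)" .
    qed
    fix m
    have 1: "AE x in M. \<forall>m. A (a m) x = (\<Sum>k. A (it k m) x)"
      unfolding AE_all_countable a_def[abs_def] using A_suminf[OF ball_it ek] by blast
    have "AE x in M. summable (\<lambda>k. \<bar>A (it k m) x\<bar>)" for m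
      by (rule Lp_ball_suminf(1)[OF p A_ball[OF ball_it] summable_mult[OF ek]])
    then have 2: "AE x in M. \<forall>m. summable (\<lambda>k. \<bar>A (it k m) x\<bar>)"
      unfolding AE_all_countable by blast
    have 3: "AE x in M. summable (\<lambda>k. \<bar>it k m x\<bar>)"
      by (rule Lp_ball_suminf(1)[OF p ball_it ek])
    from 1 2 3 show "AE x in M. a m x = (if m = 0 then u0 x else 0)
          + c powr (-\<alpha> x) * (\<Sum>i\<le>m. binc (\<alpha> x) i * A (a (m - i)) x)"
    proof eventually_elim
      case (elim x)
      have S: "summable (\<lambda>k. A (it k m) x)" for m by (rule summable_rabs_cancel) (use elim(2) in blast)
      have "a m x = (\<Sum>k. it (k + 1) m x) + (\<Sum>k<1. it k m x)"
        unfolding a_def by (rule suminf_split_initial_segment[OF summable_rabs_cancel[OF elim(3)]])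
      also have "(\<Sum>k<1. it k m x) = (if m = 0 then u0 x else 0)" by (simp add: it_def a0_def)
      also have "(\<Sum>k. it (k + 1) m x) = (\<Sum>k. c powr (-\<alpha> x) * (\<Sum>i\<le>m. binc (\<alpha> x) i * A (it k (m - i)) x))"
        by (simp add: it_Suc)
      also have "\<dots> = c powr (-\<alpha> x) * (\<Sum>k. \<Sum>i\<le>m. binc (\<alpha> x) i * A (it k (m - i)) x)"
        by (intro suminf_mult summable_sum summable_mult S)
      also have "(\<Sum>k. \<Sum>i\<le>m. binc (\<alpha> x) i * A (it k (m - i)) x) = (\<Sum>i\<le>m. \<Sum>k. binc (\<alpha> x) i * A (it k (m - i)) x)"
        by (intro suminf_sum summable_mult S)
      also have "\<dots> = (\<Sum>i\<le>m. binc (\<alpha> x) i * A (a (m - i)) x)"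
        using elim(1) S by (simp add: suminf_mult)
      finally show ?case by simp
    qed
  qed
qed

lemma lag_series_Lp:
  assumes a: "\<And>m. ball (e m) (a m)" and e: "summable e" and c: "0 \<le> c" and t: "0 \<le> t"
  shows "ball ((\<Sum>m. e m * exp (c * t))) (\<lambda>x. \<Sum>m. a m x * lag m (c * t))"
    and "AE x in M. A (\<lambda>x. \<Sum>m. a m x * lag m (c * t)) x = (\<Sum>m. A (a m) x * lag m (c * t))"
proof -
  have e0: "0 \<le> e m" for m using a by (rule Lp_ballD)
  have b: "ball (e m * exp (c * t)) (\<lambda>x. a m x * lag m (c * t))" for m
  proof (rule Lp_ball_mono[OF p Lp_ball_cmult[OF p a[of m], of "lag m (c * t)"]])
    show "\<bar>lag m (c * t)\<bar> * e m \<le> e m * exp (c * t)"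
      using abs_lag_le_exp[of "c * t" m] c t e0[of m] by (simp add: mult.commute mult_left_mono)
  qed (use Lp_ballD(1)[OF a, of m] in \<open>auto simp: mult.commute\<close>)
  have s: "summable (\<lambda>m. e m * exp (c * t))" by (intro summable_mult2 e)
  show "ball ((\<Sum>m. e m * exp (c * t))) (\<lambda>x. \<Sum>m. a m x * lag m (c * t))"
    by (rule Lp_ball_suminf[OF p b s])
  have "AE x in M. A (\<lambda>x. a m x * lag m (c * t)) x = A (a m) x * lag m (c * t)" for m
    using A_cmult[OF a[of m], of "lag m (c * t)"] by (simp add: mult.commute)
  then have "AE x in M. \<forall>m. A (\<lambda>x. a m x * lag m (c * t)) x = A (a m) x * lag m (c * t)"
    unfolding AE_all_countable by blast
  then show "AE x in M. A (\<lambda>x. \<Sum>m. a m x * lag m (c * t)) x = (\<Sum>m. A (a m) x * lag m (c * t))"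
    using A_suminf[OF b s] by eventually_elim simp
qed

text \<open>The norm of an increment is at most the numerical series \<open>g s\<close>, which
  converges uniformly by the Weierstrass test, is continuous, and vanishes at
  \<open>s = t\<close>.\<close>

lemma continuous_lag_series_Lp:
  assumes a: "\<And>m. ball (e m) (a m)" and e: "summable e" and c: "0 \<le> c"
  shows "continuous_into_Lp {0..} M p (\<lambda>t x. \<Sum>m. a m x * lag m (c * t))"
  unfolding continuous_into_Lp_def
proof (intro conjI ballI)
  let ?u = "\<lambda>t x. \<Sum>m. a m x * lag m (c * t)"
  have e0: "0 \<le> e m" for m using a by (rule Lp_ballD)
  fix t :: real assume t: "t \<in> {0..}"
  show "?u t \<in> Lp_space M p"
    using lag_series_Lp(1)[OF a e c, of t] t by (simp add: Lp_ball_iff[OF p])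
  define g where "g s = (\<Sum>m. e m * \<bar>lag m (c * s) - lag m (c * t)\<bar>)" for s
  define R where "R = t + 1"
  have lb: "\<bar>lag m (c * s) - lag m (c * t)\<bar> \<le> 2 * exp (c * R)" if "s \<in> {0..R}" for m s
    using abs_lag_scaled_le[OF c, of s R m] abs_lag_scaled_le[OF c, of t R m] that t by (auto simp: R_def)
  have ge: "summable (\<lambda>m. e m * (2 * exp (c * R)))" by (intro summable_mult2 e)
  have "uniform_limit {0..R} (\<lambda>n s. \<Sum>m<n. e m * \<bar>lag m (c * s) - lag m (c * t)\<bar>) g sequentially"
    unfolding g_def
    by (rule Weierstrass_m_test[OF _ ge]) (use lb e0 in \<open>auto simp: abs_mult intro!: mult_left_mono\<close>)
  then have "continuous_on {0..R} g"
    by (rule uniform_limit_theorem[rotated]) (auto intro!: always_eventually continuous_intros)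
  then have "(g \<longlongrightarrow> g t) (at t within {0..R})" using t by (auto simp: continuous_on_def R_def)
  moreover have "g t = 0" by (simp add: g_def)
  moreover have "at t within {0..R} = at t within {0..}"
    by (rule at_within_nhd[of t "{..<R}"]) (auto simp: R_def)
  ultimately have lim: "(g \<longlongrightarrow> 0) (at t within {0..})" by simp
  have near: "eventually (\<lambda>s. s \<in> {0..R}) (at t within {0..})"
  proof -
    have "eventually (\<lambda>s. s \<in> {..<R}) (at t within {0..})"
      by (rule eventually_at_topological[THEN iffD2]) (auto simp: R_def intro!: exI[of _ "{..<t+1}"])
    then show ?thesis by (auto simp: eventually_at_filter elim!: eventually_mono)
  qed
  have norm_le: "(\<lambda>x. ?u s x - ?u t x) \<in> Lp_space M p \<and> Lp_norm M p (\<lambda>x. ?u s x - ?u t x) \<le> g s"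
    if s: "s \<in> {0..R}" for s
  proof -
    have gs: "summable (\<lambda>m. e m * \<bar>lag m (c * s) - lag m (c * t)\<bar>)"
      by (rule summable_comparison_test'[OF ge, of 0]) (use lb[OF s] e0 in \<open>auto simp: abs_mult intro!: mult_left_mono\<close>)
    have "ball (\<bar>lag m (c * s) - lag m (c * t)\<bar> * e m) (\<lambda>x. (lag m (c * s) - lag m (c * t)) * a m x)" for m
      by (rule Lp_ball_cmult[OF p a])
    then have b: "ball (e m * \<bar>lag m (c * s) - lag m (c * t)\<bar>) (\<lambda>x. a m x * (lag m (c * s) - lag m (c * t)))" for m
      by (simp add: mult.commute)
    have "ball (g s) (\<lambda>x. \<Sum>m. a m x * (lag m (c * s) - lag m (c * t)))"
      unfolding g_def by (rule Lp_ball_suminf[OF p b gs])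
    moreover have "AE x in M. ?u s x - ?u t x = (\<Sum>m. a m x * (lag m (c * s) - lag m (c * t)))"
      using Lp_ball_suminf(1)[OF p a e]
    proof eventually_elim
      case (elim x)
      have "summable (\<lambda>m. a m x * lag m (c * r))" if "0 \<le> r" for r
        by (rule summable_rabs_cancel[OF summable_lag_series[OF elim]]) (use that c in auto)
      then show ?case using s t by (subst suminf_diff) (auto simp: right_diff_distrib)
    qed
    moreover have "(\<lambda>x. ?u s x - ?u t x) \<in> borel_measurable M"
      using Lp_ballD(1)[OF a] by (intro borel_measurable_diff borel_measurable_suminf borel_measurable_times) auto
    ultimately have "ball (g s) (\<lambda>x. ?u s x - ?u t x)" using Lp_ball_cong_AE[OF p] by blast
    then show ?thesis by (simp add: Lp_ball_iff[OF p])
  qed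
  show "((\<lambda>s. Lp_norm M p (\<lambda>x. ?u s x - ?u t x)) \<longlongrightarrow> 0) (at t within {0..})"
  proof (rule tendsto_sandwich[OF _ _ tendsto_const lim])
    show "\<forall>\<^sub>F s in at t within {0..}. 0 \<le> Lp_norm M p (\<lambda>x. ?u s x - ?u t x)"
      using near by eventually_elim (use norm_le Lp_norm_nonneg in blast)
    show "\<forall>\<^sub>F s in at t within {0..}. Lp_norm M p (\<lambda>x. ?u s x - ?u t x) \<le> g s"
      using near by eventually_elim (use norm_le in blast)
  qed
qed

end

text \<open>Sections of a Lebesgue measurable function on a product may fail to be measurable. A
  Borel representative removes this problem at the cost of a null set.\<close>

lemma lebesgue_on_borel_representative:
  fixes f :: "'a::euclidean_space \<Rightarrow> real"
  assumes "f \<in> borel_measurable (lebesgue_on S)" "S \<in> sets lebesgue"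
  obtains g where "g \<in> borel_measurable borel" "AE x in lebesgue_on S. f x = g x"
proof -
  have "(\<lambda>x. if x \<in> S then f x else 0) \<in> borel_measurable lebesgue"
    using assms by (simp add: borel_measurable_if_I)
  from completion_ex_borel_measurable_real[OF this] obtain g
    where g: "g \<in> borel_measurable lborel" "AE x in lborel. (if x \<in> S then f x else 0) = g x" by blast
  have "AE x in lebesgue. x \<in> S \<longrightarrow> f x = g x"
    using AE_completion[OF g(2)] by eventually_elim auto
  then have "AE x in lebesgue_on S. f x = g x" using assms by (simp add: AE_restrict_space_iff)
  with g show ?thesis by (intro that) auto
qed

lemma Cauchy_problem_solution_exists:
  fixes \<Omega> :: "'a::euclidean_space set"
  assumes p: "1 \<le> p" and \<Omega>: "open \<Omega>" and A: "bounded_linear_Lp (lebesgue_on \<Omega>) p A"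
    and \<alpha>0: "0 < \<alpha>0" "\<alpha>0 < 1" and \<alpha>: "\<alpha> \<in> borel_measurable (lebesgue_on \<Omega>)"
    and \<alpha>_bounds: "AE x in lebesgue_on \<Omega>. \<alpha>0 \<le> \<alpha> x \<and> \<alpha> x \<le> 1"
    and u0: "u0 \<in> Lp_space (lebesgue_on \<Omega>) p"
  shows "\<exists>u. solves_Cauchy_problem {0..} \<Omega> p \<alpha> A u0 u"
proof -
  let ?M = "lebesgue_on \<Omega>"
  obtain K where "Lp_operator ?M p A K" using Lp_operatorI[OF p A] .
  then interpret Lp_operator ?M p A K .
  obtain c a' e where c: "1 \<le> c" and a': "\<And>m. ball (e m) (a' m)" and e: "summable e"
    and rec': "\<And>m. AE x in ?M. a' m x = (if m = 0 then u0 x else 0)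
          + c powr (-\<alpha> x) * (\<Sum>i\<le>m. binc (\<alpha> x) i * A (a' (m - i)) x)"
    by (rule coefficients_exist[OF \<alpha> \<alpha>0(1) less_imp_le[OF \<alpha>0(2)] \<alpha>_bounds Lp_ball_norm[OF p u0]]) (rule that)
  have \<Omega>': "\<Omega> \<in> sets lebesgue" using \<Omega> by auto
  \<comment> \<open>Borel coefficients make the series jointly Borel in time and space. Changing
    them on null sets changes their images under \<open>A\<close> only on null sets, so the
    coefficient system survives.\<close>
  have "\<exists>g. g \<in> borel_measurable borel \<and> (AE x in ?M. a' m x = g x)" for m
    by (rule lebesgue_on_borel_representative[OF Lp_ballD(1)[OF a'] \<Omega>']) blast
  then obtain a where a_meas [measurable]: "\<And>m. a m \<in> borel_measurable borel"
    and aa': "\<And>m. AE x in ?M. a' m x = a m x" by metis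
  have a: "ball (e m) (a m)" for m
  proof (rule Lp_ball_cong_AE[OF p a'])
    show "a m \<in> borel_measurable ?M" by (intro measurable_restrict_space1 measurable_completion) simp
    show "AE x in ?M. a m x = a' m x" using aa'[of m] by eventually_elim simp
  qed
  have rec: "AE x in ?M. \<forall>m. a m x = (if m = 0 then u0 x else 0)
          + c powr (-\<alpha> x) * (\<Sum>i\<le>m. binc (\<alpha> x) i * A (a (m - i)) x)"
  proof -
    have "AE x in ?M. A (a' m) x = A (a m) x" for m by (rule A_cong[OF a' a aa'])
    then have "AE x in ?M. \<forall>m. A (a' m) x = A (a m) x" unfolding AE_all_countable by blast
    moreover have "AE x in ?M. \<forall>m. a' m x = a m x" using aa' unfolding AE_all_countable by blast
    moreover have "AE x in ?M. \<forall>m. a' m x = (if m = 0 then u0 x else 0)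
          + c powr (-\<alpha> x) * (\<Sum>i\<le>m. binc (\<alpha> x) i * A (a' (m - i)) x)"
      using rec' unfolding AE_all_countable by blast
    ultimately show ?thesis by eventually_elim simp
  qed
  define u where "u t x = (\<Sum>m. a m x * lag m (c * t))" for t x
  have sa: "AE x in ?M. summable (\<lambda>m. \<bar>a m x\<bar>)" by (rule Lp_ball_suminf(1)[OF p a e])
  have sA: "AE x in ?M. summable (\<lambda>m. \<bar>A (a m) x\<bar>)"
    by (rule Lp_ball_suminf(1)[OF p A_ball[OF a] summable_mult[OF e]])
  \<comment> \<open>One null set serves all times, since it comes from countably many
    coefficients.\<close>
  have Caputo: "AE x in ?M. u 0 x = u0 x \<and> (\<forall>t\<in>{0..}. has_Caputo_derivative {0..} (\<alpha> x) (\<lambda>s. u s x) t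
      (\<Sum>m. A (a m) x * lag m (c * t)))"
    using sA rec \<alpha>_bounds
  proof eventually_elim
    case (elim x)
    let ?a = "Abs_fps (\<lambda>m. a m x)" and ?d = "Abs_fps (\<lambda>m. A (a m) x)"
    have d: "summable (\<lambda>n. \<bar>fps_nth ?d n\<bar>)" using elim(1) by simp
    have "fps_nth (bincF (\<alpha> x) * ?d) n = (\<Sum>i\<le>n. binc (\<alpha> x) i * A (a (n - i)) x)" for n
      by (simp add: fps_mult_nth atLeast0AtMost)
    then have eq: "?a = fps_const (u0 x) + fps_const (c powr (-\<alpha> x)) * (bincF (\<alpha> x) * ?d)"
      using elim(2) by (intro fps_ext) simp
    have u: "(\<lambda>s. u s x) = lagser c ?a" by (simp add: u_def lagser_def fun_eq_iff)
    have \<alpha>x: "0 < \<alpha> x" "\<alpha> x \<le> 1" "0 < c" using elim(3) \<alpha>0 c by auto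
    have "u 0 x = u0 x"
      using has_Caputo_derivative_lagser(1)[OF \<alpha>x order_refl d eq] u by metis
    moreover have "has_Caputo_derivative {0..} (\<alpha> x) (\<lambda>s. u s x) t (\<Sum>m. A (a m) x * lag m (c * t))" if "t \<in> {0..}" for t
      using has_Caputo_derivative_lagser(2)[OF \<alpha>x _ d eq, of t] that unfolding u by (simp add: lagser_def)
    ultimately show ?case by blast
  qed
  have "solves_Cauchy_problem {0..} \<Omega> p \<alpha> A u0 u"
    unfolding solves_Cauchy_problem_def
  proof (intro conjI ballI)
    have "(\<lambda>(t, x). u t x) \<in> borel_measurable (borel \<Otimes>\<^sub>M borel)"
      unfolding u_def by measurable
    then have "(\<lambda>(t, x). u t x) \<in> borel_measurable lborel" by (simp add: borel_prod)
    then show "(\<lambda>(t, x). u t x) \<in> borel_measurable (lebesgue_on ({0..} \<times> \<Omega>))"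
      by (intro measurable_restrict_space1 measurable_completion)
    show "continuous_into_Lp {0..} ?M p u"
      unfolding u_def[abs_def] using c by (intro continuous_lag_series_Lp[OF a e]) auto
    show "AE x in ?M. \<forall>t\<in>{0..}. \<exists>D. has_Caputo_derivative {0..} (\<alpha> x) (\<lambda>s. u s x) t D"
      using Caputo by eventually_elim blast
    show "AE x in ?M. u 0 x = u0 x" using Caputo by eventually_elim blast
    fix t :: real assume t: "t \<in> {0..}"
    have "AE x in ?M. A (u t) x = (\<Sum>m. A (a m) x * lag m (c * t))"
      unfolding u_def[abs_def] using c t by (intro lag_series_Lp(2)[OF a e]) auto
    with Caputo show "AE x in ?M. has_Caputo_derivative {0..} (\<alpha> x) (\<lambda>s. u s x) t (A (u t) x)"
      by eventually_elim (use t in auto)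
  qed
  then show ?thesis by blast
qed

section \<open>Operators and time integrals\<close>

context Lp_operator
begin

lemma Lp_norm_diff_le:
  assumes f: "f \<in> Lp_space M p" and g: "g \<in> Lp_space M p" and fg: "ball C (\<lambda>x. f x - g x)"
  shows "\<bar>Lp_norm M p f - Lp_norm M p g\<bar> \<le> C"
proof -
  have "ball (Lp_norm M p g + C) f"
    using Lp_ball_add[OF p Lp_ball_norm[OF p g] fg] by simp
  moreover have "ball (Lp_norm M p f + C) g"
    using Lp_ball_diff[OF p Lp_ball_norm[OF p f] fg] by simp
  ultimately show ?thesis by (auto simp: Lp_ball_iff[OF p])
qed

lemma continuous_curve_near:
  assumes w: "\<And>s. s \<in> I \<Longrightarrow> w s \<in> Lp_space M p"
    and cont: "((\<lambda>r. Lp_norm M p (\<lambda>x. w r x - w m x)) \<longlongrightarrow> 0) (at m within I)"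
    and m: "m \<in> I" and \<epsilon>: "0 < \<epsilon>"
  obtains d where "0 < d" "\<And>r. r \<in> I \<Longrightarrow> dist r m < d \<Longrightarrow> ball \<epsilon> (\<lambda>x. w r x - w m x)"
proof -
  have "eventually (\<lambda>r. Lp_norm M p (\<lambda>x. w r x - w m x) < \<epsilon>) (at m within I)"
    using cont \<epsilon> by (rule order_tendstoD)
  then obtain d where d: "0 < d" "\<And>r. r \<in> I \<Longrightarrow> r \<noteq> m \<Longrightarrow> dist r m < d \<Longrightarrow> Lp_norm M p (\<lambda>x. w r x - w m x) < \<epsilon>"
    by (auto simp: eventually_at)
  show ?thesis
  proof
    fix r assume r: "r \<in> I" "dist r m < d"
    show "ball \<epsilon> (\<lambda>x. w r x - w m x)"
    proof (cases "r = m")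
      case True
      then show ?thesis using \<epsilon> by (simp add: Lp_ball_0)
    next
      case False
      have "ball (Lp_norm M p (w r) + Lp_norm M p (w m)) (\<lambda>x. w r x - w m x)"
        using r m w by (intro Lp_ball_diff[OF p] Lp_ball_norm[OF p])
      then show ?thesis using d(2)[OF r(1) False r(2)] by (simp add: Lp_ball_iff[OF p])
    qed
  qed (use d in simp)
qed

lemma continuous_curve_bounded:
  fixes a b :: real
  assumes w: "\<And>s. s \<in> {a..b} \<Longrightarrow> w s \<in> Lp_space M p"
    and cont: "\<And>s. s \<in> {a..b} \<Longrightarrow> ((\<lambda>r. Lp_norm M p (\<lambda>x. w r x - w s x)) \<longlongrightarrow> 0) (at s within {a..b})"
  obtains C where "0 \<le> C" "\<And>s. s \<in> {a..b} \<Longrightarrow> ball C (w s)"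
proof -
  have "continuous_on {a..b} (\<lambda>s. Lp_norm M p (w s))"
    unfolding continuous_on_iff
  proof (intro ballI allI impI)
    fix m e :: real assume m: "m \<in> {a..b}" and e: "0 < e"
    obtain d where d: "0 < d" "\<And>r. r \<in> {a..b} \<Longrightarrow> dist r m < d \<Longrightarrow> ball (e/2) (\<lambda>x. w r x - w m x)"
      using continuous_curve_near[of "{a..b}" w m "e/2"] w cont[OF m] m e by auto
    have "dist (Lp_norm M p (w r)) (Lp_norm M p (w m)) < e" if "r \<in> {a..b}" "dist r m < d" for r
      using Lp_norm_diff_le[OF w[OF that(1)] w[OF m] d(2)[OF that]] e by (simp add: dist_real_def)
    with d(1) show "\<exists>d>0. \<forall>x'\<in>{a..b}. dist x' m < d \<longrightarrow> dist (Lp_norm M p (w x')) (Lp_norm M p (w m)) < e"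
      by blast
  qed
  then have "bounded ((\<lambda>s. Lp_norm M p (w s)) ` {a..b})"
    by (intro compact_imp_bounded compact_continuous_image) auto
  then obtain C where C: "\<forall>s\<in>{a..b}. \<bar>Lp_norm M p (w s)\<bar> \<le> C"
    by (auto simp: bounded_iff)
  show ?thesis
  proof
    show "ball (max 0 C) (w s)" if "s \<in> {a..b}" for s
      using bspec[OF C that] w[OF that] by (auto simp: Lp_ball_iff[OF p])
  qed simp
qed

text \<open>The defect \<open>E t\<close> between \<open>A\<close> of the integral over \<open>[0, t]\<close> and the integral of \<open>A\<close> has
  increments of size \<open>o(\<bar>t - s\<bar>)\<close>, so its norm has derivative zero.\<close>

lemma A_integral:
  fixes w W D :: "real \<Rightarrow> 'a \<Rightarrow> real"
  assumes M: "sigma_finite_measure M" and T: "0 \<le> T"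
    and W [measurable]: "(\<lambda>(s, x). W s x) \<in> borel_measurable (lborel \<Otimes>\<^sub>M M)"
    and D [measurable]: "(\<lambda>(s, x). D s x) \<in> borel_measurable (lborel \<Otimes>\<^sub>M M)"
    and w: "\<And>s. s \<in> {0..T} \<Longrightarrow> w s \<in> Lp_space M p"
    and cont: "\<And>s. s \<in> {0..T} \<Longrightarrow> ((\<lambda>r. Lp_norm M p (\<lambda>x. w r x - w s x)) \<longlongrightarrow> 0) (at s within {0..T})"
    and Ww: "AE s in lborel. s \<in> {0..T} \<longrightarrow> (AE x in M. W s x = w s x)"
    and DA: "AE s in lborel. s \<in> {0..T} \<longrightarrow> (AE x in M. D s x = A (w s) x)"
    and \<phi> [measurable]: "\<phi> \<in> borel_measurable borel" and \<phi>_le: "\<And>s. s \<in> {0..T} \<Longrightarrow> \<bar>\<phi> s\<bar> \<le> B"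
  shows "AE x in M. A (\<lambda>x. LINT s:{0..T}|lborel. \<phi> s * W s x) x = (LINT s:{0..T}|lborel. \<phi> s * D s x)"
proof -
  have B: "0 \<le> B" using \<phi>_le[of 0] T by auto
  obtain C where C: "0 \<le> C" "\<And>s. s \<in> {0..T} \<Longrightarrow> ball C (w s)"
    using continuous_curve_bounded[of 0 T w] w cont by blast
  have sec: "W s \<in> borel_measurable M" "D s \<in> borel_measurable M" for s
    using measurable_Pair2[OF W, of s] measurable_Pair2[OF D, of s] by simp_all
  have ball_scale: "ball (B * R) (\<lambda>x. \<phi> s * f x)" if "ball R f" "s \<in> {0..T}" for R s f
  proof (rule Lp_ball_mono[OF p Lp_ball_cmult[OF p that(1), of "\<phi> s"]])
    show "\<bar>\<phi> s\<bar> * R \<le> B * R" using \<phi>_le[OF that(2)] Lp_ballD(2)[OF that(1)] by (rule mult_right_mono)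
  qed (use Lp_ballD(1)[OF that(1)] in auto)
  define IW where "IW a b x = (LINT s:{a..b}|lborel. \<phi> s * W s x)" for a b x
  define ID where "ID a b x = (LINT s:{a..b}|lborel. \<phi> s * D s x)" for a b x
  have bW: "AE s in lborel. s \<in> {a..b} \<longrightarrow> ball (B * C) (\<lambda>x. \<phi> s * W s x)" if "0 \<le> a" "b \<le> T" for a b
    using Ww
  proof eventually_elim
    case (elim s)
    show ?case
    proof
      assume "s \<in> {a..b}"
      then have s: "s \<in> {0..T}" using that by auto
      show "ball (B * C) (\<lambda>x. \<phi> s * W s x)"
        using Lp_ball_cong_AE[OF p C(2)[OF s] sec(1)] elim s by (intro ball_scale) auto
    qed
  qed
  have bD: "AE s in lborel. s \<in> {a..b} \<longrightarrow> ball (B * (K * C)) (\<lambda>x. \<phi> s * D s x)" if "0 \<le> a" "b \<le> T" for a b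
    using DA
  proof eventually_elim
    case (elim s)
    show ?case
    proof
      assume "s \<in> {a..b}"
      then have s: "s \<in> {0..T}" using that by auto
      show "ball (B * (K * C)) (\<lambda>x. \<phi> s * D s x)"
        using Lp_ball_cong_AE[OF p A_ball[OF C(2)[OF s]] sec(2)] elim s by (intro ball_scale) auto
    qed
  qed
  have mW: "(\<lambda>(s, x). \<phi> s * W s x) \<in> borel_measurable (lborel \<Otimes>\<^sub>M M)"
    and mD: "(\<lambda>(s, x). \<phi> s * D s x) \<in> borel_measurable (lborel \<Otimes>\<^sub>M M)" by measurable
  have BC: "0 \<le> B * C" "0 \<le> B * (K * C)" using B C K by auto
  have IW: "ball ((b - a) * (B * C)) (IW a b)" "AE x in M. set_integrable lborel {a..b} (\<lambda>s. \<phi> s * W s x)"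
    if "0 \<le> a" "a \<le> b" "b \<le> T" for a b
    unfolding IW_def[abs_def] using Lp_ball_integral[OF p M that(2) BC(1) mW bW[OF that(1,3)]] by auto
  have ID: "ball ((b - a) * (B * (K * C))) (ID a b)" "AE x in M. set_integrable lborel {a..b} (\<lambda>s. \<phi> s * D s x)"
    if "0 \<le> a" "a \<le> b" "b \<le> T" for a b
    unfolding ID_def[abs_def] using Lp_ball_integral[OF p M that(2) BC(2) mD bD[OF that(1,3)]] by auto
  have set_int_combine: "(LINT s:{0..b}|lborel. f s) = (LINT s:{0..a}|lborel. f s) + (LINT s:{a..b}|lborel. f s)"
    if "set_integrable lborel {0..b} f" "0 \<le> a" "a \<le> b" for f :: "real \<Rightarrow> real" and a b
  proof -
    have "set_integrable lborel {0..a} f" "set_integrable lborel {a..b} f"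
      using that by (auto intro: set_integrable_subset)
    with that show ?thesis
      by (simp add: set_borel_integral_eq_integral Henstock_Kurzweil_Integration.integral_combine)
  qed
  \<comment> \<open>\<open>G a b\<close> is the defect on \<open>[a, b]\<close>;
    \<open>E_diff\<close> identifies it with the increment of \<open>E\<close>.\<close>
  define G where "G a b x = A (IW a b) x - ID a b x" for a b x
  define E where "E b = G 0 b" for b
  have G_ball: "ball (K * ((b - a) * (B * C)) + (b - a) * (B * (K * C))) (G a b)" if "0 \<le> a" "a \<le> b" "b \<le> T" for a b
    unfolding G_def[abs_def] using that by (intro Lp_ball_diff[OF p] A_ball IW ID)
  have E_Lp: "E b \<in> Lp_space M p" if "0 \<le> b" "b \<le> T" for b
    using G_ball[of 0 b] that by (simp add: E_def Lp_ball_iff[OF p])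
  have E_diff: "AE x in M. E b x - E a x = G a b x" if ab: "0 \<le> a" "a \<le> b" "b \<le> T" for a b
  proof -
    have 0: "0 \<le> b" "a \<le> T" using ab by auto
    have "AE x in M. IW 0 b x = IW 0 a x + IW a b x"
      using IW(2)[OF order_refl 0(1) ab(3)] by eventually_elim (simp add: IW_def set_int_combine[OF _ ab(1,2)])
    from A_cong[OF IW(1)[OF order_refl 0(1) ab(3)] Lp_ball_add[OF p IW(1)[OF order_refl ab(1) 0(2)] IW(1)[OF ab]] this]
      A_add[OF IW(1)[OF order_refl ab(1) 0(2)] IW(1)[OF ab]] ID(2)[OF order_refl 0(1) ab(3)]
    show ?thesis
      by eventually_elim (simp add: E_def G_def ID_def set_int_combine[OF _ ab(1,2)])
  qed
  \<comment> \<open>Compare \<open>w\<close> with its value at a single time \<open>m\<close>. The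
    constant curve contributes no defect, by linearity of \<open>A\<close>; only the integrals
    \<open>X\<close> and \<open>Y\<close> of the deviations remain, and these are small with
    \<epsilon>.\<close>
  have G_small: "ball ((b - a) * (2 * K * B * \<epsilon>)) (G a b)"
    if ab: "0 \<le> a" "a \<le> b" "b \<le> T" and m: "m \<in> {0..T}" and \<epsilon>: "0 \<le> \<epsilon>"
      and near: "\<And>s. s \<in> {a..b} \<Longrightarrow> ball \<epsilon> (\<lambda>x. w s x - w m x)" for a b m \<epsilon>
  proof -
    have wm [measurable]: "w m \<in> borel_measurable M" and Awm [measurable]: "A (w m) \<in> borel_measurable M"
      using C(2)[OF m] by (auto dest: Lp_ballD intro: A_measurable)
    define J where "J = (LINT s:{a..b}|lborel. \<phi> s)"
    define X where "X x = (LINT s:{a..b}|lborel. \<phi> s * (W s x - w m x))" for x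
    define Y where "Y x = (LINT s:{a..b}|lborel. \<phi> s * (D s x - A (w m) x))" for x
    have i\<phi>: "set_integrable lborel {a..b} \<phi>"
      by (rule set_integrable_bound[OF set_integrable_const_Icc[of a b B]])
         (use \<phi>_le ab B in \<open>auto simp: set_borel_measurable_def\<close>)
    have "AE s in lborel. s \<in> {a..b} \<longrightarrow> ball (B * \<epsilon>) (\<lambda>x. \<phi> s * (W s x - w m x))"
      using Ww
    proof eventually_elim
      case (elim s)
      show ?case
      proof
        assume sab: "s \<in> {a..b}"
        then have s: "s \<in> {0..T}" using ab by auto
        have "AE x in M. W s x - w m x = w s x - w m x" using elim s by (auto elim: eventually_mono)
        then have "ball \<epsilon> (\<lambda>x. W s x - w m x)"
          using sec by (intro Lp_ball_cong_AE[OF p near[OF sab]]) auto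
        then show "ball (B * \<epsilon>) (\<lambda>x. \<phi> s * (W s x - w m x))" using s by (rule ball_scale)
      qed
    qed
    then have X: "ball ((b - a) * (B * \<epsilon>)) X"
      unfolding X_def[abs_def] using B \<epsilon> ab by (intro Lp_ball_integral[OF p M]) auto
    have "AE s in lborel. s \<in> {a..b} \<longrightarrow> ball (B * (K * \<epsilon>)) (\<lambda>x. \<phi> s * (D s x - A (w m) x))"
      using DA
    proof eventually_elim
      case (elim s)
      show ?case
      proof
        assume sab: "s \<in> {a..b}"
        then have s: "s \<in> {0..T}" using ab by auto
        have "AE x in M. D s x - A (w m) x = A (\<lambda>x. w s x - w m x) x"
          using A_diff[OF C(2)[OF s] C(2)[OF m]] elim[rule_format, OF s] by eventually_elim simp
        then have "ball (K * \<epsilon>) (\<lambda>x. D s x - A (w m) x)"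
          using sec by (intro Lp_ball_cong_AE[OF p A_ball[OF near[OF sab]]]) auto
        then show "ball (B * (K * \<epsilon>)) (\<lambda>x. \<phi> s * (D s x - A (w m) x))" using s by (rule ball_scale)
      qed
    qed
    then have Y: "ball ((b - a) * (B * (K * \<epsilon>))) Y"
      unfolding Y_def[abs_def] using B \<epsilon> K ab by (intro Lp_ball_integral[OF p M]) auto
    have "AE x in M. IW a b x = X x + J * w m x"
      using IW(2)[OF ab]
    proof eventually_elim
      case (elim x)
      have "X x = (LINT s:{a..b}|lborel. \<phi> s * W s x - \<phi> s * w m x)"
        unfolding X_def by (simp add: right_diff_distrib)
      also have "\<dots> = IW a b x - J * w m x"
        using elim i\<phi> by (subst set_integral_diff) (auto simp: IW_def J_def)
      finally show ?case by simp
    qed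
    from A_cong[OF IW(1)[OF ab] Lp_ball_add[OF p X Lp_ball_cmult[OF p C(2)[OF m], of J]] this]
      A_add[OF X Lp_ball_cmult[OF p C(2)[OF m], of J]] A_cmult[OF C(2)[OF m], of J] ID(2)[OF ab]
    have "AE x in M. G a b x = A X x - Y x"
    proof eventually_elim
      case (elim x)
      have "Y x = (LINT s:{a..b}|lborel. \<phi> s * D s x - \<phi> s * A (w m) x)"
        unfolding Y_def by (simp add: right_diff_distrib)
      also have "\<dots> = ID a b x - J * A (w m) x"
        using elim i\<phi> by (subst set_integral_diff) (auto simp: ID_def J_def)
      finally show ?case using elim by (simp add: G_def)
    qed
    moreover have "ball (K * ((b - a) * (B * \<epsilon>)) + (b - a) * (B * (K * \<epsilon>))) (\<lambda>x. A X x - Y x)"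
      by (intro Lp_ball_diff[OF p] A_ball X Y)
    moreover have "K * ((b - a) * (B * \<epsilon>)) + (b - a) * (B * (K * \<epsilon>)) = (b - a) * (2 * K * B * \<epsilon>)"
      by (simp add: algebra_simps)
    ultimately show ?thesis
      using Lp_ball_cong_AE[OF p _ Lp_ballD(1)[OF G_ball[OF ab]]] by metis
  qed
  define e where "e t = Lp_norm M p (E t)" for t
  have e_lip: "\<bar>e s - e m\<bar> \<le> \<bar>s - m\<bar> * (2 * K * B * \<epsilon>)"
    if s: "s \<in> {0..T}" and m: "m \<in> {0..T}" and \<epsilon>: "0 \<le> \<epsilon>"
      and near: "\<And>r. r \<in> {0..T} \<Longrightarrow> dist r m \<le> dist s m \<Longrightarrow> ball \<epsilon> (\<lambda>x. w r x - w m x)" for s m \<epsilon>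
  proof -
    define a b where "a = min s m" and "b = max s m"
    have ab: "0 \<le> a" "a \<le> b" "b \<le> T" using s m by (auto simp: a_def b_def)
    have "ball ((b - a) * (2 * K * B * \<epsilon>)) (G a b)"
    proof (rule G_small[OF ab m \<epsilon>])
      fix r assume "r \<in> {a..b}"
      then show "ball \<epsilon> (\<lambda>x. w r x - w m x)"
        using s m by (intro near) (auto simp: a_def b_def dist_real_def min_def max_def split: if_splits)
    qed
    moreover have "(\<lambda>x. E b x - E a x) \<in> borel_measurable M"
      using E_Lp[of a] E_Lp[of b] ab by (auto simp: Lp_space_def)
    ultimately have "ball ((b - a) * (2 * K * B * \<epsilon>)) (\<lambda>x. E b x - E a x)"
      using Lp_ball_cong_AE[OF p _ _ E_diff[OF ab]] by blast
    then have "\<bar>e b - e a\<bar> \<le> (b - a) * (2 * K * B * \<epsilon>)"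
      unfolding e_def using ab by (intro Lp_norm_diff_le E_Lp) auto
    then show ?thesis by (auto simp: a_def b_def min_def max_def split: if_splits)
  qed
  have "(e has_field_derivative 0) (at m within {0..T})" if m: "m \<in> {0..T}" for m
    unfolding has_field_derivative_iff
  proof (rule tendstoI)
    fix \<epsilon>' :: real assume \<epsilon>': "0 < \<epsilon>'"
    \<comment> \<open>The summand 1 only prevents division by 0; what matters is that
      \<open>2 * K * B * \<epsilon>\<close> stays below \<open>\<epsilon>'\<close>.\<close>
    define \<epsilon> where "\<epsilon> = \<epsilon>' / (2 * K * B + 1)"
    have pos: "0 < 2 * K * B + 1" using K(1) B by (intro add_nonneg_pos) auto
    have \<epsilon>: "0 < \<epsilon>" using \<epsilon>' pos by (simp add: \<epsilon>_def)
    have lt: "2 * K * B * \<epsilon> < \<epsilon>'"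
    proof -
      have "2 * K * B * \<epsilon> < (2 * K * B + 1) * \<epsilon>" using \<epsilon> by (simp add: algebra_simps)
      also have "\<dots> = \<epsilon>'" using pos by (simp add: \<epsilon>_def)
      finally show ?thesis .
    qed
    obtain d where d: "0 < d" "\<And>r. r \<in> {0..T} \<Longrightarrow> dist r m < d \<Longrightarrow> ball \<epsilon> (\<lambda>x. w r x - w m x)"
      using continuous_curve_near[of "{0..T}" w m \<epsilon>] w cont[OF m] m \<epsilon> by auto
    have "\<bar>(e y - e m) / (y - m)\<bar> < \<epsilon>'" if y: "y \<in> {0..T}" "y \<noteq> m" "dist y m < d" for y
    proof -
      have "\<bar>e y - e m\<bar> \<le> \<bar>y - m\<bar> * (2 * K * B * \<epsilon>)"
        using y d(2) \<epsilon> by (intro e_lip m) auto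
      then have "\<bar>(e y - e m) / (y - m)\<bar> \<le> 2 * K * B * \<epsilon>"
        using y(2) by (simp add: field_simps)
      with lt show ?thesis by linarith
    qed
    with d(1) show "\<forall>\<^sub>F y in at m within {0..T}. dist ((e y - e m) / (y - m)) 0 < \<epsilon>'"
      by (auto simp: eventually_at dist_real_def)
  qed
  then obtain k where k: "\<And>t. t \<in> {0..T} \<Longrightarrow> e t = k"
    using has_field_derivative_zero_constant[of "{0..T}" e] by blast
  have "ball 0 (E 0)" using G_ball[of 0 0] T by (simp add: E_def)
  then have "e 0 \<le> 0" by (simp add: e_def Lp_ball_iff[OF p])
  then have "e T \<le> 0" using k[of 0] k[of T] T by simp
  then have "ball 0 (E T)" using E_Lp[of T] T by (simp add: e_def Lp_ball_iff[OF p])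
  then have "AE x in M. E T x = 0" by (rule Lp_ball_0_AE[OF p])
  then show ?thesis by eventually_elim (simp add: E_def G_def IW_def[abs_def] ID_def)
qed

end

section \<open>Convolution identities\<close>

text \<open>Fubini's theorem on the triangle \<open>0 \<le> s \<le> t \<le> T\<close> for an
  integrable, possibly singular kernel \<open>k\<close>: convolving \<kappa> with
  \<open>k * f\<close> is convolving \<open>f\<close> with \<open>k * \<kappa>\<close>. After
  integration in \<open>t\<close> the integrand is controlled by the integral of
  \<open>\<bar>k\<bar>\<close>, by translation.\<close>

lemma convolution_commute:
  fixes f \<kappa> k :: "real \<Rightarrow> real"
  assumes [measurable]: "f \<in> borel_measurable borel" "\<kappa> \<in> borel_measurable borel" "k \<in> borel_measurable borel"
    and f: "set_integrable lborel {0..T} f" and k: "set_integrable lborel {0..T} k"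
    and B: "\<And>r. r \<in> {0..T} \<Longrightarrow> \<bar>\<kappa> r\<bar> \<le> B"
  shows "(LINT t:{0..T}|lborel. \<kappa> (T - t) * (LINT s:{0..t}|lborel. k (t - s) * f s))
       = (LINT s:{0..T}|lborel. f s * (LINT r:{0..T - s}|lborel. k (T - s - r) * \<kappa> r))"
proof -
  define H where "H s t = (if 0 \<le> s \<and> s \<le> t \<and> t \<le> T then \<kappa> (T - t) * k (t - s) * f s else 0)" for s t
  have [measurable]: "case_prod H \<in> borel_measurable (lborel \<Otimes>\<^sub>M lborel)"
    unfolding H_def by measurable
  define k1 where "k1 s t = (if s \<le> t \<and> t \<le> T then \<bar>k (t - s)\<bar> else 0)" for s t
  have k1: "integrable lborel (k1 s) \<and> (\<integral>t. k1 s t \<partial>lborel) \<le> (LINT r:{0..T}|lborel. \<bar>k r\<bar>)"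
    if s: "0 \<le> s" for s
  proof -
    have i0: "integrable lborel (\<lambda>r. indicator {0..T} r * \<bar>k r\<bar>)"
      using set_integrable_abs[OF k] by (simp add: set_integrable_def)
    have i: "integrable lborel (\<lambda>r. if 0 \<le> r \<and> r \<le> T - s then \<bar>k r\<bar> else 0)"
      by (rule Bochner_Integration.integrable_bound[OF i0]) (use s in \<open>auto simp: indicator_def\<close>)
    have eq: "k1 s (s + 1 * r) = (if 0 \<le> r \<and> r \<le> T - s then \<bar>k r\<bar> else 0)" for r
      by (auto simp: k1_def)
    have ik: "integrable lborel (k1 s)"
      using lborel_integrable_real_affine_iff[of 1 "k1 s" s] i unfolding eq by simp
    have "(\<integral>t. k1 s t \<partial>lborel) = (\<integral>r. (if 0 \<le> r \<and> r \<le> T - s then \<bar>k r\<bar> else 0) \<partial>lborel)"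
      using lborel_integral_real_affine[of 1 "k1 s" s] unfolding eq by simp
    also have "\<dots> \<le> (\<integral>r. indicator {0..T} r * \<bar>k r\<bar> \<partial>lborel)"
      using s by (intro integral_mono i i0) (auto simp: indicator_def)
    finally show ?thesis using ik by (simp add: set_lebesgue_integral_def)
  qed
  define I where "I = (LINT r:{0..T}|lborel. \<bar>k r\<bar>)"
  have Hle: "norm (H s t) \<le> (if 0 \<le> s \<and> s \<le> T then B * \<bar>f s\<bar> * k1 s t else 0)" for s t
  proof (cases "0 \<le> s \<and> s \<le> t \<and> t \<le> T")
    case True
    have "\<bar>\<kappa> (T - t)\<bar> * (\<bar>k (t - s)\<bar> * \<bar>f s\<bar>) \<le> B * (\<bar>k (t - s)\<bar> * \<bar>f s\<bar>)"
      using True by (intro mult_right_mono B) auto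
    then show ?thesis using True by (simp add: H_def k1_def abs_mult mult_ac)
  qed (auto simp: H_def k1_def)
  have iH: "integrable lborel (H s)" for s
  proof (cases "0 \<le> s \<and> s \<le> T")
    case True
    show ?thesis
      by (rule Bochner_Integration.integrable_bound[of _ "\<lambda>t. B * \<bar>f s\<bar> * k1 s t"])
         (use True Hle[of s] k1[of s] in \<open>auto intro!: order_trans[OF _ abs_ge_self]\<close>)
  next
    case False
    then have "H s = (\<lambda>t. 0)" by (auto simp: H_def fun_eq_iff)
    then show ?thesis by simp
  qed
  have int_H: "(\<integral>t. norm (H s t) \<partial>lborel) \<le> indicator {0..T} s * (B * I * \<bar>f s\<bar>)" for s
  proof (cases "0 \<le> s \<and> s \<le> T")
    case True
    then have B0: "0 \<le> B" using B[of 0] by auto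
    have "(\<integral>t. norm (H s t) \<partial>lborel) \<le> (\<integral>t. B * \<bar>f s\<bar> * k1 s t \<partial>lborel)"
      using True Hle[of s] k1[of s] iH by (intro integral_mono integrable_norm) auto
    also have "\<dots> = B * \<bar>f s\<bar> * (\<integral>t. k1 s t \<partial>lborel)" by simp
    also have "\<dots> \<le> B * \<bar>f s\<bar> * I" using k1[of s] True B0 by (intro mult_left_mono) (auto simp: I_def)
    finally show ?thesis using True by (simp add: mult_ac)
  next
    case False
    then have "H s = (\<lambda>t. 0)" by (auto simp: H_def fun_eq_iff)
    with False show ?thesis by (auto simp: indicator_def)
  qed
  have "integrable (lborel \<Otimes>\<^sub>M lborel) (case_prod H)"
  proof (rule lborel_pair.Fubini_integrable)
    have if': "integrable lborel (\<lambda>s. indicator {0..T} s * (B * I * \<bar>f s\<bar>))"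
      using integrable_mult_right[OF set_integrable_abs[OF f, unfolded set_integrable_def], of "B * I"]
      by (simp add: mult_ac)
    show "integrable lborel (\<lambda>s. \<integral>t. norm (case (s, t) of (s, t) \<Rightarrow> H s t) \<partial>lborel)"
      by (rule Bochner_Integration.integrable_bound[OF if'])
         (use int_H in \<open>auto intro!: order_trans[OF _ abs_ge_self]\<close>)
  qed (use iH in auto)
  from lborel_pair.Fubini_integral[OF this]
  have main: "(\<integral>t. (\<integral>s. H s t \<partial>lborel) \<partial>lborel) = (\<integral>s. (\<integral>t. H s t \<partial>lborel) \<partial>lborel)" .
  have L: "(\<integral>s. H s t \<partial>lborel) = indicator {0..T} t *\<^sub>R (\<kappa> (T - t) * (LINT s:{0..t}|lborel. k (t - s) * f s))" for t
  proof (cases "t \<in> {0..T}")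
    case True
    then have "H s t = \<kappa> (T - t) * (indicator {0..t} s *\<^sub>R (k (t - s) * f s))" for s
      by (auto simp: H_def indicator_def)
    then show ?thesis using True by (simp add: set_lebesgue_integral_def)
  next
    case False
    then have "H s t = 0" for s by (auto simp: H_def)
    then show ?thesis using False by simp
  qed
  have R: "(\<integral>t. H s t \<partial>lborel) = indicator {0..T} s *\<^sub>R (f s * (LINT r:{0..T - s}|lborel. k (T - s - r) * \<kappa> r))" for s
  proof (cases "s \<in> {0..T}")
    case True
    have H: "H s (T + (-1) * r) = f s * (indicator {0..T - s} r *\<^sub>R (k (T - s - r) * \<kappa> r))" for r
      using True by (auto simp: H_def indicator_def algebra_simps)
    have "(\<integral>t. H s t \<partial>lborel) = (\<integral>r. H s (T + (-1) * r) \<partial>lborel)"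
      using lborel_integral_real_affine[of "-1" "H s" T] by simp
    also have "\<dots> = (\<integral>r. f s * (indicator {0..T - s} r *\<^sub>R (k (T - s - r) * \<kappa> r)) \<partial>lborel)"
      unfolding H ..
    finally show ?thesis using True by (simp add: set_lebesgue_integral_def)
  next
    case False
    then have "H s t = 0" for t by (auto simp: H_def)
    then show ?thesis using False by simp
  qed
  show ?thesis using main unfolding L R by (simp add: set_lebesgue_integral_def)
qed

lemma RL_integral_lborel:
  assumes [measurable]: "f \<in> borel_measurable borel" and "\<gamma> \<noteq> 0"
  shows "RL_integral \<gamma> f t = 1 / Gamma \<gamma> * (LINT s:{0..t}|lborel. (t - s) powr (\<gamma> - 1) * f s)"
  using assms(2) unfolding RL_integral_def set_lebesgue_integral_def
  by (subst integral_completion) auto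

lemma borel_measurable_RL_integral [measurable]:
  assumes [measurable]: "f \<in> borel_measurable borel"
  shows "RL_integral \<gamma> f \<in> borel_measurable borel"
proof (cases "\<gamma> = 0")
  case True
  then have "RL_integral \<gamma> f = f" by (simp add: RL_integral_def fun_eq_iff)
  then show ?thesis by simp
next
  case False
  have "RL_integral \<gamma> f = (\<lambda>t. 1 / Gamma \<gamma> * (\<integral>s. (if 0 \<le> s \<and> s \<le> t then (t - s) powr (\<gamma> - 1) * f s else 0) \<partial>lborel))"
    unfolding RL_integral_lborel[OF assms False, abs_def] set_lebesgue_integral_def
    by (auto simp: indicator_def fun_eq_iff intro!: arg_cong[where f = "\<lambda>x. x / Gamma \<gamma>"] Bochner_Integration.integral_cong)
  also have "\<dots> \<in> borel_measurable borel" by measurable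
  finally show ?thesis .
qed

lemma set_integrable_powr_Icc:
  assumes "-1 < (a::real)" "0 \<le> T"
  shows "set_integrable lborel {0..T} (\<lambda>t. t powr a)"
proof -
  have "(\<lambda>t. t powr a) integrable_on {0..T}"
    by (rule integrable_on_powr_from_0) (use assms in auto)
  then have "(\<lambda>t. t powr a) absolutely_integrable_on {0..T}"
    by (subst absolutely_integrable_on_iff_nonneg) auto
  then show ?thesis unfolding set_integrable_def by (subst (asm) integrable_completion) auto
qed

text \<open>Fractional integration is symmetric for the reflected pairing on \<open>[0, T]\<close>.
  It can thus be moved from an unknown function to an explicit kernel.\<close>

lemma RL_integral_convolution:
  fixes f \<kappa> :: "real \<Rightarrow> real"
  assumes [measurable]: "f \<in> borel_measurable borel" "\<kappa> \<in> borel_measurable borel"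
    and \<gamma>: "0 \<le> \<gamma>" and T: "0 \<le> T" and f: "set_integrable lborel {0..T} f"
    and B: "\<And>r. r \<in> {0..T} \<Longrightarrow> \<bar>\<kappa> r\<bar> \<le> B"
  shows "(LINT t:{0..T}|lborel. \<kappa> (T - t) * RL_integral \<gamma> f t)
       = (LINT s:{0..T}|lborel. f s * RL_integral \<gamma> \<kappa> (T - s))"
proof (cases "\<gamma> = 0")
  case True
  then show ?thesis by (simp add: RL_integral_def mult.commute)
next
  case False
  have "(LINT t:{0..T}|lborel. \<kappa> (T - t) * (LINT s:{0..t}|lborel. (t - s) powr (\<gamma> - 1) * f s))
       = (LINT s:{0..T}|lborel. f s * (LINT r:{0..T - s}|lborel. (T - s - r) powr (\<gamma> - 1) * \<kappa> r))"
    using False \<gamma> T f B by (intro convolution_commute[where k = "\<lambda>r. r powr (\<gamma> - 1)"] set_integrable_powr_Icc) auto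
  then have "1 / Gamma \<gamma> * (LINT t:{0..T}|lborel. \<kappa> (T - t) * (LINT s:{0..t}|lborel. (t - s) powr (\<gamma> - 1) * f s))
       = 1 / Gamma \<gamma> * (LINT s:{0..T}|lborel. f s * (LINT r:{0..T - s}|lborel. (T - s - r) powr (\<gamma> - 1) * \<kappa> r))"
    by simp
  then show ?thesis
    using False by (simp add: RL_integral_lborel set_integral_mult_right[symmetric] del: set_integral_mult_right)
qed

lemma set_lborel_reflect:
  fixes f :: "real \<Rightarrow> real"
  shows "(LINT s:{0..T}|lborel. f (T - s)) = (LINT s:{0..T}|lborel. f s)"
proof -
  have "(LINT s:{0..T}|lborel. f s) = (\<integral>s. indicator {0..T} (T + (-1) * s) *\<^sub>R f (T + (-1) * s) \<partial>lborel)"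
    using lborel_integral_real_affine[of "-1" "\<lambda>s. indicator {0..T} s *\<^sub>R f s" T]
    by (simp add: set_lebesgue_integral_def)
  also have "\<dots> = (LINT s:{0..T}|lborel. f (T - s))"
    unfolding set_lebesgue_integral_def by (intro Bochner_Integration.integral_cong) (auto simp: indicator_def)
  finally show ?thesis by simp
qed

text \<open>This is \<open>c\<close> times the integral of \<open>lag m (c * s)\<close> over
  \<open>[0, t]\<close>; for \<open>m = 0\<close> it is \<open>c * t\<close>.\<close>

definition lagdiff :: "real \<Rightarrow> nat \<Rightarrow> real \<Rightarrow> real" where
  "lagdiff c m t = lag m (c * t) - lag (Suc m) (c * t)"

lemma borel_measurable_lagser [measurable]: "lagser c a \<in> borel_measurable borel"
  unfolding lagser_def[abs_def] by measurable

lemma borel_measurable_lagdiff [measurable]: "lagdiff c m \<in> borel_measurable borel"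
  unfolding lagdiff_def[abs_def] by measurable

lemma abs_lagdiff_le:
  assumes "0 \<le> c" "r \<in> {0..T}"
  shows "\<bar>lagdiff c m r\<bar> \<le> 2 * exp (c * T)"
  using abs_lag_scaled_le[of c r T m] abs_lag_scaled_le[of c r T "Suc m"] assms by (simp add: lagdiff_def)

lemma lagser_X_power: "lagser c (fps_X ^ m) t = lag m (c * t)"
proof -
  have "(\<Sum>n. fps_nth (fps_X ^ m) n * lag n (c * t)) = (\<Sum>n\<in>{m}. fps_nth (fps_X ^ m) n * lag n (c * t))"
    by (rule suminf_finite) auto
  then show ?thesis by (simp add: lagser_def)
qed

lemma lagser_X_power_diff: "lagser c (bincF 1 * fps_X ^ m) t = lagdiff c m t"
proof -
  have nth: "fps_nth (bincF 1 * fps_X ^ m) n = (if n = m then 1 else if n = Suc m then -1 else 0)" for n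
  proof -
    have "bincF 1 * fps_X ^ m = fps_X ^ m - fps_X ^ Suc m"
      by (simp add: bincF_1 left_diff_distrib)
    then show ?thesis by (simp del: power_Suc)
  qed
  have "(\<Sum>n. fps_nth (bincF 1 * fps_X ^ m) n * lag n (c * t))
      = (\<Sum>n\<in>{m, Suc m}. fps_nth (bincF 1 * fps_X ^ m) n * lag n (c * t))"
    by (rule suminf_finite) (auto simp: nth)
  then show ?thesis by (simp add: lagser_def lagdiff_def nth)
qed

lemma lagser_X_power_mult: "lagser c (fps_X ^ j * bincF \<beta>) t = (\<Sum>i. binc \<beta> i * lag (i + j) (c * t))"
  if "0 \<le> \<beta>" "\<beta> \<le> 1" "0 \<le> c * t"
proof -
  let ?g = "\<lambda>n. fps_nth (fps_X ^ j * bincF \<beta>) n * lag n (c * t)"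
  have g: "?g (i + j) = binc \<beta> i * lag (i + j) (c * t)" for i
    by (simp add: fps_X_power_mult_nth)
  have "(\<lambda>i. ?g (i + j)) sums (\<Sum>i. binc \<beta> i * lag (i + j) (c * t))"
    unfolding g using summable_sums[OF summable_binc_lag[OF that(1,2,3), of "\<lambda>i. i + j"]] by simp
  then have "?g sums (\<Sum>i. binc \<beta> i * lag (i + j) (c * t))"
    by (subst (asm) sums_iff_shift) (simp add: fps_X_power_mult_nth)
  then show ?thesis by (simp add: sums_iff lagser_def)
qed

lemma set_integrable_reflect:
  fixes f :: "real \<Rightarrow> real"
  assumes "set_integrable lborel {0..T} f"
  shows "set_integrable lborel {0..T} (\<lambda>s. f (T - s))"
proof -
  have "integrable lborel (\<lambda>s. indicator {0..T} (T + (-1) * s) *\<^sub>R f (T + (-1) * s))"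
    using assms lborel_integrable_real_affine_iff[of "-1" "\<lambda>s. indicator {0..T} s *\<^sub>R f s" T]
    by (simp add: set_integrable_def)
  also have "(\<lambda>s. indicator {0..T} (T + (-1) * s) *\<^sub>R f (T + (-1) * s)) = (\<lambda>s. indicator {0..T} s *\<^sub>R f (T - s))"
    by (auto simp: indicator_def fun_eq_iff)
  finally show ?thesis by (simp add: set_integrable_def)
qed

text \<open>Pair the two expressions for \<open>h\<close> with the reflected kernel whose
  coefficients are \<open>X^j (1 - X)^\<beta>\<close>. Moving the integral of order
  \<open>1 - \<beta>\<close> from \<open>W\<close> onto it gives \<open>X^j (1 - X)\<close>, hence
  \<open>lagdiff c j\<close>. Expanding the kernel instead, and moving the integral of order 1 from
  \<open>D\<close> onto each Laguerre polynomial, gives the series. The remaining powers of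
  \<open>c\<close> combine to \<open>c powr (-\<beta>)\<close>.\<close>

lemma kernel_identity:
  fixes W D h :: "real \<Rightarrow> real"
  assumes \<beta>: "0 < \<beta>" "\<beta> \<le> 1" and c: "0 < c" and T: "0 \<le> T"
    and [measurable]: "W \<in> borel_measurable borel" "D \<in> borel_measurable borel" "h \<in> borel_measurable borel"
    and W: "set_integrable lborel {0..T} W" and D: "set_integrable lborel {0..T} D"
    and hi: "set_integrable lborel {0..T} h"
    and hD: "AE t in lborel. t \<in> {0..T} \<longrightarrow> h t = RL_integral 1 D t"
    and hW: "AE t in lborel. t \<in> {0..T} \<longrightarrow> h t = RL_integral (1 - \<beta>) W t"
  shows "(\<lambda>i. c powr (-\<beta>) * (binc \<beta> i * (LINT s:{0..T}|lborel. lagdiff c (i + j) (T - s) * D s))) sums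
      (LINT s:{0..T}|lborel. lagdiff c j (T - s) * W s)"
proof -
  define k where "k = fps_X ^ j * bincF \<beta>"
  have sk: "summable (\<lambda>n. \<bar>fps_nth k n\<bar>)"
    unfolding k_def
  proof (rule summable_abs_fps_mult)
    show "summable (\<lambda>n. \<bar>fps_nth (fps_X ^ j) n :: real\<bar>)"
      by (rule summable_finite[of "{j}"]) auto
  qed (use \<beta> in \<open>auto intro: summable_abs_binc\<close>)
  have bounded: "\<exists>B. \<forall>r\<in>{0..T}. \<bar>lagser c a r\<bar> \<le> B" if "summable (\<lambda>n. \<bar>fps_nth a n\<bar>)" for a
    using compact_imp_bounded[OF compact_continuous_image[OF continuous_on_lagser[OF that, of c T] compact_Icc]] c
    by (auto simp: bounded_iff)
  have sX: "summable (\<lambda>n. \<bar>fps_nth (fps_X ^ m) n :: real\<bar>)" for m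
    by (rule summable_finite[of "{m}"]) auto
  obtain B where B: "\<forall>r\<in>{0..T}. \<bar>lagser c k r\<bar> \<le> B" using bounded[OF sk] by blast
  have "(LINT t:{0..T}|lborel. lagser c k (T - t) * h t) = (LINT t:{0..T}|lborel. lagser c k (T - t) * RL_integral (1 - \<beta>) W t)"
    unfolding set_lebesgue_integral_def
    by (rule integral_cong_AE) (use hW in \<open>auto simp: indicator_def elim!: eventually_mono\<close>)
  also have "\<dots> = (LINT s:{0..T}|lborel. W s * RL_integral (1 - \<beta>) (lagser c k) (T - s))"
    using \<beta> T W B by (intro RL_integral_convolution) auto
  also have "\<dots> = (LINT s:{0..T}|lborel. c powr (-(1 - \<beta>)) * (lagdiff c j (T - s) * W s))"
  proof (rule set_lebesgue_integral_cong)
    show "\<forall>s. s \<in> {0..T} \<longrightarrow> W s * RL_integral (1 - \<beta>) (lagser c k) (T - s) = c powr (-(1 - \<beta>)) * (lagdiff c j (T - s) * W s)"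
    proof (intro allI impI)
      fix s assume "s \<in> {0..T}"
      then have "RL_integral (1 - \<beta>) (lagser c k) (T - s) = c powr (-(1 - \<beta>)) * lagser c (bincF (1 - \<beta>) * k) (T - s)"
        using \<beta> c sk by (intro RL_integral_lagser(2)) auto
      also have "bincF (1 - \<beta>) * k = (bincF (1 - \<beta>) * bincF \<beta>) * fps_X ^ j" by (simp add: k_def mult_ac)
      also have "\<dots> = bincF 1 * fps_X ^ j" by (simp add: bincF_mult)
      finally show "W s * RL_integral (1 - \<beta>) (lagser c k) (T - s) = c powr (-(1 - \<beta>)) * (lagdiff c j (T - s) * W s)"
        by (simp add: lagser_X_power_diff mult_ac)
    qed
  qed simp
  also have "\<dots> = c powr (-(1 - \<beta>)) * (LINT s:{0..T}|lborel. lagdiff c j (T - s) * W s)" by simp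
  finally have 1: "(LINT t:{0..T}|lborel. lagser c k (T - t) * h t)
      = c powr (-(1 - \<beta>)) * (LINT s:{0..T}|lborel. lagdiff c j (T - s) * W s)" .
  have shifted: "(LINT t:{0..T}|lborel. lag m (c * (T - t)) * h t)
      = c powr (-1) * (LINT s:{0..T}|lborel. lagdiff c m (T - s) * D s)" for m
  proof -
    obtain B where B: "\<forall>r\<in>{0..T}. \<bar>lagser c (fps_X ^ m) r\<bar> \<le> B" using bounded[OF sX] by blast
    have "(LINT t:{0..T}|lborel. lag m (c * (T - t)) * h t) = (LINT t:{0..T}|lborel. lagser c (fps_X ^ m) (T - t) * RL_integral 1 D t)"
      unfolding set_lebesgue_integral_def lagser_X_power
      by (rule integral_cong_AE) (use hD in \<open>auto simp: indicator_def elim!: eventually_mono\<close>)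
    also have "\<dots> = (LINT s:{0..T}|lborel. D s * RL_integral 1 (lagser c (fps_X ^ m)) (T - s))"
      using T D B by (intro RL_integral_convolution) auto
    also have "\<dots> = (LINT s:{0..T}|lborel. c powr (-1) * (lagdiff c m (T - s) * D s))"
    proof (rule set_lebesgue_integral_cong)
      show "\<forall>s. s \<in> {0..T} \<longrightarrow> D s * RL_integral 1 (lagser c (fps_X ^ m)) (T - s) = c powr (-1) * (lagdiff c m (T - s) * D s)"
      proof (intro allI impI)
        fix s assume "s \<in> {0..T}"
        then have "RL_integral 1 (lagser c (fps_X ^ m)) (T - s) = c powr (-1) * lagser c (bincF 1 * fps_X ^ m) (T - s)"
          using c sX by (intro RL_integral_lagser(2)) auto
        then show "D s * RL_integral 1 (lagser c (fps_X ^ m)) (T - s) = c powr (-1) * (lagdiff c m (T - s) * D s)"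
          by (simp add: lagser_X_power_diff mult_ac)
      qed
    qed simp
    finally show ?thesis by simp
  qed
  define \<phi> where "\<phi> s = h (T - s)" for s
  have \<phi>: "\<phi> absolutely_integrable_on {0..T}"
    using set_integrable_reflect[OF hi] unfolding set_integrable_def \<phi>_def
    by (subst integrable_completion) auto
  have lint: "integral {0..T} (\<lambda>s. \<phi> s * g s) = (LINT t:{0..T}|lborel. g (T - t) * h t)"
    if "(\<lambda>s. \<phi> s * g s) absolutely_integrable_on {0..T}" and [measurable]: "g \<in> borel_measurable borel" for g
  proof -
    have "integral {0..T} (\<lambda>s. \<phi> s * g s) = (LINT s:{0..T}|lebesgue. \<phi> s * g s)"
      by (rule set_lebesgue_integral_eq_integral(2)[OF that(1), symmetric])
    also have "\<dots> = (LINT s:{0..T}|lborel. \<phi> s * g s)"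
      unfolding set_lebesgue_integral_def \<phi>_def by (subst integral_completion) auto
    also have "\<dots> = (LINT s:{0..T}|lborel. \<phi> (T - s) * g (T - s))"
      by (rule set_lborel_reflect[symmetric])
    finally show ?thesis by (simp add: \<phi>_def mult.commute)
  qed
  have ser: "(\<Sum>i. binc \<beta> i * lag (i + j) (c * s)) = lagser c k s" if "s \<in> {0..T}" for s
    unfolding k_def using \<beta> c that by (intro lagser_X_power_mult[symmetric]) auto
  have sb: "summable (\<lambda>i. \<bar>binc \<beta> i\<bar>)" using \<beta> by (intro summable_abs_binc) auto
  note lsi = lag_series_integral[OF \<phi> sb less_imp_le[OF c], of "\<lambda>i. i + j"]
  have "(\<lambda>i. binc \<beta> i * (LINT t:{0..T}|lborel. lag (i + j) (c * (T - t)) * h t)) sums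
      integral {0..T} (\<lambda>s. \<phi> s * (\<Sum>i. binc \<beta> i * lag (i + j) (c * s)))"
    using lsi(2) by (subst (asm) lint[OF lsi(3)]) auto
  moreover have "integral {0..T} (\<lambda>s. \<phi> s * (\<Sum>i. binc \<beta> i * lag (i + j) (c * s)))
      = (LINT t:{0..T}|lborel. (\<Sum>i. binc \<beta> i * lag (i + j) (c * (T - t))) * h t)"
    by (rule lint[OF lsi(1)]) measurable
  moreover have "\<dots> = (LINT t:{0..T}|lborel. lagser c k (T - t) * h t)"
    by (rule set_lebesgue_integral_cong) (auto simp: ser)
  ultimately have "(\<lambda>i. binc \<beta> i * (c powr (-1) * (LINT s:{0..T}|lborel. lagdiff c (i + j) (T - s) * D s))) sums
      (LINT t:{0..T}|lborel. lagser c k (T - t) * h t)"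
    unfolding shifted by simp
  then have S: "(\<lambda>i. c powr (-1) * (binc \<beta> i * (LINT s:{0..T}|lborel. lagdiff c (i + j) (T - s) * D s))) sums
      (c powr (-(1 - \<beta>)) * (LINT s:{0..T}|lborel. lagdiff c j (T - s) * W s))"
    unfolding 1 by (simp add: mult_ac)
  have cp: "c powr (1 - \<beta>) * c powr (-(1 - \<beta>)) = 1" "c powr (1 - \<beta>) * c powr (-1) = c powr (-\<beta>)"
    unfolding powr_add[symmetric] using c by simp_all
  from sums_mult[OF S, of "c powr (1 - \<beta>)"]
  show ?thesis by (simp only: mult.assoc[symmetric] cp mult_1)
qed

section \<open>Measurability of time derivatives\<close>

text \<open>For each time separately, \<open>h t\<close> is measurable up to a null set. Since
  almost every path is continuous, its values on countable grids determine it off one null set; a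
  jointly measurable copy \<open>H\<close> is a limit of step functions, and forward difference
  quotients, which stay inside the half line, give the derivative.\<close>

lemma joint_derivative:
  fixes h :: "real \<Rightarrow> 'a \<Rightarrow> real"
  assumes meas: "\<And>t. 0 \<le> t \<Longrightarrow> \<exists>g\<in>borel_measurable M. AE x in M. h t x = g x"
    and der: "AE x in M. \<forall>t\<in>{0..}. \<exists>D. ((\<lambda>s. h s x) has_real_derivative D) (at t within {0..})"
  obtains D' H where "(\<lambda>(s, x). D' s x) \<in> borel_measurable (lborel \<Otimes>\<^sub>M M)"
    "(\<lambda>(s, x). H s x) \<in> borel_measurable (lborel \<Otimes>\<^sub>M M)"
    "AE x in M. \<forall>t\<in>{0..}. H t x = h t x \<and> ((\<lambda>s. h s x) has_real_derivative D' t x) (at t within {0..})"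
proof -
  obtain g where g: "\<And>t. 0 \<le> t \<Longrightarrow> g t \<in> borel_measurable M" "\<And>t. 0 \<le> t \<Longrightarrow> AE x in M. h t x = g t x"
    using meas by metis
  \<comment> \<open>The grid point of mesh \<open>1 / Suc n\<close> just below a nonnegative time;
    \<open>nat\<close> clips negative indices, as \<open>g\<close> is controlled only at nonnegative
    times.\<close>
  define q where "q n i = real (nat i) / real (Suc n)" for n and i :: int
  define Hn where "Hn n s x = g (q n \<lfloor>real (Suc n) * s\<rfloor>) x" for n s x
  have Hn [measurable]: "(\<lambda>(s, x). Hn n s x) \<in> borel_measurable (lborel \<Otimes>\<^sub>M M)" for n
  proof -
    have "(\<lambda>z. g (q n \<lfloor>real (Suc n) * fst z\<rfloor>) (snd z)) \<in> borel_measurable (lborel \<Otimes>\<^sub>M M)"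
    proof (rule measurable_compose_countable[where f = "\<lambda>i z. g (q n i) (snd z)" and g = "\<lambda>z. \<lfloor>real (Suc n) * fst z\<rfloor>"])
      show "(\<lambda>z. g (q n i) (snd z)) \<in> borel_measurable (lborel \<Otimes>\<^sub>M M)" for i
        by (rule measurable_compose[OF measurable_snd g(1)]) (simp add: q_def)
    qed measurable
    then show ?thesis by (simp add: Hn_def case_prod_beta')
  qed
  define H where "H s x = lim (\<lambda>n. Hn n s x)" for s x
  have H [measurable]: "(\<lambda>(s, x). H s x) \<in> borel_measurable (lborel \<Otimes>\<^sub>M M)"
    unfolding H_def by measurable
  define D' where "D' s x = lim (\<lambda>n. real (Suc n) * (H (s + 1 / real (Suc n)) x - H s x))" for s x
  have D': "(\<lambda>(s, x). D' s x) \<in> borel_measurable (lborel \<Otimes>\<^sub>M M)"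
    unfolding D'_def by measurable
  have "AE x in M. h (q n i) x = g (q n i) x" for n i by (rule g) (simp add: q_def)
  then have "AE x in M. \<forall>n i. h (q n i) x = g (q n i) x" unfolding AE_all_countable by blast
  with der have "AE x in M. \<forall>t\<in>{0..}. H t x = h t x \<and> ((\<lambda>s. h s x) has_real_derivative D' t x) (at t within {0..})"
  proof eventually_elim
    case (elim x)
    have H_eq: "H t x = h t x" if t: "0 \<le> t" for t
    proof -
      obtain D where "((\<lambda>s. h s x) has_real_derivative D) (at t within {0..})" using elim(1) t by auto
      then have "continuous (at t within {0..}) (\<lambda>s. h s x)" by (rule DERIV_continuous)
      moreover have "(\<lambda>n. q n \<lfloor>real (Suc n) * t\<rfloor>) \<longlonglongrightarrow> t"
      proof (rule tendsto_sandwich[where f = "\<lambda>n. t - 1 / real (Suc n)" and h = "\<lambda>n. t"])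
        show "(\<lambda>n. t - 1 / real (Suc n)) \<longlonglongrightarrow> t"
          using tendsto_diff[OF tendsto_const[of t] LIMSEQ_Suc[OF lim_1_over_n]] by simp
        have q: "q n \<lfloor>real (Suc n) * t\<rfloor> = of_int \<lfloor>real (Suc n) * t\<rfloor> / real (Suc n)" for n
          using t by (simp add: q_def del: of_nat_Suc)
        show "\<forall>\<^sub>F n in sequentially. t - 1 / real (Suc n) \<le> q n \<lfloor>real (Suc n) * t\<rfloor>"
        proof (intro always_eventually allI)
          fix n
          have "real (Suc n) * t - 1 \<le> of_int \<lfloor>real (Suc n) * t\<rfloor>" by linarith
          then have "(real (Suc n) * t - 1) / real (Suc n) \<le> q n \<lfloor>real (Suc n) * t\<rfloor>"
            unfolding q by (intro divide_right_mono) auto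
          then show "t - 1 / real (Suc n) \<le> q n \<lfloor>real (Suc n) * t\<rfloor>"
            by (simp add: diff_divide_distrib del: of_nat_Suc)
        qed
        show "\<forall>\<^sub>F n in sequentially. q n \<lfloor>real (Suc n) * t\<rfloor> \<le> t"
        proof (intro always_eventually allI)
          fix n
          have "of_int \<lfloor>real (Suc n) * t\<rfloor> / real (Suc n) \<le> (real (Suc n) * t) / real (Suc n)"
            by (intro divide_right_mono) auto
          then show "q n \<lfloor>real (Suc n) * t\<rfloor> \<le> t" unfolding q by (simp del: of_nat_Suc)
        qed
      qed simp
      ultimately have "(\<lambda>n. h (q n \<lfloor>real (Suc n) * t\<rfloor>) x) \<longlonglongrightarrow> h t x"
        unfolding continuous_within_sequentially o_def by (auto simp: q_def)
      then show ?thesis using elim(2) by (simp add: H_def Hn_def limI)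
    qed
    have "((\<lambda>s. h s x) has_real_derivative D' t x) (at t within {0..})" if t: "0 \<le> t" for t
    proof -
      obtain D where D: "((\<lambda>s. h s x) has_real_derivative D) (at t within {0..})" using elim(1) t by auto
      have "filterlim (\<lambda>n. t + 1 / real (Suc n)) (at t within {0..}) sequentially"
        unfolding filterlim_at
      proof
        show "(\<lambda>n. t + 1 / real (Suc n)) \<longlonglongrightarrow> t"
          using tendsto_add[OF tendsto_const[of t] LIMSEQ_Suc[OF lim_1_over_n]] by simp
      qed (use t in \<open>auto intro!: always_eventually\<close>)
      from filterlim_compose[OF D[unfolded has_field_derivative_iff] this]
      have "(\<lambda>n. real (Suc n) * (h (t + 1 / real (Suc n)) x - h t x)) \<longlonglongrightarrow> D"
        by (simp add: mult.commute del: of_nat_Suc)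
      then have "D' t x = D" using t by (simp add: D'_def H_eq limI)
      with D show ?thesis by simp
    qed
    with H_eq show ?case by auto
  qed
  with D' H that show ?thesis by blast
qed

section \<open>Uniqueness\<close>

lemma AE_lebesgue_on_iff:
  assumes "S \<in> sets lebesgue"
  shows "(AE x in lebesgue_on S. P x) \<longleftrightarrow> (AE x in lborel. x \<in> S \<longrightarrow> P x)"
  using assms by (simp add: AE_restrict_space_iff AE_completion_iff)

lemma sigma_finite_lebesgue_on:
  fixes S :: "'a::euclidean_space set"
  assumes "S \<in> sets lebesgue"
  shows "sigma_finite_measure (lebesgue_on S)"
proof (rule sigma_finite_measure_restrict_space[OF _ assms])
  obtain \<C> :: "'a set set" where C: "countable \<C>" "\<C> \<subseteq> sets lborel" "\<Union>\<C> = space lborel" "\<forall>a\<in>\<C>. emeasure lborel a \<noteq> \<infinity>"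
    using lborel.sigma_finite_countable by blast
  show "sigma_finite_measure (lebesgue :: 'a measure)"
    by standard (use C in \<open>auto intro!: exI[of _ \<C>] simp: subset_iff\<close>)
qed

text \<open>Order 0 is excluded because there the operator evaluates \<open>f\<close> at
  \<open>t\<close>, which equality almost everywhere does not determine.\<close>

lemma RL_integral_cong_AE:
  assumes f: "RL_integral_exists \<gamma> f t" and g [measurable]: "g \<in> borel_measurable borel" and "\<gamma> \<noteq> 0"
    and eq: "AE s in lborel. 0 \<le> s \<longrightarrow> f s = g s"
  shows "RL_integral \<gamma> f t = RL_integral \<gamma> g t"
proof -
  have "(LINT s:{0..t}|lebesgue. (t - s) powr (\<gamma> - 1) * f s) = (LINT s:{0..t}|lebesgue. (t - s) powr (\<gamma> - 1) * g s)"
    unfolding set_lebesgue_integral_def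
  proof (rule integral_cong_AE)
    show "(\<lambda>s. indicator {0..t} s *\<^sub>R ((t - s) powr (\<gamma> - 1) * f s)) \<in> borel_measurable lebesgue"
      using f \<open>\<gamma> \<noteq> 0\<close> by (auto simp: RL_integral_exists_def set_integrable_def)
    show "(\<lambda>s. indicator {0..t} s *\<^sub>R ((t - s) powr (\<gamma> - 1) * g s)) \<in> borel_measurable lebesgue"
      by (rule measurable_completion) measurable
    show "AE s in lebesgue. indicator {0..t} s *\<^sub>R ((t - s) powr (\<gamma> - 1) * f s) = indicator {0..t} s *\<^sub>R ((t - s) powr (\<gamma> - 1) * g s)"
      using AE_completion[OF eq] by eventually_elim (auto simp: indicator_def)
  qed
  with \<open>\<gamma> \<noteq> 0\<close> show ?thesis by (simp add: RL_integral_def)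
qed

lemma RL_integral_1_lborel:
  assumes [measurable]: "f \<in> borel_measurable borel"
  shows "RL_integral 1 f t = (LINT s:{0..t}|lborel. f s)"
proof -
  have "RL_integral 1 f t = (LINT s:{0..t}|lborel. (t - s) powr (1 - 1) * f s)"
    by (simp add: RL_integral_lborel)
  also have "\<dots> = (LINT s:{0..t}|lborel. f s)"
    unfolding set_lebesgue_integral_def
  proof (rule integral_cong_AE)
    show "AE s in lborel. indicator {0..t} s *\<^sub>R ((t - s) powr (1 - 1) * f s) = indicator {0..t} s *\<^sub>R f s"
      using AE_lborel_singleton[of t] by eventually_elim auto
  qed auto
  finally show ?thesis .
qed

lemma RL_integral_at_0: "\<gamma> \<noteq> 0 \<Longrightarrow> RL_integral \<gamma> f 0 = 0"
proof -
  assume "\<gamma> \<noteq> 0"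
  have "(LINT s:{0..0}|lebesgue. (0 - s) powr (\<gamma> - 1) * f s) = 0"
    unfolding set_lebesgue_integral_def
  proof (rule integral_eq_zero_AE)
    show "AE s in lebesgue. indicator {0..0::real} s *\<^sub>R ((0 - s) powr (\<gamma> - 1) * f s) = 0"
      using AE_completion[OF AE_lborel_singleton[of "0::real"]] by eventually_elim auto
  qed
  with \<open>\<gamma> \<noteq> 0\<close> show ?thesis by (simp add: RL_integral_def)
qed

lemma RL_integral_diff:
  assumes f: "RL_integral_exists \<gamma> f t" and g: "RL_integral_exists \<gamma> g t"
  shows "RL_integral_exists \<gamma> (\<lambda>s. f s - g s) t"
    and "RL_integral \<gamma> (\<lambda>s. f s - g s) t = RL_integral \<gamma> f t - RL_integral \<gamma> g t"
proof -
  show "RL_integral_exists \<gamma> (\<lambda>s. f s - g s) t"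
    using set_integral_diff(1)[of lebesgue "{0..t}"] f g
    by (auto simp: RL_integral_exists_def right_diff_distrib)
  show "RL_integral \<gamma> (\<lambda>s. f s - g s) t = RL_integral \<gamma> f t - RL_integral \<gamma> g t"
    using set_integral_diff(2)[of lebesgue "{0..t}"] f g
    by (auto simp: RL_integral_exists_def RL_integral_def right_diff_distrib diff_divide_distrib)
qed

lemma has_Caputo_derivative_diff:
  assumes f: "has_Caputo_derivative I \<beta> f t D" and g: "has_Caputo_derivative I \<beta> g t E" and t: "t \<in> I"
  shows "has_Caputo_derivative I \<beta> (\<lambda>s. f s - g s) t (D - E)"
proof -
  let ?f = "\<lambda>s. f s - f 0" and ?g = "\<lambda>s. g s - g 0"
  have eq: "(\<lambda>s. f s - g s - (f 0 - g 0)) = (\<lambda>s. ?f s - ?g s)" by auto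
  have ev: "\<forall>\<^sub>F s in nhds t. s \<in> I \<longrightarrow> RL_integral_exists (1 - \<beta>) ?f s \<and> RL_integral_exists (1 - \<beta>) ?g s"
    using f g unfolding has_Caputo_derivative_def has_RL_derivative_def
    by (auto elim: eventually_elim2)
  then obtain d where d: "0 < d" "\<And>s. s \<in> I \<Longrightarrow> dist s t < d \<Longrightarrow> RL_integral_exists (1 - \<beta>) ?f s \<and> RL_integral_exists (1 - \<beta>) ?g s"
    unfolding eventually_nhds_metric by auto
  have "((\<lambda>s. RL_integral (1 - \<beta>) ?f s - RL_integral (1 - \<beta>) ?g s) has_real_derivative D - E) (at t within I)"
    using f g unfolding has_Caputo_derivative_def has_RL_derivative_def by (intro DERIV_diff) auto
  then have "(RL_integral (1 - \<beta>) (\<lambda>s. ?f s - ?g s) has_real_derivative D - E) (at t within I)"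
    by (rule has_field_derivative_transform_within[OF _ d(1) t]) (use d(2) in \<open>simp add: RL_integral_diff\<close>)
  moreover have "\<forall>\<^sub>F s in nhds t. s \<in> I \<longrightarrow> RL_integral_exists (1 - \<beta>) (\<lambda>s. ?f s - ?g s) s"
    using ev by eventually_elim (auto intro: RL_integral_diff(1))
  ultimately show ?thesis
    unfolding has_Caputo_derivative_def has_RL_derivative_def eq by blast
qed

lemma has_real_derivative_unique_Ici:
  assumes "(f has_real_derivative D) (at t within {0..})" "(f has_real_derivative E) (at t within {0..})" "0 \<le> t"
  shows "D = E"
proof -
  have "at t within {0..} \<noteq> bot"
  proof -
    have "at t within {t<..} \<le> at t within {0..}" using assms(3) by (intro at_le) auto
    then show ?thesis using trivial_limit_at_right_real[of t] by (metis bot.extremum_uniqueI)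
  qed
  then show ?thesis using assms(1,2) unfolding has_field_derivative_iff by (rule tendsto_unique)
qed

text \<open>The second difference in \<open>T\<close> of the ramp \<open>max 0 (T - s)\<close> is
  the tent at \<open>t\<close>. Using ramps puts the three integrals on the common interval
  \<open>[0, t + \<delta>]\<close>.\<close>

lemma tent_integral:
  fixes g :: "real \<Rightarrow> real"
  assumes g: "set_integrable lborel {0..t + \<delta>} g" and [measurable]: "g \<in> borel_measurable borel"
    and \<delta>: "0 < \<delta>" "\<delta> \<le> t"
  defines "\<Phi> \<equiv> \<lambda>T. LINT s:{0..T}|lborel. (T - s) * g s"
  shows "(LINT s:{t - \<delta>..t + \<delta>}|lborel. (\<delta> - \<bar>s - t\<bar>) * g s) = \<Phi> (t + \<delta>) - 2 * \<Phi> t + \<Phi> (t - \<delta>)"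
proof -
  let ?R = "t + \<delta>"
  have int: "set_integrable lborel {0..?R} (\<lambda>s. max 0 (T - s) * g s)" if "T \<le> ?R" for T
  proof (rule set_integrable_bound)
    show "set_integrable lborel {0..?R} (\<lambda>s. ?R * g s)" using g by (intro set_integrable_mult_right)
    have "\<bar>max 0 (T - s) * g s\<bar> \<le> \<bar>?R * g s\<bar>" if "s \<in> {0..?R}" for s
      using \<open>T \<le> ?R\<close> that unfolding abs_mult by (intro mult_right_mono) auto
    then show "AE s in lborel. s \<in> {0..?R} \<longrightarrow> norm (max 0 (T - s) * g s) \<le> norm (?R * g s)" by auto
  qed (auto simp: set_borel_measurable_def)
  have \<Phi>: "(LINT s:{0..?R}|lborel. max 0 (T - s) * g s) = \<Phi> T" if "0 \<le> T" "T \<le> ?R" for T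
    unfolding \<Phi>_def set_lebesgue_integral_def
    by (intro Bochner_Integration.integral_cong) (use that in \<open>auto simp: indicator_def\<close>)
  have "(LINT s:{t - \<delta>..?R}|lborel. (\<delta> - \<bar>s - t\<bar>) * g s)
      = (LINT s:{0..?R}|lborel. max 0 (?R - s) * g s - 2 * (max 0 (t - s) * g s) + max 0 (t - \<delta> - s) * g s)"
    unfolding set_lebesgue_integral_def
  proof (intro Bochner_Integration.integral_cong refl)
    fix s
    have "max 0 (?R - s) - 2 * max 0 (t - s) + max 0 (t - \<delta> - s) = (if t - \<delta> \<le> s then \<delta> - \<bar>s - t\<bar> else 0)" if "s \<le> ?R"
      using that \<delta> by (auto simp: max_def abs_real_def)
    then have "max 0 (?R - s) * g s - 2 * (max 0 (t - s) * g s) + max 0 (t - \<delta> - s) * g s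
        = (if t - \<delta> \<le> s then \<delta> - \<bar>s - t\<bar> else 0) * g s" if "s \<le> ?R"
      using that by (simp only: flip: distrib_right left_diff_distrib mult.assoc)
    then show "indicator {t - \<delta>..?R} s *\<^sub>R ((\<delta> - \<bar>s - t\<bar>) * g s) = indicator {0..?R} s *\<^sub>R
        (max 0 (?R - s) * g s - 2 * (max 0 (t - s) * g s) + max 0 (t - \<delta> - s) * g s)"
      using \<delta> by (auto simp: indicator_def)
  qed
  also have "\<dots> = (LINT s:{0..?R}|lborel. max 0 (?R - s) * g s) - 2 * (LINT s:{0..?R}|lborel. max 0 (t - s) * g s)
       + (LINT s:{0..?R}|lborel. max 0 (t - \<delta> - s) * g s)"
    using int[of ?R] int[of t] int[of "t - \<delta>"] \<delta>
    by (simp add: set_integral_add set_integral_diff set_integrable_mult_right)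
  also have "\<dots> = \<Phi> ?R - 2 * \<Phi> t + \<Phi> (t - \<delta>)" using \<delta> by (simp add: \<Phi>)
  finally show ?thesis .
qed

text \<open>The mass of the tent, as the second difference of \<open>T\<^sup>2 / 2\<close>.\<close>

lemma tent_integral_1:
  fixes t \<delta> :: real
  assumes \<delta>: "0 < \<delta>" "\<delta> \<le> t"
  shows "(LINT s:{t - \<delta>..t + \<delta>}|lborel. (\<delta> - \<bar>s - t\<bar>)) = \<delta>\<^sup>2"
proof -
  have sq: "(LINT s:{0..T}|lborel. (T - s) * 1) = T\<^sup>2 / 2" if "0 \<le> T" for T :: real
  proof -
    have "((\<lambda>s. T - s) has_integral ((T * T - T\<^sup>2 / 2) - (T * 0 - 0\<^sup>2 / 2))) {0..T}"
      using that by (intro fundamental_theorem_of_calculus)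
        (auto simp: has_real_derivative_iff_has_vector_derivative[symmetric] intro!: derivative_eq_intros)
    moreover have "set_integrable lborel {0..T} (\<lambda>s. T - s)"
      by (intro borel_integrable_atLeastAtMost' continuous_intros)
    ultimately show ?thesis
      by (simp add: set_borel_integral_eq_integral integral_unique power2_eq_square)
  qed
  have "0 \<le> t + \<delta>" "0 \<le> t" "0 \<le> t - \<delta>" using \<delta> by auto
  note sq3 = this[THEN sq]
  have "(LINT s:{t - \<delta>..t + \<delta>}|lborel. (\<delta> - \<bar>s - t\<bar>) * 1) = (t + \<delta>)\<^sup>2 / 2 - 2 * (t\<^sup>2 / 2) + (t - \<delta>)\<^sup>2 / 2"
    unfolding tent_integral[OF set_integrable_const_Icc[of 0 "t + \<delta>" 1] borel_measurable_const \<delta>] sq3 ..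
  also have "\<dots> = \<delta>\<^sup>2" by (simp add: power2_eq_square field_simps)
  finally show ?thesis by simp
qed

context Lp_operator
begin

text \<open>If all \<open>L j\<close> lie in the ball of radius \<tau>, the equations put them in
  the ball of radius \<open>\<tau> / 2\<close>. The adjoint shift raises the index, so a bound
  uniform in \<open>j\<close> takes the role of summability.\<close>

lemma adjoint_system_zero:
  fixes L :: "nat \<Rightarrow> 'a \<Rightarrow> real"
  assumes \<alpha>: "\<alpha> \<in> borel_measurable M" and \<alpha>0: "0 < \<alpha>0" "\<alpha>0 \<le> 1"
    and \<alpha>_bounds: "AE x in M. \<alpha>0 \<le> \<alpha> x \<and> \<alpha> x \<le> 1" and c: "1 \<le> c"
    and small: "c powr (-\<alpha>0) * ((\<Sum>i. binc_bound \<alpha>0 i) * K) \<le> 1/2"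
    and L: "\<And>j. ball \<sigma> (L j)"
    and rec: "\<And>j. AE x in M. (\<lambda>i. c powr (-\<alpha> x) * (binc (\<alpha> x) i * A (L (i + j)) x)) sums L j x"
  shows "AE x in M. L j x = 0"
proof -
  define B where "B = (\<Sum>i. binc_bound \<alpha>0 i)"
  have bb: "summable (binc_bound \<alpha>0)" and bb0: "0 \<le> binc_bound \<alpha>0 i" for i
    using \<alpha>0 by (auto intro: summable_binc_bound binc_bound_nonneg)
  have \<sigma>: "0 \<le> \<sigma>" using L by (rule Lp_ballD)
  have halve: "ball (\<tau> / 2) (L j)" if L: "\<And>j. ball \<tau> (L j)" for \<tau> j
  proof -
    have \<tau>: "0 \<le> \<tau>" using L by (rule Lp_ballD)
    let ?g = "\<lambda>i x. (c powr (-\<alpha> x) * binc (\<alpha> x) i) * A (L (i + j)) x"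
    have g: "ball ((c powr (-\<alpha>0) * binc_bound \<alpha>0 i) * (K * \<tau>)) (?g i)" for i
      by (intro ball_weight \<alpha> \<alpha>0(1) \<alpha>_bounds c A_ball L)
    have sm: "(\<lambda>i. (c powr (-\<alpha>0) * binc_bound \<alpha>0 i) * (K * \<tau>)) sums ((c powr (-\<alpha>0) * B) * (K * \<tau>))"
      unfolding B_def by (intro sums_mult2 sums_mult summable_sums bb)
    have "AE x in M. L j x = (\<Sum>i. ?g i x)"
      using rec[of j] by eventually_elim (simp add: sums_iff mult.assoc)
    from Lp_ball_cong_AE[OF p Lp_ball_suminf(2)[OF p g sums_summable[OF sm]] Lp_ballD(1)[OF L] this]
    have "ball ((c powr (-\<alpha>0) * B) * (K * \<tau>)) (L j)" using sm by (simp add: sums_iff)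
    moreover have "(c powr (-\<alpha>0) * B) * (K * \<tau>) \<le> \<tau> / 2"
      using mult_right_mono[OF small \<tau>] by (simp add: B_def mult_ac)
    ultimately show ?thesis using \<tau> by (auto simp: Lp_ball_iff[OF p])
  qed
  have ball_n: "ball (\<sigma> * (1/2) ^ n) (L j)" for n j
  proof (induction n arbitrary: j)
    case (Suc n)
    from halve[OF this, of j] show ?case by simp
  qed (use L in simp)
  have "(\<lambda>n. \<sigma> * (1/2) ^ n) \<longlonglongrightarrow> \<sigma> * 0"
    by (intro tendsto_mult tendsto_const LIMSEQ_power_zero) simp
  then have lim: "(\<lambda>n. \<sigma> * (1/2) ^ n) \<longlonglongrightarrow> 0" by simp
  show ?thesis
  proof (rule Lp_ball_arbitrarily_small[OF p])
    fix e :: real assume "0 < e"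
    with lim have "eventually (\<lambda>n. \<sigma> * (1/2) ^ n < e) sequentially" by (rule order_tendstoD)
    then obtain n where "\<sigma> * (1/2) ^ n < e" by (meson eventually_at_top_linorder order_refl)
    then show "\<exists>C\<le>e. ball C (L j)" using ball_n[of n j] by (intro exI[of _ "\<sigma> * (1/2) ^ n"]) auto
  qed
qed

end

section \<open>Reduction to zero initial data and vanishing of such solutions\<close>

lemma solves_Cauchy_problem_diff:
  fixes \<Omega> :: "'a::euclidean_space set"
  assumes p: "1 \<le> p" and A: "bounded_linear_Lp (lebesgue_on \<Omega>) p A"
    and v: "solves_Cauchy_problem {0..} \<Omega> p \<alpha> A u0 v" and u: "solves_Cauchy_problem {0..} \<Omega> p \<alpha> A u0 u"
  shows "solves_Cauchy_problem {0..} \<Omega> p \<alpha> A (\<lambda>x. 0) (\<lambda>t x. v t x - u t x)"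
proof -
  let ?M = "lebesgue_on \<Omega>"
  obtain K where "Lp_operator ?M p A K" using Lp_operatorI[OF p A] .
  then interpret Lp_operator ?M p A K .
  note defs = solves_Cauchy_problem_def continuous_into_Lp_def
  have Lp: "v t \<in> Lp_space ?M p" "u t \<in> Lp_space ?M p" if "t \<in> {0..}" for t
    using v u that by (auto simp: defs)
  show ?thesis
    unfolding defs
  proof (intro conjI ballI)
    have "(\<lambda>(t, x). v t x) \<in> borel_measurable (lebesgue_on ({0..} \<times> \<Omega>))"
      "(\<lambda>(t, x). u t x) \<in> borel_measurable (lebesgue_on ({0..} \<times> \<Omega>))"
      using v u by (auto simp: defs)
    from borel_measurable_diff[OF this]
    show "(\<lambda>(t, x). v t x - u t x) \<in> borel_measurable (lebesgue_on ({0..} \<times> \<Omega>))"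
      by (simp add: case_prod_beta')
    show "AE x in ?M. v 0 x - u 0 x = 0"
      using v u unfolding defs by (auto elim: eventually_elim2)
    have "AE x in ?M. \<forall>t\<in>{0..}. \<exists>D. has_Caputo_derivative {0..} (\<alpha> x) (\<lambda>s. v s x) t D"
      "AE x in ?M. \<forall>t\<in>{0..}. \<exists>D. has_Caputo_derivative {0..} (\<alpha> x) (\<lambda>s. u s x) t D"
      using v u by (auto simp: defs)
    then show "AE x in ?M. \<forall>t\<in>{0..}. \<exists>D. has_Caputo_derivative {0..} (\<alpha> x) (\<lambda>s. v s x - u s x) t D"
    proof eventually_elim
      case (elim x)
      show ?case
      proof
        fix t :: real assume t: "t \<in> {0..}"
        obtain D E where "has_Caputo_derivative {0..} (\<alpha> x) (\<lambda>s. v s x) t D"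
          "has_Caputo_derivative {0..} (\<alpha> x) (\<lambda>s. u s x) t E" using elim t by blast
        from has_Caputo_derivative_diff[OF this t]
        show "\<exists>D. has_Caputo_derivative {0..} (\<alpha> x) (\<lambda>s. v s x - u s x) t D" by blast
      qed
    qed
    fix t :: real assume t: "t \<in> {0..}"
    show "(\<lambda>x. v t x - u t x) \<in> Lp_space ?M p"
      using Lp_ball_diff[OF p Lp_ball_norm[OF p Lp(1)[OF t]] Lp_ball_norm[OF p Lp(2)[OF t]]]
      by (simp add: Lp_ball_iff[OF p])
    have "AE x in ?M. has_Caputo_derivative {0..} (\<alpha> x) (\<lambda>s. v s x) t (A (v t) x)"
      "AE x in ?M. has_Caputo_derivative {0..} (\<alpha> x) (\<lambda>s. u s x) t (A (u t) x)"
      using v u t by (auto simp: defs)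
    with A_diff[OF Lp_ball_norm[OF p Lp(1)[OF t]] Lp_ball_norm[OF p Lp(2)[OF t]]]
    show "AE x in ?M. has_Caputo_derivative {0..} (\<alpha> x) (\<lambda>s. v s x - u s x) t (A (\<lambda>x. v t x - u t x) x)"
      by eventually_elim (use t has_Caputo_derivative_diff in auto)
    have "(\<lambda>x. f s x - f t x) \<in> Lp_space ?M p" if "f s \<in> Lp_space ?M p" "f t \<in> Lp_space ?M p" for f :: "real \<Rightarrow> 'a \<Rightarrow> real" and s
      using Lp_ball_diff[OF p Lp_ball_norm[OF p that(1)] Lp_ball_norm[OF p that(2)]] by (simp add: Lp_ball_iff[OF p])
    then have le: "(\<lambda>x. (v s x - u s x) - (v t x - u t x)) \<in> Lp_space ?M p \<and>
        Lp_norm ?M p (\<lambda>x. (v s x - u s x) - (v t x - u t x))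
        \<le> Lp_norm ?M p (\<lambda>x. v s x - v t x) + Lp_norm ?M p (\<lambda>x. u s x - u t x)" if s: "s \<in> {0..}" for s
      using Lp_ball_diff[OF p Lp_ball_norm[OF p, of "\<lambda>x. v s x - v t x" ?M] Lp_ball_norm[OF p, of "\<lambda>x. u s x - u t x" ?M]]
        Lp[OF s] Lp[OF t] by (simp add: Lp_ball_iff[OF p] algebra_simps)
    have near: "\<forall>\<^sub>F s in at t within {0..}. s \<in> {0..}" by (auto simp: eventually_at_filter)
    show "((\<lambda>s. Lp_norm ?M p (\<lambda>x. v s x - u s x - (v t x - u t x))) \<longlongrightarrow> 0) (at t within {0..})"
    proof (rule tendsto_sandwich[OF _ _ tendsto_const])
      show "\<forall>\<^sub>F s in at t within {0..}. 0 \<le> Lp_norm ?M p (\<lambda>x. v s x - u s x - (v t x - u t x))"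
        using near by eventually_elim (use le Lp_norm_nonneg in blast)
      show "\<forall>\<^sub>F s in at t within {0..}. Lp_norm ?M p (\<lambda>x. v s x - u s x - (v t x - u t x))
          \<le> Lp_norm ?M p (\<lambda>x. v s x - v t x) + Lp_norm ?M p (\<lambda>x. u s x - u t x)"
        using near by eventually_elim (use le in blast)
      have "((\<lambda>s. Lp_norm ?M p (\<lambda>x. v s x - v t x) + Lp_norm ?M p (\<lambda>x. u s x - u t x)) \<longlongrightarrow> 0 + 0) (at t within {0..})"
        using v u t by (intro tendsto_add) (auto simp: defs)
      then show "((\<lambda>s. Lp_norm ?M p (\<lambda>x. v s x - v t x) + Lp_norm ?M p (\<lambda>x. u s x - u t x)) \<longlongrightarrow> 0) (at t within {0..})"
        by simp
    qed
  qed
qed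

lemma Cauchy_problem_zero_solution:
  fixes \<Omega> :: "'a::euclidean_space set"
  assumes p: "1 \<le> p" and \<Omega>: "open \<Omega>" and A: "bounded_linear_Lp (lebesgue_on \<Omega>) p A"
    and \<alpha>0: "0 < \<alpha>0" "\<alpha>0 < 1" and \<alpha> [measurable]: "\<alpha> \<in> borel_measurable (lebesgue_on \<Omega>)"
    and \<alpha>_bounds: "AE x in lebesgue_on \<Omega>. \<alpha>0 \<le> \<alpha> x \<and> \<alpha> x \<le> 1"
    and sol: "solves_Cauchy_problem {0..} \<Omega> p \<alpha> A (\<lambda>x. 0) w" and t0: "0 \<le> t0"
  shows "AE x in lebesgue_on \<Omega>. w t0 x = 0"
proof -
  let ?M = "lebesgue_on \<Omega>"
  have \<Omega>': "\<Omega> \<in> sets lebesgue" using \<Omega> by auto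
  have M: "sigma_finite_measure ?M" by (rule sigma_finite_lebesgue_on[OF \<Omega>'])
  obtain K where "Lp_operator ?M p A K" using Lp_operatorI[OF p A] .
  then interpret Lp_operator ?M p A K .
  have w_meas: "(\<lambda>(t, x). w t x) \<in> borel_measurable (lebesgue_on ({0..} \<times> \<Omega>))"
    and w: "\<And>s. 0 \<le> s \<Longrightarrow> w s \<in> Lp_space ?M p"
    and cont: "\<And>s. 0 \<le> s \<Longrightarrow> ((\<lambda>r. Lp_norm ?M p (\<lambda>x. w r x - w s x)) \<longlongrightarrow> 0) (at s within {0..})"
    and Cap_ex: "AE x in ?M. \<forall>t\<in>{0..}. \<exists>D. has_Caputo_derivative {0..} (\<alpha> x) (\<lambda>s. w s x) t D"
    and Cap: "\<And>t. 0 \<le> t \<Longrightarrow> AE x in ?M. has_Caputo_derivative {0..} (\<alpha> x) (\<lambda>s. w s x) t (A (w t) x)"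
    and w0: "AE x in ?M. w 0 x = 0"
    using sol by (auto simp: solves_Cauchy_problem_def continuous_into_Lp_def)
  have w_m: "w s \<in> borel_measurable ?M" if "0 \<le> s" for s using w[OF that] by (simp add: Lp_space_def)

  have S: "({0..} :: real set) \<times> \<Omega> \<in> sets lebesgue"
    using \<Omega> by (intro sets_completionI_sets) (auto simp: borel_prod[symmetric] intro!: pair_measureI)
  \<comment> \<open>The Borel copy \<open>W\<close> has measurable time sections for every
    \<open>x\<close>; it agrees with \<open>w\<close> only for almost every pair of time and
    point.\<close>
  obtain W0 where W0: "W0 \<in> borel_measurable borel" "AE z in lebesgue_on ({0..} \<times> \<Omega>). (case z of (t, x) \<Rightarrow> w t x) = W0 z"
    using lebesgue_on_borel_representative[OF w_meas S] .
  define W where "W s x = W0 (s, x)" for s x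
  have W_borel [measurable]: "(\<lambda>z. W (fst z) (snd z)) \<in> borel_measurable (borel \<Otimes>\<^sub>M borel)"
    using W0(1) by (simp add: W_def borel_prod)
  have id [measurable]: "(\<lambda>x. x) \<in> measurable ?M borel"
    by (intro measurable_restrict_space1 measurable_completion) simp
  have W_joint [measurable]: "(\<lambda>(s, x). W s x) \<in> borel_measurable (lborel \<Otimes>\<^sub>M ?M)"
  proof -
    have "(\<lambda>z. (fst z, snd z)) \<in> measurable (lborel \<Otimes>\<^sub>M ?M) (borel \<Otimes>\<^sub>M borel)"
      by (intro measurable_Pair measurable_compose[OF measurable_snd id]) simp
    from measurable_compose[OF this W_borel] show ?thesis by (simp add: case_prod_beta')
  qed
  have W_joint' [measurable]: "(\<lambda>(x, s). W s x) \<in> borel_measurable (?M \<Otimes>\<^sub>M lborel)"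
    using measurable_compose[OF measurable_pair_swap' W_joint] by (simp add: case_prod_beta')
  have Wx [measurable]: "(\<lambda>s. W s x) \<in> borel_measurable borel" for x
    using measurable_compose[OF _ W_borel, of "\<lambda>s. (s, x)" borel] by simp
  have ae: "AE z in lborel \<Otimes>\<^sub>M lborel. 0 \<le> fst z \<and> snd z \<in> \<Omega> \<longrightarrow> w (fst z) (snd z) = W (fst z) (snd z)"
    using W0(2)[unfolded AE_lebesgue_on_iff[OF S]] unfolding lborel_prod
    by eventually_elim (auto simp: W_def)
  have Ww: "AE s in lborel. 0 \<le> s \<longrightarrow> (AE x in ?M. W s x = w s x)"
    using lborel_pair.AE_pair[OF ae]
  proof eventually_elim
    case (elim s)
    then show ?case
      unfolding AE_lebesgue_on_iff[OF \<Omega>'] by (auto elim!: eventually_mono)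
  qed
  have Ww': "AE x in ?M. AE s in lborel. 0 \<le> s \<longrightarrow> w s x = W s x"
  proof -
    have "AE z in lborel \<Otimes>\<^sub>M lborel. 0 \<le> snd z \<and> fst z \<in> \<Omega> \<longrightarrow> w (snd z) (fst z) = W (snd z) (fst z)"
    proof -
      have "AE z in distr (lborel \<Otimes>\<^sub>M lborel) (lborel \<Otimes>\<^sub>M lborel) (\<lambda>(x, y). (y, x)).
          0 \<le> fst z \<and> snd z \<in> \<Omega> \<longrightarrow> w (fst z) (snd z) = W (fst z) (snd z)"
        using ae by (subst (asm) lborel_pair.distr_pair_swap)
      from AE_distrD[OF measurable_pair_swap' this] show ?thesis by (simp add: case_prod_beta')
    qed
    from lborel_pair.AE_pair[OF this] show ?thesis
      unfolding AE_lebesgue_on_iff[OF \<Omega>'] by eventually_elim (auto elim!: eventually_mono)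
  qed

  \<comment> \<open>Since \<open>w\<close> vanishes at time 0, its Caputo derivative is the ordinary
    time derivative of \<open>h\<close>.\<close>
  define h where "h t x = RL_integral (1 - \<alpha> x) (\<lambda>s. w s x) t" for t x
  have h_der: "RL_integral_exists (1 - \<alpha> x) (\<lambda>s. w s x) t \<and> ((\<lambda>s. h s x) has_real_derivative D) (at t within {0..})"
    if "w 0 x = 0" "has_Caputo_derivative {0..} (\<alpha> x) (\<lambda>s. w s x) t D" "0 \<le> t" for x t D
    using that eventually_nhds_x_imp_x[of _ t]
    unfolding has_Caputo_derivative_def has_RL_derivative_def h_def by fastforce
  have good: "AE x in ?M. w 0 x = 0 \<and> 0 < \<alpha> x \<and> \<alpha> x \<le> 1 \<and>
      (AE s in lborel. 0 \<le> s \<longrightarrow> w s x = W s x) \<and>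
      (\<forall>t\<ge>0. RL_integral_exists (1 - \<alpha> x) (\<lambda>s. w s x) t) \<and>
      (\<forall>t\<in>{0..}. \<exists>D. ((\<lambda>s. h s x) has_real_derivative D) (at t within {0..}))"
    using w0 \<alpha>_bounds Ww' Cap_ex
  proof eventually_elim
    case (elim x)
    have "\<exists>D. RL_integral_exists (1 - \<alpha> x) (\<lambda>s. w s x) t \<and> ((\<lambda>s. h s x) has_real_derivative D) (at t within {0..})"
      if "0 \<le> t" for t using h_der elim(1,4) that by (meson atLeast_iff)
    then show ?case using elim(1-3) \<alpha>0 by auto
  qed
  \<comment> \<open>At order 0, that is \<open>\<alpha> x = 1\<close>, \<open>h\<close> takes the
    values of \<open>w\<close> itself, and passing to \<open>W\<close> is legitimate only for almost
    every time.\<close>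
  have h_W: "h t x = RL_integral (1 - \<alpha> x) (\<lambda>s. W s x) t"
    if "AE s in lborel. 0 \<le> s \<longrightarrow> w s x = W s x" "RL_integral_exists (1 - \<alpha> x) (\<lambda>s. w s x) t" "\<alpha> x \<noteq> 1" for x t
    unfolding h_def using that by (intro RL_integral_cong_AE) auto
  have h_meas: "\<exists>g\<in>borel_measurable ?M. AE x in ?M. h t x = g x" if t: "0 \<le> t" for t
  proof
    note [measurable] = w_m[OF t]
    have rG [measurable]: "(rGamma :: real \<Rightarrow> real) \<in> borel_measurable borel"
      by (intro borel_measurable_continuous_onI continuous_on_rGamma)
    interpret lborel: sigma_finite_measure "lborel :: real measure" by (rule lborel.sigma_finite_measure_axioms)
    \<comment> \<open>The reciprocal Gamma function is continuous everywhere, hence measurable in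
      the varying order. The branch \<open>\<alpha> x = 1\<close> is the convention for order
      0.\<close>
    let ?g = "\<lambda>x. if \<alpha> x = 1 then w t x else
       rGamma (1 - \<alpha> x) * (\<integral>s. (if 0 \<le> s \<and> s \<le> t then (t - s) powr (1 - \<alpha> x - 1) * W s x else 0) \<partial>lborel)"
    show "?g \<in> borel_measurable ?M" by measurable
    show "AE x in ?M. h t x = ?g x"
      using good
    proof eventually_elim
      case (elim x)
      show ?case
      proof (cases "\<alpha> x = 1")
        case False
        have "h t x = rGamma (1 - \<alpha> x) * (LINT s:{0..t}|lborel. (t - s) powr (1 - \<alpha> x - 1) * W s x)"
          using False elim t by (subst h_W) (auto simp: RL_integral_lborel rGamma_inverse_Gamma divide_inverse)
        also have "(LINT s:{0..t}|lborel. (t - s) powr (1 - \<alpha> x - 1) * W s x)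
            = (\<integral>s. (if 0 \<le> s \<and> s \<le> t then (t - s) powr (1 - \<alpha> x - 1) * W s x else 0) \<partial>lborel)"
          unfolding set_lebesgue_integral_def by (intro Bochner_Integration.integral_cong) (auto simp: indicator_def)
        finally show ?thesis using False by simp
      qed (simp add: h_def RL_integral_def)
    qed
  qed
  have "AE x in ?M. \<forall>t\<in>{0..}. \<exists>D. ((\<lambda>s. h s x) has_real_derivative D) (at t within {0..})"
    using good by eventually_elim blast
  from joint_derivative[OF h_meas this]
  obtain D H where D_joint [measurable]: "(\<lambda>(s, x). D s x) \<in> borel_measurable (lborel \<Otimes>\<^sub>M ?M)"
    and H_joint: "(\<lambda>(s, x). H s x) \<in> borel_measurable (lborel \<Otimes>\<^sub>M ?M)"
    and DH: "AE x in ?M. \<forall>t\<in>{0..}. H t x = h t x \<and> ((\<lambda>s. h s x) has_real_derivative D t x) (at t within {0..})"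
    by blast
  have DA: "AE x in ?M. D s x = A (w s) x" if s: "0 \<le> s" for s
    using DH Cap[OF s] w0
  proof eventually_elim
    case (elim x)
    then show ?case using s h_der has_real_derivative_unique_Ici by (meson atLeast_iff)
  qed
  have sec: "(\<lambda>s. D s x) \<in> borel_measurable borel" "(\<lambda>s. H s x) \<in> borel_measurable borel" if "x \<in> space ?M" for x
    using measurable_Pair1[OF D_joint that] measurable_Pair1[OF H_joint that] by simp_all

  obtain c where c: "1 \<le> c" and small: "c powr (-\<alpha>0) * ((\<Sum>i. binc_bound \<alpha>0 i) * K) \<le> 1/2"
  proof (rule exists_scale[of \<alpha>0 "(\<Sum>i. binc_bound \<alpha>0 i) * K"])
    show "0 \<le> (\<Sum>i. binc_bound \<alpha>0 i) * K"
      using \<alpha>0 K by (intro mult_nonneg_nonneg suminf_nonneg summable_binc_bound binc_bound_nonneg) auto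
  qed (use \<alpha>0 in auto)

  have moment: "(AE x in ?M. set_integrable lborel {0..T} (\<lambda>s. W s x)) \<and>
      (AE x in ?M. (LINT s:{0..T}|lborel. (T - s) * W s x) = 0)" if T: "0 \<le> T" for T
  proof
    have cont_T: "((\<lambda>r. Lp_norm ?M p (\<lambda>x. w r x - w s x)) \<longlongrightarrow> 0) (at s within {0..T})" if "s \<in> {0..T}" for s
      using that by (intro tendsto_within_subset[OF cont]) auto
    obtain C where C: "0 \<le> C" "\<And>s. s \<in> {0..T} \<Longrightarrow> ball C (w s)"
    proof (rule continuous_curve_bounded[of 0 T w, OF _ cont_T])
      show "w s \<in> Lp_space ?M p" if "s \<in> {0..T}" for s using w that by auto
    qed (use that in auto)
    have secM: "W s \<in> borel_measurable ?M" "D s \<in> borel_measurable ?M" for s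
      using measurable_Pair2[OF W_joint, of s] measurable_Pair2[OF D_joint, of s] by simp_all
    have bW: "AE s in lborel. s \<in> {0..T} \<longrightarrow> ball C (W s)"
      using Ww
    proof eventually_elim
      case (elim s)
      show ?case
      proof
        assume s: "s \<in> {0..T}"
        then have "AE x in ?M. W s x = w s x" using elim by auto
        from Lp_ball_cong_AE[OF p C(2)[OF s] secM(1) this] show "ball C (W s)" .
      qed
    qed
    have bD: "AE s in lborel. s \<in> {0..T} \<longrightarrow> ball (K * C) (D s)"
    proof (rule AE_I2, rule impI)
      fix s assume s: "s \<in> {0..T}"
      then have "AE x in ?M. D s x = A (w s) x" using DA by auto
      from Lp_ball_cong_AE[OF p A_ball[OF C(2)[OF s]] secM(2) this] show "ball (K * C) (D s)" .
    qed
    have iW: "AE x in ?M. set_integrable lborel {0..T} (\<lambda>s. W s x)"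
      by (rule Lp_ball_integral(1)[OF p M T C(1) W_joint bW])
    then show "AE x in ?M. set_integrable lborel {0..T} (\<lambda>s. W s x)" .
    have iD: "AE x in ?M. set_integrable lborel {0..T} (\<lambda>s. D s x)"
      using K C by (intro Lp_ball_integral(1)[OF p M T _ D_joint bD]) auto
    define L where "L m x = (LINT s:{0..T}|lborel. lagdiff c m (T - s) * W s x)" for m x
    define \<Delta> where "\<Delta> m x = (LINT s:{0..T}|lborel. lagdiff c m (T - s) * D s x)" for m x
    define B where "B = 2 * exp (c * T)"
    have ld: "\<bar>lagdiff c m (T - s)\<bar> \<le> B" if "s \<in> {0..T}" for m s
      unfolding B_def using c that by (intro abs_lagdiff_le) auto
    have L: "ball ((T - 0) * (B * C)) (L m)" for m
      unfolding L_def[abs_def]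
    proof (rule Lp_ball_integral(2)[OF p M T])
      show "AE s in lborel. s \<in> {0..T} \<longrightarrow> ball (B * C) (\<lambda>x. lagdiff c m (T - s) * W s x)"
        using bW
      proof eventually_elim
        case (elim s)
        show ?case
        proof
          assume s: "s \<in> {0..T}"
          with elim have "ball C (W s)" by blast
          from Lp_ball_cmult[OF p this, of "lagdiff c m (T - s)"]
          have "ball (\<bar>lagdiff c m (T - s)\<bar> * C) (\<lambda>x. lagdiff c m (T - s) * W s x)" .
          then show "ball (B * C) (\<lambda>x. lagdiff c m (T - s) * W s x)"
            using mult_right_mono[OF ld[OF s] C(1)] by (rule Lp_ball_weaken[OF p])
        qed
      qed
    qed (use C in \<open>auto simp: B_def\<close>)
    \<comment> \<open>The moment of \<open>A w\<close> is \<open>A\<close> applied to the moment of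
      \<open>w\<close>; this is what closes the system of moments.\<close>
    have AL: "AE x in ?M. A (L m) x = \<Delta> m x" for m
      unfolding L_def[abs_def] \<Delta>_def
    proof (rule A_integral[OF M T W_joint D_joint, of w])
      show "AE s in lborel. s \<in> {0..T} \<longrightarrow> (AE x in ?M. W s x = w s x)"
        using Ww by eventually_elim auto
      show "AE s in lborel. s \<in> {0..T} \<longrightarrow> (AE x in ?M. D s x = A (w s) x)"
        using DA by (intro AE_I2) auto
      show "\<bar>lagdiff c m (T - s)\<bar> \<le> B" if "s \<in> {0..T}" for s using that by (rule ld)
    qed (use w cont_T in auto)
    have "AE x in ?M. \<forall>m. A (L m) x = \<Delta> m x" unfolding AE_all_countable using AL by blast
    then have rec: "AE x in ?M. (\<lambda>i. c powr (-\<alpha> x) * (binc (\<alpha> x) i * A (L (i + j)) x)) sums L j x" for j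
      using good DH iW iD AE_space
    proof eventually_elim
      case (elim x)
      note [measurable] = sec[OF elim(6)]
      have \<alpha>x: "0 < \<alpha> x" "\<alpha> x \<le> 1" using elim(2) by auto
      have Hh: "H t x = h t x" if "0 \<le> t" for t using elim(3) that by auto
      have der: "((\<lambda>s. h s x) has_real_derivative D t x) (at t within {0..})" if "0 \<le> t" for t
        using elim(3) that by auto
      have h0: "h 0 x = 0"
        using elim(2) RL_integral_at_0[of "1 - \<alpha> x"] by (cases "\<alpha> x = 1") (auto simp: h_def RL_integral_def)
      have "continuous_on {0..T} (\<lambda>s. h s x)"
        by (rule DERIV_continuous_on[OF has_field_derivative_subset[OF der]]) auto
      then have "continuous_on {0..T} (\<lambda>s. H s x)"
        by (rule continuous_on_cong[THEN iffD1, rotated 2]) (auto simp: Hh)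
      then have iH: "set_integrable lborel {0..T} (\<lambda>s. H s x)" by (rule borel_integrable_atLeastAtMost')
      \<comment> \<open>For this \<open>x\<close> the derivative exists at every time, so the
        fundamental theorem for the Henstock-Kurzweil integral recovers \<open>h\<close> without
        continuity of \<open>D\<close>; Lebesgue integrability of \<open>D\<close> then identifies
        the two integrals.\<close>
      have HD: "H t x = RL_integral 1 (\<lambda>s. D s x) t" if t: "t \<in> {0..T}" for t
      proof -
        have "((\<lambda>s. D s x) has_integral (h t x - h 0 x)) {0..t}"
          using t by (intro fundamental_theorem_of_calculus)
            (auto simp: has_real_derivative_iff_has_vector_derivative[symmetric] intro: has_field_derivative_subset[OF der])
        moreover have "set_integrable lborel {0..t} (\<lambda>s. D s x)"
          by (rule set_integrable_subset[OF elim(5)]) (use t in auto)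
        ultimately show ?thesis
          using t h0 by (simp add: RL_integral_1_lborel set_borel_integral_eq_integral integral_unique Hh)
      qed
      have HW: "AE t in lborel. t \<in> {0..T} \<longrightarrow> H t x = RL_integral (1 - \<alpha> x) (\<lambda>s. W s x) t"
      proof (cases "\<alpha> x = 1")
        case True
        have "AE s in lborel. 0 \<le> s \<longrightarrow> w s x = W s x" using elim(2) by blast
        then show ?thesis
          by eventually_elim (auto simp: True Hh h_def RL_integral_def)
      next
        case False
        then show ?thesis using elim(2) by (intro AE_I2) (auto simp: Hh h_W)
      qed
      have "(\<lambda>i. c powr (-\<alpha> x) * (binc (\<alpha> x) i * \<Delta> (i + j) x)) sums L j x"
        unfolding L_def \<Delta>_def
        by (rule kernel_identity[OF \<alpha>x _ T Wx sec[OF elim(6)] elim(4,5) iH]) (use c HD HW in auto)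
      then show ?case using elim(1) by simp
    qed
    have "AE x in ?M. L 0 x = 0"
      by (rule adjoint_system_zero[OF \<alpha> \<alpha>0(1) less_imp_le[OF \<alpha>0(2)] \<alpha>_bounds c small L rec])
    then show "AE x in ?M. (LINT s:{0..T}|lborel. (T - s) * W s x) = 0"
    proof eventually_elim
      case (elim x)
      have "lagdiff c 0 r = c * r" for r
        by (simp add: lagdiff_def lag_def)
      then have "L 0 x = c * (LINT s:{0..T}|lborel. (T - s) * W s x)"
        by (simp add: L_def mult.assoc)
      with elim c show ?case by simp
    qed
  qed

  show ?thesis
  proof (cases "t0 = 0")
    case True
    then show ?thesis using w0 by simp
  next
    case False
    with t0 have t0: "0 < t0" by simp
    show ?thesis
    proof (rule Lp_ball_arbitrarily_small[OF p])
      fix e :: real assume e: "0 < e"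
      obtain d where d: "0 < d" "\<And>r. r \<in> {0..} \<Longrightarrow> dist r t0 < d \<Longrightarrow> ball (e/2) (\<lambda>x. w r x - w t0 x)"
      proof (rule continuous_curve_near[of "{0..}" w t0 "e/2", OF _ cont])
        show "w s \<in> Lp_space ?M p" if "s \<in> {0..}" for s using w that by auto
      qed (use that t0 e in auto)
      \<comment> \<open>The tent must stay in nonnegative times and inside the neighbourhood where
        \<open>w\<close> is close to \<open>w t0\<close>.\<close>
      define \<delta> where "\<delta> = min (d / 2) t0"
      have \<delta>: "0 < \<delta>" "\<delta> \<le> t0" "\<delta> < d" using d t0 by (auto simp: \<delta>_def min_def)
      note [measurable] = w_m[OF less_imp_le[OF t0]]
      define F where "F s x = (\<delta> - \<bar>s - t0\<bar>) * (W s x - w t0 x)" for s x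
      have [measurable]: "(\<lambda>(s, x). F s x) \<in> borel_measurable (lborel \<Otimes>\<^sub>M ?M)" unfolding F_def by measurable
      have "AE s in lborel. s \<in> {t0 - \<delta>..t0 + \<delta>} \<longrightarrow> ball (\<delta> * (e/2)) (F s)"
        using Ww
      proof eventually_elim
        case (elim s)
        show ?case
        proof
          assume s: "s \<in> {t0 - \<delta>..t0 + \<delta>}"
          then have s0: "0 \<le> s" and sd: "\<bar>s - t0\<bar> \<le> \<delta>" using \<delta> by auto
          have "AE x in ?M. W s x - w t0 x = w s x - w t0 x" using elim s0 by (auto elim: eventually_mono)
          moreover have "(\<lambda>x. W s x - w t0 x) \<in> borel_measurable ?M"
            using measurable_Pair2[OF W_joint, of s] by simp
          moreover have "ball (e/2) (\<lambda>x. w s x - w t0 x)" using d(2)[of s] s0 sd \<delta> by (auto simp: dist_real_def)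
          ultimately have "ball (e/2) (\<lambda>x. W s x - w t0 x)" using Lp_ball_cong_AE[OF p] by blast
          from Lp_ball_cmult[OF p this, of "\<delta> - \<bar>s - t0\<bar>"]
          have b: "ball (\<bar>\<delta> - \<bar>s - t0\<bar>\<bar> * (e/2)) (F s)" by (simp add: F_def[abs_def])
          have "\<bar>\<delta> - \<bar>s - t0\<bar>\<bar> * (e/2) \<le> \<delta> * (e/2)" using sd e by (intro mult_right_mono) auto
          with b show "ball (\<delta> * (e/2)) (F s)" by (rule Lp_ball_weaken[OF p])
        qed
      qed
      then have "ball ((t0 + \<delta> - (t0 - \<delta>)) * (\<delta> * (e/2))) (\<lambda>x. LINT s:{t0 - \<delta>..t0 + \<delta>}|lborel. F s x)"
        using e \<delta> by (intro Lp_ball_integral(2)[OF p M]) auto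
      \<comment> \<open>The tent integral of \<open>W\<close> vanishes by the moments, so dividing
        by the mass \<open>\<delta>\<^sup>2\<close> and changing sign turns the integral of
        \<open>F\<close> into \<open>w t0\<close>. The radius is
        \<open>2 * \<delta> * (\<delta> * (e/2)) / \<delta>\<^sup>2 = e\<close>.\<close>
      from Lp_ball_cmult[OF p this, of "- 1 / \<delta>\<^sup>2"]
      have b: "ball e (\<lambda>x. (- 1 / \<delta>\<^sup>2) * (LINT s:{t0 - \<delta>..t0 + \<delta>}|lborel. F s x))"
        using \<delta> by (simp add: power2_eq_square)
      have nn: "0 \<le> t0 + \<delta>" "0 \<le> t0" "0 \<le> t0 - \<delta>" using \<delta> t0 by auto
      have "AE x in ?M. w t0 x = (- 1 / \<delta>\<^sup>2) * (LINT s:{t0 - \<delta>..t0 + \<delta>}|lborel. F s x)"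
        using conjunct1[OF moment[OF nn(1)]] conjunct2[OF moment[OF nn(1)]]
          conjunct2[OF moment[OF nn(2)]] conjunct2[OF moment[OF nn(3)]]
      proof eventually_elim
        case (elim x)
        have z: "(LINT s:{t0 - \<delta>..t0 + \<delta>}|lborel. (\<delta> - \<bar>s - t0\<bar>) * W s x) = 0"
          using elim \<delta> t0 by (subst tent_integral[OF _ Wx \<delta>(1,2)]) auto
        have "set_integrable lborel {t0 - \<delta>..t0 + \<delta>} (\<lambda>s. W s x)"
          using elim(1) \<delta> t0 by (auto intro: set_integrable_subset)
        then have i1: "set_integrable lborel {t0 - \<delta>..t0 + \<delta>} (\<lambda>s. (\<delta> - \<bar>s - t0\<bar>) * W s x)"
        proof (rule set_integrable_bound[OF set_integrable_mult_right[where a = \<delta>]])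
          show "AE s in lborel. s \<in> {t0 - \<delta>..t0 + \<delta>} \<longrightarrow> norm ((\<delta> - \<bar>s - t0\<bar>) * W s x) \<le> norm (\<delta> * W s x)"
            by (auto simp: abs_mult intro!: AE_I2 mult_right_mono)
        qed (auto simp: set_borel_measurable_def)
        have i2: "set_integrable lborel {t0 - \<delta>..t0 + \<delta>} (\<lambda>s. \<delta> - \<bar>s - t0\<bar>)"
          by (intro borel_integrable_atLeastAtMost' continuous_intros)
        have "(LINT s:{t0 - \<delta>..t0 + \<delta>}|lborel. F s x)
            = (LINT s:{t0 - \<delta>..t0 + \<delta>}|lborel. (\<delta> - \<bar>s - t0\<bar>) * W s x - (\<delta> - \<bar>s - t0\<bar>) * w t0 x)"
          by (simp add: F_def right_diff_distrib)
        also have "\<dots> = - (\<delta>\<^sup>2 * w t0 x)"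
          using i1 i2 z tent_integral_1[OF \<delta>(1,2)] by (subst set_integral_diff) auto
        finally show ?case using \<delta> by simp
      qed
      from Lp_ball_cong_AE[OF p b w_m[OF less_imp_le[OF t0]] this]
      show "\<exists>C\<le>e. ball C (w t0)" by blast
    qed
  qed
qed

theorem theorem22:
  fixes p :: ereal
    and \<Omega> :: "(real ^ 'n) set"
    and A :: "(real ^ 'n \<Rightarrow> real) \<Rightarrow> (real ^ 'n \<Rightarrow> real)"
    and \<alpha>0 :: real
    and \<alpha> u0 :: "real ^ 'n \<Rightarrow> real"
  assumes "1 \<le> p"
    and "open \<Omega>"
    and "bounded_linear_Lp (lebesgue_on \<Omega>) p A"
    and "0 < \<alpha>0" and "\<alpha>0 < 1"
    and "\<alpha> \<in> Lp_space (lebesgue_on \<Omega>) \<infinity>"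
    and "AE x in lebesgue_on \<Omega>. \<alpha>0 \<le> \<alpha> x \<and> \<alpha> x \<le> 1"
    and "u0 \<in> Lp_space (lebesgue_on \<Omega>) p"
  shows "\<exists>u. solves_Cauchy_problem {0..} \<Omega> p \<alpha> A u0 u \<and>
           (\<forall>v. solves_Cauchy_problem {0..} \<Omega> p \<alpha> A u0 v \<longrightarrow>
                (\<forall>t\<in>{0..}. AE x in lebesgue_on \<Omega>. v t x = u t x))"
proof -
  have \<alpha>: "\<alpha> \<in> borel_measurable (lebesgue_on \<Omega>)" using assms(6) by (simp add: Lp_space_def)
  obtain u where u: "solves_Cauchy_problem {0..} \<Omega> p \<alpha> A u0 u"
    using Cauchy_problem_solution_exists[OF assms(1-5) \<alpha> assms(7,8)] by blast
  have "AE x in lebesgue_on \<Omega>. v t x = u t x"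
    if v: "solves_Cauchy_problem {0..} \<Omega> p \<alpha> A u0 v" and t: "t \<in> {0..}" for v t
  proof -
    have "AE x in lebesgue_on \<Omega>. v t x - u t x = 0"
      using t by (intro Cauchy_problem_zero_solution[OF assms(1-5) \<alpha> assms(7)
        solves_Cauchy_problem_diff[OF assms(1,3) v u]]) auto
    then show ?thesis by eventually_elim simp
  qed
  with u show ?thesis by blast
qed

end
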